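(* For every integer $n\ge 1$ there exists a constant $c_n>0$, depending only on the dimension $n$, such that the following holds. Let $w\in A_\infty$ be a Muckenhoupt weight on $\mathbb{R}^n$, with Fujii–Wilson constant $[w]_{A_\infty}$, and for $\alpha\in(0,1)$ let $$\mathsf{C}_{\mathsf{HL},w}(\alpha) := \sup_{\substack{E\subset\mathbb{R}^n\text{ measurable}\\ 0<w(E)<\infty}} \frac{1}{w(E)}\, w\big(\{x\in\mathbb{R}^n : \mathsf{M}\chi_E(x)>\alpha\}\big),$$ where $\mathsf{M}$ is the uncentered Hardy–Littlewood maximal operator on $\mathbb{R}^n$ with respect to cubes. Then $$\mathsf{C}_{\mathsf{HL},w}\in C^{(c_n[w]_{A_\infty})^{-1}}(0,1).$$
   Context: Cubes in $\mathbb{R}^n$ have sides parallel to the coordinate axes. The uncentered Hardy–Littlewood maximal operator with respect to cubes is $$\mathsf{M}f(x):=\sup_{Q\ni x}\frac{1}{|Q|}\int_Q|f|,$$ the supremum being over all cubes $Q\subset\mathbb{R}^n$ containing $x$; $|\cdot|$ is Lebesgue measure and $\chi_E$ is the indicator function of $E$. A weight $w$ is a non-negative, locally integrable function on $\mathbb{R}^n$, not almost everywhere equal to $0$, and $w(E):=\int_E w$ for measurable $E$. The weight $w$ belongs to the Muckenhoupt class $A_\infty$ if and only if its Fujii–Wilson constant is finite: $$[w]_{A_\infty}:=\sup_Q\frac{1}{w(Q)}\int_Q\mathsf{M}(w\chi_Q)<+\infty,$$ where the supremum is over all cubes $Q$ in $\mathbb{R}^n$ (with $w(Q)>0$). Local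 Hölder classes: for an interval $I\subset\mathbb{R}$ and an exponent $p>0$, a real-valued function $f$ on $I$ lies in $C^p(I)$ if for every compact set $K\subset I$ there is a constant $C_K$ (which may also depend on $f$) such that $|f(x)-f(y)|\le C_K|x-y|^p$ for all $x,y\in K$. *)

theory Defs
  imports "HOL-Analysis.Analysis"
begin

(* Cubes are closed and nondegenerate; averages over open or half-open cubes of the same
   side length are the same, and using open cubes instead gives the same suprema below. *)
definition is_cube :: "(real ^ 'n) set \<Rightarrow> bool" where
  "is_cube Q \<longleftrightarrow> (\<exists>a l. l > 0 \<and> Q = cbox a (\<chi> i. a $ i + l))"

(* Values are extended nonnegative reals: the supremum may be infinite. *)
definition maximal_op :: "(real ^ 'n \<Rightarrow> real) \<Rightarrow> real ^ 'n \<Rightarrow> ennreal" where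
  "maximal_op f x =
     (SUP Q \<in> {Q. is_cube Q \<and> x \<in> Q}.
        (\<integral>\<^sup>+y\<in>Q. ennreal \<bar>f y\<bar> \<partial>lebesgue) / emeasure lebesgue Q)"

definition is_weight :: "(real ^ 'n \<Rightarrow> real) \<Rightarrow> bool" where
  "is_weight w \<longleftrightarrow>
     (\<forall>x. 0 \<le> w x) \<and>
     (\<forall>K. compact K \<longrightarrow> set_integrable lebesgue K w) \<and>
     \<not> (AE x in lebesgue. w x = 0)"

definition weight_of :: "(real ^ 'n \<Rightarrow> real) \<Rightarrow> (real ^ 'n) set \<Rightarrow> ennreal" where
  "weight_of w E = (\<integral>\<^sup>+x\<in>E. ennreal (w x) \<partial>lebesgue)"

definition fujii_wilson :: "(real ^ 'n \<Rightarrow> real) \<Rightarrow> ennreal" where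
  "fujii_wilson w =
     (SUP Q \<in> {Q. is_cube Q \<and> 0 < weight_of w Q}.
        (\<integral>\<^sup>+x\<in>Q. maximal_op (\<lambda>y. w y * indicator Q y) x \<partial>lebesgue) / weight_of w Q)"

definition A_infty :: "(real ^ 'n \<Rightarrow> real) set" where
  "A_infty = {w. is_weight w \<and> fujii_wilson w < \<infinity>}"

definition C_HL :: "(real ^ 'n \<Rightarrow> real) \<Rightarrow> real \<Rightarrow> ennreal" where
  "C_HL w \<alpha> =
     (SUP E \<in> {E \<in> sets lebesgue. 0 < weight_of w E \<and> weight_of w E < \<infinity>}.
        weight_of w {x. maximal_op (indicator E) x > ennreal \<alpha>} / weight_of w E)"

definition local_holder :: "real \<Rightarrow> real set \<Rightarrow> (real \<Rightarrow> real) set" where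
  "local_holder p I =
     {f. \<forall>K. compact K \<and> K \<subseteq> I \<longrightarrow>
           (\<exists>C. \<forall>x\<in>K. \<forall>y\<in>K. \<bar>f x - f y\<bar> \<le> C * \<bar>x - y\<bar> powr p)}"

end

theory Submission
  imports Defs
begin

text \<open>
  Write \<open>H \<alpha> E = {x. M \<chi>\<^sub>E x > \<alpha>}\<close> (below: \<open>halo \<alpha> E\<close>), \<open>C(\<alpha>)\<close> for the
  constant \<open>C_HL w \<alpha>\<close>, \<open>K\<close> for the Fujii-Wilson constant of \<open>w\<close> and \<open>n\<close> for the
  dimension. Two facts give the theorem.

  First, a halo can be reached in two steps (\<open>halo_gain\<close>):
  \<open>H \<alpha> E \<subseteq> H \<beta> (H \<gamma> E)\<close> as soon as \<open>\<beta> \<le> \<alpha> (1 + (1 - \<gamma>) / 2\<^sup>n\<^sup>+\<^sup>1)\<close>. Indeed, a cube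
  \<open>Q\<close> in which \<open>E\<close> has density above \<open>\<gamma>\<close> is contained in \<open>H \<gamma> E\<close>. If the density is above \<open>\<alpha>\<close>
  but at most \<open>\<gamma>\<close>, then almost all of \<open>E \<inter> Q\<close> is covered by
  disjoint dyadic subcubes, each of which contains a comparable cube where the density of \<open>E\<close>
  is above \<open>\<gamma>\<close> and at most \<open>(1 + \<gamma>) / 2\<close>. Such a cube lies in \<open>H \<gamma> E\<close> and
  a fixed part of it is outside \<open>E\<close>, so \<open>H \<gamma> E\<close> occupies a fixed proportion more of \<open>Q\<close>
  than \<open>E\<close> does. Consequently \<open>C(\<alpha>) \<le> C(\<beta>) C(\<gamma>)\<close> (\<open>C_HL_submult\<close>).

  Second, a Solyanik estimate \<open>C(1 - t) \<le> 1 + B t\<^sup>p\<close> holds for small \<open>t\<close>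
  (\<open>solyanik_weighted\<close>), with \<open>p\<close> of the form \<open>1 / (c K)\<close> where \<open>c\<close> depends on \<open>n\<close> only. Here and
  below \<open>c\<close> and \<open>B\<close> may change from line to line, and \<open>B\<close> may depend on \<open>w\<close>.

  Iterating the first fact from a level near \<open>1\<close>, where the second one applies, shows that
  \<open>C\<close> is finite on \<open>(0, 1)\<close>. For \<open>x < y\<close>, taking \<open>\<gamma> = 1 - t\<close> with \<open>t\<close> proportional to
  \<open>(y - x) / x\<close> gives \<open>C(x) \<le> C(y) (1 + B t\<^sup>p)\<close>, which is the Hoelder bound because \<open>C\<close> is
  decreasing.

  The Solyanik estimate combines two ingredients. One is the quantitative absolute continuity
  \<open>w(A) / w(Q) \<le> B (|A| / |Q|)\<^sup>1\<^sup>/\<^sup>(\<^sup>c\<^sup>K\<^sup>)\<close> for \<open>A \<subseteq> Q\<close> (\<open>A_infty_estimate\<close>): the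
  \<open>w\<close>-masses of the level sets of the dyadic maximal function of \<open>w\<close> on \<open>Q\<close> decay like
  \<open>(1 - 1 / (c K))\<^sup>k\<close> at the heights \<open>2\<^sup>k\<close>, since the Fujii-Wilson condition bounds the sum of
  the later masses by \<open>c K\<close> times the present one. The other is the estimate for Lebesgue
  measure, in the form
  \<open>|\<Union>F - E| \<le> B \<epsilon>\<^sup>1\<^sup>/\<^sup>2\<^sup>n |\<Union>F|\<close> for finite families \<open>F\<close> of cubes in which \<open>E\<close> misses at
  most the proportion \<open>\<epsilon>\<close> (\<open>solyanik_unweighted\<close>). There, trimming all cubes by a
  factor \<open>1 - \<epsilon>\<^sup>1\<^sup>/\<^sup>2\<^sup>n\<close> costs little measure, and what remains is covered by disjoint
  dyadic cubes in which \<open>E\<close> still misses little. A Vitali selection localizes the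
  Lebesgue estimate to triples of disjoint cubes, where absolute continuity turns it into an
  estimate for \<open>w\<close>.
\<close>

section \<open>Cubes and dyadic cubes\<close>

definition cube :: "real ^ 'n \<Rightarrow> real \<Rightarrow> (real ^ 'n) set" where
  "cube c r = {x. \<forall>i. \<bar>x $ i - c $ i\<bar> \<le> r}"

lemma cube_eq_cbox: "cube c r = cbox (\<chi> i. c $ i - r) (\<chi> i. c $ i + r)"
  by (auto simp: cube_def mem_box_cart abs_le_iff algebra_simps)

lemma is_cube_iff: "is_cube Q \<longleftrightarrow> (\<exists>c r. r > 0 \<and> Q = cube c r)"
proof
  assume "is_cube Q"
  then obtain a l where l: "l > 0" "Q = cbox a (\<chi> i. a $ i + l)"
    by (auto simp: is_cube_def)
  have "Q = cube (\<chi> i. a $ i + l/2) (l/2)"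
    by (simp add: l(2) cube_eq_cbox algebra_simps vec_lambda_eta)
  then show "\<exists>c r. r > 0 \<and> Q = cube c r" using l(1) by (metis half_gt_zero)
next
  assume "\<exists>c r. r > 0 \<and> Q = cube c r"
  then obtain c r where r: "r > 0" "Q = cube c r" by auto
  show "is_cube Q" unfolding is_cube_def
    by (rule exI[of _ "\<chi> i. c $ i - r"], rule exI[of _ "2 * r"])
       (use r in \<open>simp add: cube_eq_cbox algebra_simps\<close>)
qed

lemma cube_lmeasurable [simp, intro]: "cube c r \<in> lmeasurable"
  by (simp add: cube_eq_cbox)

lemma cube_sets [measurable, simp]: "cube c r \<in> sets lebesgue"
  using cube_lmeasurable by blast

lemma measure_cube:
  assumes "0 \<le> r"
  shows "measure lebesgue (cube (c :: real ^ 'n) r) = (2 * r) ^ CARD('n)"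
proof -
  have "cbox (\<chi> i. c $ i - r) (\<chi> i. c $ i + r) \<noteq> {}"
    using assms by (simp add: interval_ne_empty_cart)
  then show ?thesis
    by (simp add: cube_eq_cbox content_cbox_cart)
qed

lemma emeasure_cube:
  assumes "0 \<le> r"
  shows "emeasure lebesgue (cube (c :: real ^ 'n) r) = ennreal ((2 * r) ^ CARD('n))"
  using measure_cube[OF assms, of c] by (metis cube_lmeasurable emeasure_eq_measure2)

lemma cube_mono: "r \<le> s \<Longrightarrow> cube c r \<subseteq> cube c s"
  by (auto simp: cube_def intro: order_trans)

text \<open>The half-open dyadic cube of side \<open>l / 2\<^sup>m\<close> through \<open>x\<close>, in the grid with base point
\<open>a\<close>. Describing it as the class of the points with the same integer parts makes
the cubes of one level a partition for free, and nestedness becomes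
\<open>\<lfloor>2u\<rfloor> div 2 = \<lfloor>u\<rfloor>\<close>.\<close>

definition dyadic :: "real ^ 'n \<Rightarrow> real \<Rightarrow> nat \<Rightarrow> real ^ 'n \<Rightarrow> (real ^ 'n) set" where
  "dyadic a l m x = {y. \<forall>i. \<lfloor>(y $ i - a $ i) * 2 ^ m / l\<rfloor> = \<lfloor>(x $ i - a $ i) * 2 ^ m / l\<rfloor>}"

lemma dyadic_self [simp, intro]: "x \<in> dyadic a l m x"
  by (simp add: dyadic_def)

lemma dyadic_eq: "y \<in> dyadic a l m x \<Longrightarrow> dyadic a l m y = dyadic a l m x"
  by (auto simp: dyadic_def)

lemma dyadic_Suc: "dyadic a l (Suc m) x \<subseteq> dyadic a l m x"
proof -
  have *: "\<lfloor>u\<rfloor> = \<lfloor>2 * u\<rfloor> div 2" for u :: real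
    using floor_divide_real_eq_div[of 2 "2 * u"] by simp
  have "\<lfloor>u\<rfloor> = \<lfloor>v\<rfloor>" if "\<lfloor>2 * u\<rfloor> = \<lfloor>2 * v\<rfloor>" for u v :: real
    using that *[of u] *[of v] by simp
  note ** = this
  have e: "(u :: real) * 2 ^ Suc m / l = 2 * (u * 2 ^ m / l)" for u by simp
  show ?thesis unfolding dyadic_def e
    by (intro Collect_mono impI allI, rule **, erule spec)
qed

lemma dyadic_antimono: "j \<le> m \<Longrightarrow> dyadic a l m x \<subseteq> dyadic a l j x"
  by (induction rule: dec_induct) (use dyadic_Suc in blast)+

definition dyadic_center :: "real ^ 'n \<Rightarrow> real \<Rightarrow> nat \<Rightarrow> real ^ 'n \<Rightarrow> real ^ 'n" where
  "dyadic_center a l m x = (\<chi> i. a $ i + (of_int \<lfloor>(x $ i - a $ i) * 2 ^ m / l\<rfloor> + 1/2) * (l / 2 ^ m))"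

text \<open>The cube with center \<open>c\<close> and half side \<open>r\<close> is, up to its boundary, the level \<open>0\<close> cube of this
grid. It serves as the root of the decompositions inside a given cube.\<close>

lemma dyadic_center_root:
  assumes "r > 0" shows "dyadic_center (\<chi> i. c $ i - r) (2 * r) 0 c = c"
proof -
  have "\<lfloor>r / (2 * r)\<rfloor> = 0" using assms by (simp add: floor_eq_iff)
  then show ?thesis using assms by (simp add: dyadic_center_def vec_eq_iff)
qed

lemma dyadic_iff:
  assumes "l > 0"
  shows "y \<in> dyadic a l m x \<longleftrightarrow>
    (\<forall>i. dyadic_center a l m x $ i - l / 2 ^ m / 2 \<le> y $ i \<and> y $ i < dyadic_center a l m x $ i + l / 2 ^ m / 2)"
proof -
  have "\<lfloor>u * 2 ^ m / l\<rfloor> = k \<longleftrightarrow> (of_int k + 1/2) * (l / 2 ^ m) - l / 2 ^ m / 2 \<le> u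
      \<and> u < (of_int k + 1/2) * (l / 2 ^ m) + l / 2 ^ m / 2" for u :: real and k
  proof -
    have "\<lfloor>u * 2 ^ m / l\<rfloor> = k \<longleftrightarrow> of_int k * (l / 2^m) \<le> u \<and> u < (of_int k + 1) * (l / 2^m)"
      unfolding floor_eq_iff using assms by (simp add: field_simps)
    then show ?thesis by (simp add: algebra_simps add_divide_distrib)
  qed
  note * = this
  have "(\<lfloor>(y $ i - a $ i) * 2 ^ m / l\<rfloor> = \<lfloor>(x $ i - a $ i) * 2 ^ m / l\<rfloor>) \<longleftrightarrow>
     dyadic_center a l m x $ i - l / 2 ^ m / 2 \<le> y $ i \<and> y $ i < dyadic_center a l m x $ i + l / 2 ^ m / 2" for i
    unfolding * by (auto simp: dyadic_center_def)
  then show ?thesis by (simp add: dyadic_def)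
qed

lemma dyadic_subset_cube:
  assumes "l > 0" shows "dyadic a l m x \<subseteq> cube (dyadic_center a l m x) (l / 2 ^ m / 2)"
  using assms by (auto simp: cube_def dyadic_iff abs_le_iff algebra_simps) (smt (verit))+

lemma dyadic_borel: assumes "l > 0" shows "dyadic a l m x \<in> sets borel"
proof -
  have "dyadic a l m x = (\<Inter>i. {y. dyadic_center a l m x $ i - l / 2 ^ m / 2 \<le> y $ i} \<inter> {y. y $ i < dyadic_center a l m x $ i + l / 2 ^ m / 2})"
    using dyadic_iff[OF assms, of _ a m x] by auto
  also have "\<dots> \<in> sets borel"
    by (intro sets.finite_INT sets.Int borel_closed borel_open closed_halfspace_component_ge_cart
          open_halfspace_component_lt_cart) auto
  finally show ?thesis .
qed

lemma dyadic_sets: "l > 0 \<Longrightarrow> dyadic a l m x \<in> sets lebesgue"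
  by (simp add: dyadic_borel)

text \<open>The cube lies between an open box and a closed cube of the same volume.\<close>

lemma emeasure_dyadic:
  assumes "l > 0"
  shows "emeasure lebesgue (dyadic (a :: real ^ 'n) l m x) = ennreal ((l / 2 ^ m) ^ CARD('n))"
proof (rule antisym)
  have "emeasure lebesgue (dyadic a l m x) \<le> emeasure lebesgue (cube (dyadic_center a l m x) (l / 2 ^ m / 2))"
    by (intro emeasure_mono dyadic_subset_cube assms) auto
  also have "\<dots> = ennreal ((l / 2 ^ m) ^ CARD('n))"
    using assms by (subst emeasure_cube) auto
  finally show "emeasure lebesgue (dyadic a l m x) \<le> ennreal ((l / 2 ^ m) ^ CARD('n))" .
next
  let ?u = "\<chi> i. dyadic_center a l m x $ i - l / 2 ^ m / 2" and ?v = "\<chi> i. dyadic_center a l m x $ i + l / 2 ^ m / 2"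
  have "emeasure lebesgue (box ?u ?v) \<le> emeasure lebesgue (dyadic a l m x)"
    using dyadic_sets[OF assms] by (intro emeasure_mono) (auto simp: dyadic_iff[OF assms] mem_box_cart less_imp_le)
  moreover have "emeasure lebesgue (box ?u ?v) = emeasure lebesgue (cbox ?u ?v)"
    by (simp add: emeasure_lborel_box_eq emeasure_lborel_cbox_eq)
  moreover have "\<dots> = ennreal ((l / 2 ^ m) ^ CARD('n))"
    using emeasure_cube[of "l / 2 ^ m / 2" "dyadic_center a l m x"] assms unfolding cube_eq_cbox by simp
  ultimately show "ennreal ((l / 2 ^ m) ^ CARD('n)) \<le> emeasure lebesgue (dyadic a l m x)" by simp
qed

lemma dyadic_lmeasurable: "l > 0 \<Longrightarrow> dyadic a l m x \<in> lmeasurable"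
  by (rule fmeasurableI) (use dyadic_sets emeasure_dyadic[of l a m x] in \<open>auto simp del: emeasure_completion\<close>)

lemma measure_dyadic:
  "l > 0 \<Longrightarrow> measure lebesgue (dyadic (a :: real ^ 'n) l m x) = (l / 2 ^ m) ^ CARD('n)"
  by (simp add: measure_def emeasure_dyadic)

lemma countable_dyadic: "countable {dyadic a l m x |m x. True}"
proof (rule countable_subset)
  let ?g = "\<lambda>(m :: nat, k :: 'a \<Rightarrow> int). {y :: real ^ 'a. \<forall>i. \<lfloor>(y $ i - a $ i) * 2 ^ m / l\<rfloor> = k i}"
  show "{dyadic a l m x |m x. True} \<subseteq> range ?g"
  proof clarify
    fix m x
    have "dyadic a l m x = ?g (m, \<lambda>i. \<lfloor>(x $ i - a $ i) * 2 ^ m / l\<rfloor>)" by (simp add: dyadic_def)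
    then show "dyadic a l m x \<in> range ?g" by blast
  qed
qed auto

lemma dyadic_small:
  assumes "open U" "x \<in> U" "l > 0"
  obtains m where "dyadic a l m x \<subseteq> U"
proof -
  obtain e where e: "e > 0" "ball x e \<subseteq> U" using assms open_contains_ball by blast
  define N where "N = real CARD('a)"
  have "N > 0" by (simp add: N_def)
  obtain m :: nat where m: "2 ^ m > l * N / e"
    using real_arch_pow[of 2 "l * N / e"] by auto
  have lm: "l / 2 ^ m * N < e" using m e(1) \<open>N > 0\<close> by (simp add: field_simps)
  have "dyadic a l m x \<subseteq> ball x e"
  proof
    fix y assume y: "y \<in> dyadic a l m x"
    have x: "x \<in> dyadic a l m x" by simp
    have "\<bar>(x - y) $ i\<bar> \<le> l / 2 ^ m" for i
      using x[unfolded dyadic_iff[OF assms(3)], rule_format, of i] y[unfolded dyadic_iff[OF assms(3)], rule_format, of i]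
      by (simp add: abs_le_iff)
    then have "norm (x - y) \<le> (\<Sum>i\<in>(UNIV :: 'a set). l / 2 ^ m)"
      by (intro order_trans[OF norm_le_l1_cart sum_mono]) auto
    also have "\<dots> < e" using lm by (simp add: N_def mult.commute)
    finally show "y \<in> ball x e" by (simp add: dist_norm)
  qed
  then show ?thesis using e that by blast
qed

lemma emeasure_density_indicator:
  assumes "E \<in> sets lebesgue" "A \<in> sets lebesgue"
  shows "emeasure (density lebesgue (indicator E)) A = emeasure lebesgue (E \<inter> A)"
proof -
  have "emeasure (density lebesgue (indicator E)) A = (\<integral>\<^sup>+x. indicator E x * indicator A x \<partial>lebesgue)"
    using assms by (intro emeasure_density) auto
  also have "\<dots> = (\<integral>\<^sup>+x. indicator (E \<inter> A) x \<partial>lebesgue)"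
    by (intro nn_integral_cong) (auto simp: indicator_def)
  finally show ?thesis using assms by (simp del: emeasure_completion)
qed

lemma emeasure_disjoint_family_le:
  assumes F: "countable F" "disjoint F" "\<And>P. P \<in> F \<Longrightarrow> P \<in> sets \<mu>"
    and sets: "sets \<mu> = sets \<nu>"
    and le: "\<And>P. P \<in> F \<Longrightarrow> emeasure \<mu> P \<le> c * emeasure \<nu> P"
  shows "emeasure \<mu> (\<Union>F) \<le> c * emeasure \<nu> (\<Union>F)"
proof -
  have d: "disjoint_family_on (\<lambda>P. P) F"
    using F(2) by (simp add: disjoint_family_on_def disjoint_def)
  have "emeasure \<mu> (\<Union>P\<in>F. P) = (\<integral>\<^sup>+P. emeasure \<mu> P \<partial>count_space F)"
    using F d by (intro emeasure_UN_countable) auto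
  also have "\<dots> \<le> (\<integral>\<^sup>+P. c * emeasure \<nu> P \<partial>count_space F)"
    using le by (intro nn_integral_mono) auto
  also have "\<dots> = c * (\<integral>\<^sup>+P. emeasure \<nu> P \<partial>count_space F)"
    by (rule nn_integral_cmult) simp
  also have "(\<integral>\<^sup>+P. emeasure \<nu> P \<partial>count_space F) = emeasure \<nu> (\<Union>P\<in>F. P)"
    using F d sets by (intro emeasure_UN_countable[symmetric]) auto
  finally show ?thesis by simp
qed

text \<open>The form in which all Calderon-Zygmund arguments below are used. The points lying in some
dyadic cube with property \<open>\<phi>\<close> are the disjoint union of the maximal such cubes, so a
comparison of two measures on the maximal cubes passes to the whole set.\<close>

lemma dyadic_stopping:
  assumes l: "l > 0"
    and sets: "sets \<mu> = sets lebesgue" "sets \<nu> = sets lebesgue"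
    and le: "\<And>m x. \<phi> (dyadic a l m x) \<Longrightarrow> (\<And>j. j < m \<Longrightarrow> \<not> \<phi> (dyadic a l j x)) \<Longrightarrow>
               emeasure \<mu> (dyadic a l m x) \<le> c * emeasure \<nu> (dyadic a l m x)"
  shows "emeasure \<mu> {x. \<exists>m. \<phi> (dyadic a l m x)} \<le> c * emeasure \<nu> {x. \<exists>m. \<phi> (dyadic a l m x)}"
proof -
  define F where "F = {dyadic a l m x |m x. \<phi> (dyadic a l m x) \<and> (\<forall>j<m. \<not> \<phi> (dyadic a l j x))}"
  have U: "{x. \<exists>m. \<phi> (dyadic a l m x)} = \<Union>F"
  proof (intro set_eqI iffI)
    fix x assume "x \<in> {x. \<exists>m. \<phi> (dyadic a l m x)}"
    then obtain m where "\<phi> (dyadic a l m x)" "\<forall>j<m. \<not> \<phi> (dyadic a l j x)"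
      using exists_least_iff[of "\<lambda>m. \<phi> (dyadic a l m x)"] by auto
    then show "x \<in> \<Union>F" unfolding F_def by blast
  next
    fix x assume "x \<in> \<Union>F"
    then obtain m y where "x \<in> dyadic a l m y" "\<phi> (dyadic a l m y)" unfolding F_def by blast
    then have "\<phi> (dyadic a l m x)" by (simp add: dyadic_eq)
    then show "x \<in> {x. \<exists>m. \<phi> (dyadic a l m x)}" by blast
  qed
  have "countable F"
    by (rule countable_subset[OF _ countable_dyadic[of a l]]) (auto simp: F_def)
  moreover have "disjoint F"
  proof (rule disjointI)
    fix P P' assume P: "P \<in> F" "P' \<in> F" "P \<noteq> P'"
    show "P \<inter> P' = {}"
    proof (rule ccontr)
      assume "P \<inter> P' \<noteq> {}"
      then obtain z where z: "z \<in> P" "z \<in> P'" by blast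
      obtain m x where mx: "P = dyadic a l m x" "\<phi> P" "\<forall>j<m. \<not> \<phi> (dyadic a l j x)" using P unfolding F_def by blast
      obtain m' x' where mx': "P' = dyadic a l m' x'" "\<phi> P'" "\<forall>j<m'. \<not> \<phi> (dyadic a l j x')"
        using P unfolding F_def by blast
      have e: "P = dyadic a l m z" "P' = dyadic a l m' z" using mx mx' z dyadic_eq by metis+
      have "dyadic a l j x = dyadic a l j z" if "j \<le> m" for j
        using dyadic_antimono[OF that, of a l x] z(1) mx(1) dyadic_eq by blast
      moreover have "dyadic a l j x' = dyadic a l j z" if "j \<le> m'" for j
        using dyadic_antimono[OF that, of a l x'] z(2) mx'(1) dyadic_eq by blast
      ultimately have "\<not> m < m'" "\<not> m' < m" using e mx mx' by (auto simp: less_imp_le)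
      then show False using e P(3) by auto
    qed
  qed
  moreover have "P \<in> sets lebesgue" if "P \<in> F" for P
    using that dyadic_sets[OF l] unfolding F_def by fast
  ultimately show ?thesis unfolding U
    using sets le by (intro emeasure_disjoint_family_le) (auto simp: F_def)
qed

lemma dyadic_Union_sets:
  assumes "l > 0" shows "{x. \<exists>m. \<phi> (dyadic a l m x)} \<in> sets lebesgue"
proof -
  let ?F = "{P. P \<in> {dyadic a l m x |m x. True} \<and> \<phi> P}"
  have "{x. \<exists>m. \<phi> (dyadic a l m x)} = \<Union>?F"
  proof (intro set_eqI iffI)
    fix x assume "x \<in> \<Union>?F"
    then obtain m y where "x \<in> dyadic a l m y" "\<phi> (dyadic a l m y)" by blast
    then have "\<phi> (dyadic a l m x)" by (simp add: dyadic_eq)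
    then show "x \<in> {x. \<exists>m. \<phi> (dyadic a l m x)}" by blast
  qed auto
  moreover have "countable ?F" by (rule countable_subset[OF _ countable_dyadic[of a l]]) auto
  moreover have "?F \<subseteq> sets lebesgue" using dyadic_sets[OF assms] by blast
  ultimately show ?thesis by (simp only: sets.countable_Union)
qed

text \<open>A substitute for Lebesgue differentiation: an upper bound for the averages of \<open>\<mu>\<close> over all
dyadic cubes meeting \<open>A\<close> bounds \<open>\<mu>\<close> on \<open>A\<close> itself. Cover \<open>A\<close> by the maximal
dyadic cubes that meet \<open>A\<close> and stay in an open set of almost the same measure.\<close>

lemma dyadic_density:
  assumes l: "l > 0" and A: "A \<in> sets lebesgue" and mu: "sets \<mu> = sets lebesgue" and lam: "lam < \<infinity>"
    and le: "\<And>m x. x \<in> A \<Longrightarrow> emeasure \<mu> (dyadic a l m x) \<le> lam * emeasure lebesgue (dyadic a l m x)"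
  shows "emeasure \<mu> A \<le> lam * emeasure lebesgue A"
proof (rule ennreal_le_epsilon)
  fix e :: real assume "e > 0"
  obtain L where L: "L \<ge> 0" "lam = ennreal L" using lam by (cases lam) auto
  define d where "d = e / (L + 1)"
  have d: "d > 0" using \<open>e > 0\<close> L by (simp add: d_def)
  obtain U where U: "open U" "A \<subseteq> U" "U - A \<in> lmeasurable" "emeasure lebesgue (U - A) < ennreal d"
    using sets_lebesgue_outer_open[OF A d] by metis
  define O1 where "O1 = {x. \<exists>m. dyadic a l m x \<subseteq> U \<and> dyadic a l m x \<inter> A \<noteq> {}}"
  have AO: "A \<subseteq> O1"
  proof
    fix x assume "x \<in> A"
    then obtain m where "dyadic a l m x \<subseteq> U" using dyadic_small[OF U(1) _ l, of x a] U(2) by blast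
    then show "x \<in> O1" using \<open>x \<in> A\<close> unfolding O1_def by blast
  qed
  have OU: "O1 \<subseteq> U" using dyadic_self unfolding O1_def by blast
  have O1m: "O1 \<in> sets lebesgue"
    unfolding O1_def by (rule dyadic_Union_sets[OF l])
  have "emeasure \<mu> A \<le> emeasure \<mu> O1" using AO O1m mu by (intro emeasure_mono) auto
  also have "\<dots> \<le> lam * emeasure lebesgue O1" unfolding O1_def
  proof (rule dyadic_stopping[OF l mu])
    fix m x assume "dyadic a l m x \<subseteq> U \<and> dyadic a l m x \<inter> A \<noteq> {}"
    then obtain y where "y \<in> A" "y \<in> dyadic a l m x" by blast
    then show "emeasure \<mu> (dyadic a l m x) \<le> lam * emeasure lebesgue (dyadic a l m x)"
      using le[of y m] dyadic_eq by metis
  qed simp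
  also have "\<dots> \<le> lam * (emeasure lebesgue A + emeasure lebesgue (U - A))"
  proof (intro mult_left_mono)
    have "emeasure lebesgue O1 \<le> emeasure lebesgue (A \<union> (U - A))"
      using OU A U by (intro emeasure_mono) auto
    also have "\<dots> \<le> emeasure lebesgue A + emeasure lebesgue (U - A)"
      using A U by (intro emeasure_subadditive) auto
    finally show "emeasure lebesgue O1 \<le> emeasure lebesgue A + emeasure lebesgue (U - A)" .
  qed simp
  also have "\<dots> \<le> lam * emeasure lebesgue A + lam * ennreal d"
    using U(4) by (simp add: distrib_left add_left_mono mult_left_mono less_imp_le)
  also have "lam * ennreal d \<le> ennreal e"
    using L d \<open>e > 0\<close> by (simp add: d_def ennreal_mult[symmetric] field_simps)
  finally show "emeasure \<mu> A \<le> lam * emeasure lebesgue A + ennreal e"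
    by (simp add: add_left_mono)
qed

section \<open>Quantitative absolute continuity of weights\<close>

definition weight_measure :: "(real ^ 'n \<Rightarrow> real) \<Rightarrow> (real ^ 'n) measure" where
  "weight_measure w = density lebesgue (\<lambda>x. ennreal (w x))"

lemma sets_weight_measure [simp, measurable_cong]: "sets (weight_measure w) = sets lebesgue"
  by (simp add: weight_measure_def)

lemma is_weight_measurable:
  assumes "is_weight w" shows "w \<in> borel_measurable lebesgue"
proof (rule borel_measurable_LIMSEQ_real)
  let ?u = "\<lambda>i x. indicator (cball 0 (real i)) x *\<^sub>R w x"
  show "?u i \<in> borel_measurable lebesgue" for i
  proof (rule borel_measurable_integrable)
    show "integrable lebesgue (?u i)"
      using assms compact_cball[of "0 :: real ^ 'a" "real i"] unfolding is_weight_def set_integrable_def by metis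
  qed
  show "(\<lambda>i. ?u i x) \<longlonglongrightarrow> w x" for x
  proof (rule tendsto_eventually)
    have "\<forall>\<^sub>F i in sequentially. norm x \<le> real i"
      using eventually_ge_at_top[of "nat \<lceil>norm x\<rceil>"] by eventually_elim linarith
    then show "\<forall>\<^sub>F i in sequentially. ?u i x = w x"
      by eventually_elim (simp add: dist_norm)
  qed
qed

lemma weight_of_eq:
  assumes "is_weight w" "E \<in> sets lebesgue"
  shows "weight_of w E = emeasure (weight_measure w) E"
  unfolding weight_of_def weight_measure_def
  using is_weight_measurable[OF assms(1)] assms(2) by (subst emeasure_density) auto

lemma weight_measure_null:
  assumes "is_weight w" "N \<in> null_sets lebesgue"
  shows "emeasure (weight_measure w) N = 0"
proof -
  have "N \<in> null_sets (weight_measure w)" unfolding weight_measure_def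
    using is_weight_measurable[OF assms(1)] assms(2)
    by (subst null_sets_density_iff) (auto intro: eventually_mono[OF AE_not_in])
  then show ?thesis by auto
qed

lemma weight_measure_cube_finite:
  assumes "is_weight w"
  shows "emeasure (weight_measure w) (cube c r) < \<infinity>"
proof -
  have "set_integrable lebesgue (cube c r) w"
    using assms compact_cbox[of "\<chi> i. c $ i - r" "\<chi> i. c $ i + r"]
    unfolding is_weight_def cube_eq_cbox by metis
  then have "(\<integral>\<^sup>+x. ennreal (norm (indicator (cube c r) x *\<^sub>R w x)) \<partial>lebesgue) < \<infinity>"
    unfolding set_integrable_def by (rule integrable_iff_bounded[THEN iffD1, THEN conjunct2])
  moreover have "ennreal (norm (indicator (cube c r) x *\<^sub>R w x)) = ennreal (w x) * indicator (cube c r) x" for x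
    using assms by (auto simp: is_weight_def indicator_def)
  ultimately have "weight_of w (cube c r) < \<infinity>" unfolding weight_of_def by simp
  then show ?thesis using weight_of_eq[OF assms] by simp
qed

lemma weight_measure_finite:
  assumes "is_weight w" "A \<in> sets lebesgue" "A \<subseteq> cube c r"
  shows "emeasure (weight_measure w) A < \<infinity>"
proof -
  have "emeasure (weight_measure w) A \<le> emeasure (weight_measure w) (cube c r)"
    using assms by (intro emeasure_mono) auto
  then show ?thesis using weight_measure_cube_finite[OF assms(1), of c r] by simp
qed

lemma weight_measure_ennreal:
  assumes "is_weight w" "A \<in> sets lebesgue" "A \<subseteq> cube c r"
  shows "emeasure (weight_measure w) A = ennreal (measure (weight_measure w) A)"
  using weight_measure_finite[OF assms] by (simp add: emeasure_eq_ennreal_measure)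

lemma weight_measure_eq_of_null_diff:
  assumes "is_weight w" "A \<in> sets lebesgue" "B \<in> sets lebesgue" "A \<subseteq> B"
    "emeasure lebesgue A = emeasure lebesgue B" "emeasure lebesgue A \<noteq> \<infinity>"
  shows "emeasure (weight_measure w) B = emeasure (weight_measure w) A"
proof -
  have "emeasure lebesgue (B - A) = 0"
    using assms by (subst emeasure_Diff) auto
  then have "B - A \<in> null_sets lebesgue" using assms by (auto simp: null_sets_def)
  then have "emeasure (weight_measure w) (B - A) = 0" by (rule weight_measure_null[OF assms(1)])
  moreover have "emeasure (weight_measure w) B = emeasure (weight_measure w) A + emeasure (weight_measure w) (B - A)"
    using assms by (subst plus_emeasure) (auto intro!: arg_cong[where f = "emeasure (weight_measure w)"])
  ultimately show ?thesis by simp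
qed

lemma cube_dyadic_center_measure:
  assumes "l > 0"
  shows "emeasure lebesgue (cube (dyadic_center a l m x) (l / 2 ^ m / 2)) = emeasure lebesgue (dyadic a l m x)"
  using assms by (subst emeasure_cube, simp, subst emeasure_dyadic) auto

lemma weight_measure_cube_dyadic_center:
  assumes "is_weight w" "l > 0"
  shows "emeasure (weight_measure w) (cube (dyadic_center a l m x) (l / 2 ^ m / 2)) = emeasure (weight_measure w) (dyadic a l m x)"
  by (rule weight_measure_eq_of_null_diff[OF assms(1) dyadic_sets cube_sets dyadic_subset_cube cube_dyadic_center_measure[symmetric]])
     (use assms emeasure_dyadic[of l a m x] in \<open>auto simp del: emeasure_completion\<close>)

lemma maximal_op_ge_dyadic:
  assumes w: "is_weight w" and l: "l > 0" and R: "dyadic a l m x \<subseteq> R"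
  shows "emeasure (weight_measure w) (dyadic a l m x) / emeasure lebesgue (dyadic a l m x)
          \<le> maximal_op (\<lambda>y. w y * indicator R y) x"
proof -
  let ?C = "cube (dyadic_center a l m x) (l / 2 ^ m / 2)" and ?P = "dyadic a l m x"
  have "l / 2 ^ m / 2 > 0" using l by simp
  then have C: "is_cube ?C" "x \<in> ?C" using dyadic_subset_cube[OF l, of a m x] is_cube_iff by auto
  have "emeasure (weight_measure w) ?P = (\<integral>\<^sup>+y\<in>?P. ennreal (w y) \<partial>lebesgue)"
    using weight_of_eq[OF w dyadic_sets[OF l, of a m x]] by (simp add: weight_of_def)
  also have "\<dots> \<le> (\<integral>\<^sup>+y\<in>?C. ennreal \<bar>w y * indicator R y\<bar> \<partial>lebesgue)"
    using R dyadic_subset_cube[OF l, of a m x] w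
    by (intro nn_integral_mono) (auto simp: indicator_def is_weight_def)
  finally have "emeasure (weight_measure w) ?P / emeasure lebesgue ?P
      \<le> (\<integral>\<^sup>+y\<in>?C. ennreal \<bar>w y * indicator R y\<bar> \<partial>lebesgue) / emeasure lebesgue ?C"
    unfolding cube_dyadic_center_measure[OF l] by (rule divide_right_mono_ennreal)
  also have "\<dots> \<le> maximal_op (\<lambda>y. w y * indicator R y) x"
    unfolding maximal_op_def using C by (intro SUP_upper) auto
  finally show ?thesis .
qed

lemma fujii_wilson_integral_le:
  assumes w: "w \<in> A_infty" and r: "r > 0" and pos: "emeasure (weight_measure w) (cube c r) > 0"
  shows "(\<integral>\<^sup>+x\<in>cube c r. maximal_op (\<lambda>y. w y * indicator (cube c r) y) x \<partial>lebesgue)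
      \<le> ennreal (enn2real (fujii_wilson w)) * emeasure (weight_measure w) (cube c r)"
    (is "?X \<le> _ * ?W")
proof -
  have iw: "is_weight w" and fin: "fujii_wilson w < \<infinity>" using w by (auto simp: A_infty_def)
  have we: "weight_of w (cube c r) = ?W" by (rule weight_of_eq[OF iw]) simp
  have "is_cube (cube c r)" using r is_cube_iff by blast
  then have "?X / ?W \<le> fujii_wilson w"
    unfolding fujii_wilson_def we[symmetric] using pos we
    by (intro SUP_upper2[of "cube c r"]) auto
  then have "?X / ?W * ?W \<le> fujii_wilson w * ?W" by (rule mult_right_mono) simp
  moreover have "?X / ?W * ?W = ?X"
    using pos weight_measure_cube_finite[OF iw, of c r] by (simp add: ennreal_divide_times)
  ultimately show ?thesis using fin by simp
qed

lemma weight_measure_cube_pos: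
  assumes w: "is_weight w" obtains c r where "r > 0" "emeasure (weight_measure w) (cube c r) > 0"
proof (rule ccontr)
  assume "\<not> thesis"
  then have z: "emeasure (weight_measure w) (cube 0 (real (Suc i))) = 0" for i
    using that[of "real (Suc i)" 0] by (metis not_gr_zero of_nat_0_less_iff zero_less_Suc)
  have "(\<Union>i. cube (0 :: real ^ 'a) (real (Suc i))) = UNIV"
  proof (intro equalityI subsetI UNIV_I)
    fix x :: "real ^ 'a"
    obtain i where i: "norm x \<le> real i" using real_arch_simple by blast
    have "\<bar>x $ j - 0 $ j\<bar> \<le> real (Suc i)" for j using component_le_norm_cart[of x j] i by simp
    then show "x \<in> (\<Union>i. cube (0 :: real ^ 'a) (real (Suc i)))" unfolding cube_def by blast
  qed
  moreover have "(\<Union>i. cube (0 :: real ^ 'a) (real (Suc i))) \<in> null_sets (weight_measure w)"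
    using z by (intro null_sets_UN) (auto simp: null_sets_def)
  ultimately have "UNIV \<in> null_sets (weight_measure w)" by simp
  then have "AE x in lebesgue. ennreal (w x) = 0" unfolding weight_measure_def
    using is_weight_measurable[OF w] by (subst (asm) null_sets_density_iff) auto
  then have "AE x in lebesgue. w x = 0"
    by (rule eventually_mono) (use w in \<open>auto simp: is_weight_def ennreal_eq_0_iff intro: antisym\<close>)
  then show False using w by (auto simp: is_weight_def)
qed

lemma fujii_wilson_ge_1:
  assumes w: "w \<in> A_infty" shows "enn2real (fujii_wilson w) \<ge> 1"
proof -
  have iw: "is_weight w" using w by (auto simp: A_infty_def)
  obtain c r where r: "r > 0" and pos: "emeasure (weight_measure w) (cube c r) > 0"
    using weight_measure_cube_pos[OF iw] .
  let ?Q = "cube c r" and ?W = "emeasure (weight_measure w) (cube c r)"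
  have Qm: "emeasure lebesgue ?Q \<noteq> 0" "emeasure lebesgue ?Q \<noteq> top"
    using r emeasure_cube[of r c] by (auto simp del: emeasure_completion)
  have "?W / emeasure lebesgue ?Q \<le> maximal_op (\<lambda>y. w y * indicator ?Q y) x" if x: "x \<in> ?Q" for x
  proof -
    have "?W = (\<integral>\<^sup>+y\<in>?Q. ennreal \<bar>w y * indicator ?Q y\<bar> \<partial>lebesgue)"
      unfolding weight_of_eq[OF iw cube_sets, symmetric] weight_of_def
      using iw by (intro nn_integral_cong) (auto simp: indicator_def is_weight_def)
    then show ?thesis
      unfolding maximal_op_def using r x is_cube_iff by (intro SUP_upper2[of ?Q]) auto
  qed
  then have "(\<integral>\<^sup>+x. ?W / emeasure lebesgue ?Q * indicator ?Q x \<partial>lebesgue)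
      \<le> (\<integral>\<^sup>+x\<in>?Q. maximal_op (\<lambda>y. w y * indicator ?Q y) x \<partial>lebesgue)"
    by (intro nn_integral_mono) (auto simp: indicator_def)
  also have "\<dots> \<le> ennreal (enn2real (fujii_wilson w)) * ?W"
    by (rule fujii_wilson_integral_le[OF w r pos])
  also have "(\<integral>\<^sup>+x. ?W / emeasure lebesgue ?Q * indicator ?Q x \<partial>lebesgue) = ?W"
    unfolding nn_integral_cmult_indicator[OF cube_sets]
    using Qm by (simp add: ennreal_divide_times less_top del: emeasure_completion)
  finally have "ennreal 1 * ?W \<le> ennreal (enn2real (fujii_wilson w)) * ?W" by simp
  moreover have "?W = ennreal (measure (weight_measure w) ?Q)"
    by (rule weight_measure_ennreal[OF iw]) auto
  moreover have "measure (weight_measure w) ?Q > 0"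
    using pos calculation(2) by (metis ennreal_0 measure_nonneg order_le_less order_less_irrefl)
  ultimately show ?thesis by (simp add: ennreal_mult[symmetric])
qed

text \<open>With \<open>T k\<close> the sum from \<open>k\<close> to \<open>L\<close>, the hypothesis says
\<open>T (k+1) \<le> C (T k - T (k+1))\<close>, so these sums decay geometrically.\<close>

lemma geometric_decay:
  fixes u :: "nat \<Rightarrow> real"
  assumes u0: "\<And>k. u k \<ge> 0" and C: "C > 0"
    and le: "\<And>k L. (\<Sum>m\<in>{k<..L}. u m) \<le> C * u k"
  shows "u L \<le> (1 + C) * (C / (1 + C)) ^ L * u 0"
proof -
  define T where "T k = (\<Sum>m\<in>{k..L}. u m)" for k
  have step: "T (Suc k) \<le> C / (1 + C) * T k" if "k < L" for k
  proof -
    have "{k..L} = insert k {k<..L}" "{Suc k..L} = {k<..L}" using that by auto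
    then have "T k = u k + T (Suc k)" "T (Suc k) \<le> C * u k" using le[of k L] by (auto simp: T_def)
    then have "T (Suc k) \<le> C * (T k - T (Suc k))" by simp
    then show ?thesis using C by (simp add: field_simps)
  qed
  have "T k \<le> (C / (1 + C)) ^ k * T 0" if "k \<le> L" for k
    using that
  proof (induction k)
    case (Suc k)
    have "T (Suc k) \<le> C / (1 + C) * T k" using step Suc by simp
    also have "\<dots> \<le> C / (1 + C) * ((C / (1 + C)) ^ k * T 0)"
      using Suc C by (intro mult_left_mono) auto
    finally show ?case by simp
  qed simp
  then have "u L \<le> (C / (1 + C)) ^ L * T 0" by (force simp: T_def)
  also have "T 0 \<le> (1 + C) * u 0"
  proof -
    have "{0..L} = insert 0 {0<..L}" by auto
    then show ?thesis using le[of 0 L] by (simp add: T_def algebra_simps)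
  qed
  then have "(C / (1 + C)) ^ L * T 0 \<le> (C / (1 + C)) ^ L * ((1 + C) * u 0)"
    using C by (intro mult_left_mono) auto
  finally show ?thesis by (simp add: mult_ac)
qed

text \<open>Splitting a set at the level \<open>2\<^sup>k\<close> of the maximal function gives the bound
\<open>2\<^sup>k a + s (1 - 1/s)\<^sup>k\<close> for its relative weight, where \<open>a\<close> is its relative measure. The two
terms are balanced, up to constants, by \<open>2\<^sup>k \<approx> a\<^sup>-\<^sup>1\<^sup>/\<^sup>2\<close>.\<close>

lemma optimize_level:
  fixes a s D :: real
  assumes a: "0 < a" "a \<le> 1" and s: "1 < s" "s \<le> D"
  obtains k :: nat where "2 ^ k * a + s * ((s - 1) / s) ^ k \<le> (1 + s * exp 1) * a powr (1 / (2 * D))"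
proof -
  define y where "y = log 2 (1 / a) / 2"
  define k where "k = nat \<lfloor>y\<rfloor>"
  have y0: "y \<ge> 0" using a by (simp add: y_def)
  have k: "real k \<le> y" "y < real k + 1" using y0 by (auto simp: k_def)
  have e: "1 / (2 * D) \<le> 1/2" "1 / (2 * D) \<le> 1 / (2 * s)" using s by (auto simp: field_simps)
  have "(2::real) ^ k = 2 powr real k" by (simp add: powr_realpow)
  also have "\<dots> \<le> 2 powr y" using k by simp
  also have "\<dots> = (1 / a) powr (1/2)"
    using powr_powr[of 2 "log 2 (1 / a)" "1/2"] a by (simp add: y_def)
  finally have "2 ^ k * a \<le> (1 / a) powr (1/2) * a" using a by simp
  also have "\<dots> = a powr (1/2)" using a by (simp add: powr_half_sqrt real_sqrt_divide field_simps)
  also have "\<dots> \<le> a powr (1 / (2 * D))" using a e by (intro powr_mono') auto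
  finally have 1: "2 ^ k * a \<le> a powr (1 / (2 * D))" .
  have "(s - 1) / s = 1 - 1 / s" using s by (simp add: field_simps)
  also have "\<dots> \<le> exp (- 1 / s)" using exp_ge_add_one_self[of "- 1 / s"] by simp
  finally have "((s - 1) / s) ^ k \<le> exp (- 1 / s) ^ k" using s by (intro power_mono) auto
  also have "\<dots> = exp (- (real k / s))" by (simp add: exp_of_nat_mult[symmetric])
  also have "\<dots> \<le> exp (1 + ln a / (2 * s))"
  proof -
    have "ln (1 / a) \<le> log 2 (1 / a)"
    proof -
      have "ln (2::real) \<le> 1" using ln_le_minus_one[of "2::real"] by simp
      moreover have "ln (1 / a) \<ge> 0" using a by simp
      ultimately show ?thesis by (simp add: log_def field_simps mult_left_le_one_le)
    qed
    then have "- ln a / 2 \<le> y" using a by (simp add: y_def ln_div)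
    then have "- ln a / 2 - 1 \<le> real k" using k by simp
    then have "(- ln a / 2 - 1) / s \<le> real k / s" using s by (intro divide_right_mono) auto
    moreover have "1 / s \<le> 1" using s by simp
    ultimately show ?thesis by (simp add: diff_divide_distrib)
  qed
  also have "\<dots> = exp 1 * a powr (1 / (2 * s))" using a by (simp add: powr_def exp_add)
  also have "\<dots> \<le> exp 1 * a powr (1 / (2 * D))"
    using a e by (intro mult_left_mono powr_mono') auto
  finally have "s * ((s - 1) / s) ^ k \<le> s * (exp 1 * a powr (1 / (2 * D)))"
    using s by (intro mult_left_mono) auto
  with 1 show ?thesis by (intro that[of k]) (simp add: algebra_simps)
qed

text \<open>Let \<open>\<alpha>\<close> be the average of \<open>w\<close> over the cube and \<open>\<Omega> k\<close> the union of the dyadic subcubes in which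
the average exceeds \<open>2\<^sup>k \<alpha>\<close>. On a maximal cube \<open>P\<close> of \<open>\<Omega> k\<close> the sum over \<open>m > k\<close> of
\<open>2\<^sup>m\<^sup>-\<^sup>1 \<alpha> \<chi>\<^bsub>\<Omega> m\<^esub>\<close> is a geometric sum that is dominated by its largest term, hence by the maximal
function of \<open>w \<chi>\<^sub>P\<close>. So the Fujii-Wilson condition on \<open>P\<close> bounds
\<open>\<Sum>m>k. w(\<Omega> m)\<close> by a multiple of \<open>w(\<Omega> k)\<close>, and \<open>w(\<Omega> k)\<close> decays geometrically in
\<open>k\<close>. Outside \<open>\<Omega> k\<close> the weight is at most \<open>2\<^sup>k \<alpha>\<close> almost everywhere.\<close>

lemma A_infty_estimate:
  fixes w :: "real ^ 'n \<Rightarrow> real"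
  assumes w: "w \<in> A_infty"
  defines "p0 \<equiv> 1 / (2 ^ (CARD('n) + 3) * enn2real (fujii_wilson w))"
  shows "\<exists>C>0. \<forall>c r A. r > 0 \<longrightarrow> A \<in> sets lebesgue \<longrightarrow> A \<subseteq> cube c r \<longrightarrow>
     measure (weight_measure w) A \<le> C * (measure lebesgue A / (2 * r) ^ CARD('n)) powr p0 * measure (weight_measure w) (cube c r)"
proof -
  have iw: "is_weight w" using w by (auto simp: A_infty_def)
  define K where "K = enn2real (fujii_wilson w)"
  have K1: "K \<ge> 1" unfolding K_def by (rule fujii_wilson_ge_1[OF w])
  define n where "n = CARD('n)"
  define C where "C = 2 ^ (n + 1) * K"
  have C0: "C > 0" using K1 by (simp add: C_def)
  define s where "s = 1 + C"
  define B where "B = 1 + s * exp 1"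
  have B: "B > 0" using C0 unfolding B_def s_def by (intro add_pos_pos mult_pos_pos) auto
  have goal: "measure (weight_measure w) A \<le> B * (measure lebesgue A / (2 * r) ^ n) powr p0 * measure (weight_measure w) (cube c r)"
    if r: "r > 0" and A: "A \<in> sets lebesgue" "A \<subseteq> cube c r" for c r A
  proof (cases "emeasure lebesgue A = 0 \<or> emeasure (weight_measure w) (cube c r) = 0")
    case True
    then have "emeasure (weight_measure w) A = 0"
    proof
      assume "emeasure lebesgue A = 0"
      then show ?thesis using A by (intro weight_measure_null[OF iw]) (auto simp: null_sets_def)
    next
      assume "emeasure (weight_measure w) (cube c r) = 0"
      then show ?thesis using emeasure_mono[OF A(2), of "weight_measure w"] by simp
    qed
    then show ?thesis using B by (simp add: measure_def)
  next
    case False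
    define l where "l = 2 * r"
    have l: "l > 0" using r by (simp add: l_def)
    define a :: "real ^ 'n" where "a = (\<chi> i. c $ i - r)"
    define D where "D = dyadic a l"
    define Q0 where "Q0 = D 0 c"
    have lQ: "dyadic_center a l 0 c = c" unfolding a_def l_def by (rule dyadic_center_root[OF r])
    have Q0: "Q0 \<subseteq> cube c r" "emeasure (weight_measure w) Q0 = emeasure (weight_measure w) (cube c r)"
      using dyadic_subset_cube[OF l, of a 0 c] weight_measure_cube_dyadic_center[OF iw l, of a 0 c] lQ
      by (auto simp: Q0_def D_def l_def)
    have Q0m: "emeasure lebesgue Q0 = ennreal (l ^ n)" unfolding Q0_def D_def n_def
      by (subst emeasure_dyadic[OF l]) simp
    let ?w = "measure (weight_measure w) (cube c r)"
    have wQ: "emeasure (weight_measure w) (cube c r) = ennreal ?w" by (rule weight_measure_ennreal[OF iw]) auto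
    have wpos: "?w > 0" using False wQ by (metis ennreal_0 measure_nonneg order_le_less)
    define \<alpha> where "\<alpha> = ?w / l ^ n"
    have \<alpha>: "\<alpha> > 0" using wpos l by (simp add: \<alpha>_def)
    define \<phi> where "\<phi> k P \<longleftrightarrow> P \<subseteq> Q0 \<and> emeasure (weight_measure w) P > ennreal (\<alpha> * 2 ^ k) * emeasure lebesgue P" for k :: nat and P
    define \<Omega> where "\<Omega> k = {x. \<exists>m. \<phi> k (D m x)}" for k
    have \<Omega>_sets: "\<Omega> k \<in> sets lebesgue" for k unfolding \<Omega>_def D_def by (rule dyadic_Union_sets[OF l])
    have \<Omega>_Q0: "\<Omega> k \<subseteq> Q0" for k unfolding \<Omega>_def \<phi>_def D_def using dyadic_self by blast
    have \<phi>_mono: "\<phi> j P" if "\<phi> k P" "j \<le> k" for j k P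
    proof -
      have "ennreal (\<alpha> * 2 ^ j) * emeasure lebesgue P \<le> ennreal (\<alpha> * 2 ^ k) * emeasure lebesgue P"
        using \<alpha> that(2) by (intro mult_right_mono ennreal_leI mult_left_mono power_increasing) auto
      then show ?thesis using that(1) unfolding \<phi>_def by (auto intro: le_less_trans)
    qed
    have \<Omega>_mono: "\<Omega> k \<subseteq> \<Omega> j" if "j \<le> k" for j k using \<phi>_mono[OF _ that] unfolding \<Omega>_def by blast
    have sub_Q0: "D m x \<subseteq> Q0" if "x \<in> Q0" for m x
    proof -
      have "D 0 x = Q0" using dyadic_eq that unfolding Q0_def D_def by blast
      then show ?thesis using dyadic_antimono[of 0 m a l x] by (simp add: D_def)
    qed
    \<comment> \<open>A maximal cube is not the root, whose average is \<alpha>, and its parent has average at most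
      2^k \<alpha> and 2^n times the volume.\<close>
    have stop: "emeasure (weight_measure w) (D m x) \<le> ennreal (\<alpha> * 2 ^ k * 2 ^ n) * emeasure lebesgue (D m x)"
      if st: "\<phi> k (D m x)" "\<And>j. j < m \<Longrightarrow> \<not> \<phi> k (D j x)" for k m x
    proof -
      have x: "x \<in> Q0" using st(1) dyadic_self unfolding \<phi>_def D_def by blast
      show ?thesis
      proof (cases m)
        case 0
        have "D 0 x = Q0" using dyadic_eq x unfolding Q0_def D_def by blast
        then have "emeasure (weight_measure w) Q0 > ennreal (\<alpha> * 2 ^ k) * emeasure lebesgue Q0"
          using st(1) 0 unfolding \<phi>_def by simp
        moreover have "ennreal ?w \<le> ennreal (\<alpha> * 2 ^ k) * emeasure lebesgue Q0"
          unfolding Q0m \<alpha>_def using wpos l by (simp add: ennreal_mult[symmetric] mult_le_cancel_left1)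
        ultimately show ?thesis using Q0 wQ by simp
      next
        case (Suc m')
        have "emeasure (weight_measure w) (D m x) \<le> emeasure (weight_measure w) (D m' x)"
          unfolding Suc D_def using dyadic_Suc dyadic_sets[OF l] by (intro emeasure_mono) (simp_all only: sets_weight_measure)
        also have "\<dots> \<le> ennreal (\<alpha> * 2 ^ k) * emeasure lebesgue (D m' x)"
          using st(2)[of m'] sub_Q0[OF x] Suc unfolding \<phi>_def by (simp add: not_less)
        also have "\<dots> = ennreal (\<alpha> * 2 ^ k * 2 ^ n) * emeasure lebesgue (D m x)"
          unfolding Suc D_def emeasure_dyadic[OF l] n_def[symmetric] using \<alpha> l
          by (simp add: ennreal_mult[symmetric] power_divide power_mult_distrib)
        finally show ?thesis .
      qed
    qed
    have lev: "emeasure (weight_measure w) (\<Omega> k) \<le> ennreal (\<alpha> * 2 ^ k * 2 ^ n) * emeasure lebesgue (\<Omega> k)" for k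
      unfolding \<Omega>_def D_def
      by (rule dyadic_stopping[OF l]) (use stop in \<open>auto simp: D_def\<close>)
    have \<Omega>fin: "emeasure lebesgue (\<Omega> k) = ennreal (measure lebesgue (\<Omega> k))" for k
      using emeasure_mono[OF \<Omega>_Q0[of k], of lebesgue] Q0m dyadic_sets[OF l, of a 0 c]
      by (intro emeasure_eq_ennreal_measure) (auto simp: Q0_def D_def top_unique simp del: emeasure_completion)
    have w\<Omega>: "emeasure (weight_measure w) (\<Omega> k) = ennreal (measure (weight_measure w) (\<Omega> k))" for k
      using \<Omega>_Q0 Q0 by (intro weight_measure_ennreal[OF iw \<Omega>_sets, of _ c r]) blast
    have lev': "measure (weight_measure w) (\<Omega> k) \<le> \<alpha> * 2 ^ k * 2 ^ n * measure lebesgue (\<Omega> k)" for k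
      using lev[of k] \<alpha> unfolding w\<Omega> \<Omega>fin by (simp add: ennreal_mult[symmetric])
    have pack: "(\<Sum>m\<in>{k<..L}. \<alpha> * 2 ^ m / 2 * measure lebesgue (\<Omega> m)) \<le> K * measure (weight_measure w) (\<Omega> k)" for k L
    proof -
      \<comment> \<open>The factor 1/2 absorbs the geometric sum, so that g itself stays below the maximal function.\<close>
      define g where "g x = (\<Sum>m\<in>{k<..L}. ennreal (\<alpha> * 2 ^ m / 2) * indicator (\<Omega> m) x)" for x
      have g_meas: "g \<in> borel_measurable lebesgue"
        unfolding g_def using \<Omega>_sets by measurable
      have g_int: "emeasure (density lebesgue g) P = (\<Sum>m\<in>{k<..L}. ennreal (\<alpha> * 2 ^ m / 2) * emeasure lebesgue (\<Omega> m \<inter> P))"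
        if P: "P \<in> sets lebesgue" for P
      proof -
        have "emeasure (density lebesgue g) P = (\<integral>\<^sup>+x. (\<Sum>m\<in>{k<..L}. ennreal (\<alpha> * 2 ^ m / 2) * indicator (\<Omega> m \<inter> P) x) \<partial>lebesgue)"
        proof (subst emeasure_density[OF g_meas P], intro nn_integral_cong)
          fix x
          show "g x * indicator P x = (\<Sum>m\<in>{k<..L}. ennreal (\<alpha> * 2 ^ m / 2) * indicator (\<Omega> m \<inter> P) x)"
            unfolding g_def sum_distrib_right by (intro sum.cong refl) (simp add: indicator_inter_arith mult.assoc)
        qed
        also have "\<dots> = (\<Sum>m\<in>{k<..L}. ennreal (\<alpha> * 2 ^ m / 2) * emeasure lebesgue (\<Omega> m \<inter> P))"
          using \<Omega>_sets P by (subst nn_integral_sum) (auto simp: nn_integral_cmult_indicator simp del: emeasure_completion)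
        finally show ?thesis .
      qed
      have "emeasure (density lebesgue g) (\<Omega> k) \<le> ennreal K * emeasure (weight_measure w) (\<Omega> k)"
        unfolding \<Omega>_def[of k] D_def
      proof (rule dyadic_stopping[OF l])
        fix N x assume st: "\<phi> k (dyadic a l N x)" "\<And>j. j < N \<Longrightarrow> \<not> \<phi> k (dyadic a l j x)"
        let ?P = "dyadic a l N x" and ?R = "cube (dyadic_center a l N x) (l / 2 ^ N / 2)"
        have PR: "?P \<subseteq> ?R" by (rule dyadic_subset_cube[OF l])
        have gM: "g y \<le> maximal_op (\<lambda>y. w y * indicator ?R y) y" if y: "y \<in> ?P" for y
        proof (cases "{m \<in> {k<..L}. y \<in> \<Omega> m} = {}")
          case True
          then have "g y = 0" unfolding g_def by (intro sum.neutral) (auto simp: indicator_def)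
          then show ?thesis by simp
        next
          case ne: False
          define J where "J = {m \<in> {k<..L}. y \<in> \<Omega> m}"
          define M where "M = Max J"
          have M: "M \<in> J" "\<And>m. m \<in> J \<Longrightarrow> m \<le> M" 
            using ne Max_in[of J] Max_ge[of J] unfolding M_def J_def[symmetric] by (auto simp: J_def)
          have "g y = (\<Sum>m\<in>J. ennreal (\<alpha> * 2 ^ m / 2))"
            unfolding g_def J_def by (rule sum.mono_neutral_cong_right) (auto simp: indicator_def)
          also have "\<dots> = ennreal (\<Sum>m\<in>J. \<alpha> * 2 ^ m / 2)" using \<alpha> by (intro sum_ennreal) auto
          also have "\<dots> \<le> ennreal (\<alpha> * 2 ^ M)"
          proof (rule ennreal_leI)
            have "(\<Sum>m\<in>J. \<alpha> * 2 ^ m / 2) \<le> (\<Sum>m\<in>{..<Suc M}. \<alpha> * 2 ^ m / 2)"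
              using M \<alpha> by (intro sum_mono2) (auto simp: less_Suc_eq_le)
            also have "\<dots> = \<alpha> / 2 * (\<Sum>m\<in>{..<Suc M}. 2 ^ m)" unfolding sum_distrib_left by (intro sum.cong) auto
            also have "(\<Sum>m\<in>{..<Suc M}. 2 ^ m) = (2 ^ Suc M - 1 :: real)"
              using sum_gp_strict[of "2::real" "Suc M"] by simp
            also have "\<alpha> / 2 * (2 ^ Suc M - 1) \<le> \<alpha> * 2 ^ M" using \<alpha> by (simp add: field_simps)
            finally show "(\<Sum>m\<in>J. \<alpha> * 2 ^ m / 2) \<le> \<alpha> * 2 ^ M" .
          qed
          also have "\<dots> \<le> maximal_op (\<lambda>y. w y * indicator ?R y) y"
          proof -
            have "y \<in> \<Omega> M" "k \<le> M" using M(1) by (auto simp: J_def)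
            then obtain j where j: "\<phi> M (dyadic a l j y)" unfolding \<Omega>_def D_def by blast
            have "\<phi> k (dyadic a l j y)" by (rule \<phi>_mono[OF j \<open>k \<le> M\<close>])
            \<comment> \<open>A cube through y with average above 2^M \<alpha> also qualifies for \<Omega> k, so it lies inside the
              maximal cube.\<close>
            have "N \<le> j"
            proof (rule ccontr)
              assume "\<not> N \<le> j"
              then have "j < N" by simp
              moreover have "dyadic a l j y = dyadic a l j x"
                using dyadic_antimono[of j N a l x] y \<open>j < N\<close> by (intro dyadic_eq) auto
              ultimately show False using st(2)[of j] \<open>\<phi> k (dyadic a l j y)\<close> by simp
            qed
            then have "dyadic a l j y \<subseteq> ?P" using dyadic_antimono[of N j a l y] dyadic_eq[OF y] by simp
            then have sub: "dyadic a l j y \<subseteq> ?R" using PR by blast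
            have pm: "emeasure lebesgue (dyadic a l j y) \<noteq> 0" "emeasure lebesgue (dyadic a l j y) \<noteq> top"
              using l emeasure_dyadic[OF l, of a j y] by (auto simp del: emeasure_completion)
            have "ennreal (\<alpha> * 2 ^ M) = ennreal (\<alpha> * 2 ^ M) * emeasure lebesgue (dyadic a l j y) / emeasure lebesgue (dyadic a l j y)"
              using pm by (simp add: ennreal_mult_divide_eq del: emeasure_completion)
            also have "\<dots> \<le> emeasure (weight_measure w) (dyadic a l j y) / emeasure lebesgue (dyadic a l j y)"
              using j unfolding \<phi>_def by (intro divide_right_mono_ennreal) auto
            also have "\<dots> \<le> maximal_op (\<lambda>y. w y * indicator ?R y) y"
              by (rule maximal_op_ge_dyadic[OF iw l sub])
            finally show ?thesis .
          qed
          finally show ?thesis .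
        qed
        have "emeasure (density lebesgue g) ?P = (\<integral>\<^sup>+y. g y * indicator ?P y \<partial>lebesgue)"
          using g_meas dyadic_sets[OF l] by (intro emeasure_density) auto
        also have "\<dots> \<le> (\<integral>\<^sup>+y\<in>?R. maximal_op (\<lambda>y. w y * indicator ?R y) y \<partial>lebesgue)"
          using gM PR by (intro nn_integral_mono) (auto simp: indicator_def)
        also have "\<dots> \<le> ennreal K * emeasure (weight_measure w) ?R" unfolding K_def
        proof (rule fujii_wilson_integral_le[OF w])
          show "l / 2 ^ N / 2 > 0" using l by simp
          show "emeasure (weight_measure w) ?R > 0"
            unfolding weight_measure_cube_dyadic_center[OF iw l] using st(1) unfolding \<phi>_def by (auto intro: le_less_trans)
        qed
        also have "\<dots> = ennreal K * emeasure (weight_measure w) ?P" unfolding weight_measure_cube_dyadic_center[OF iw l] ..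
        finally show "emeasure (density lebesgue g) ?P \<le> ennreal K * emeasure (weight_measure w) ?P" .
      qed auto
      also have "emeasure (density lebesgue g) (\<Omega> k) = (\<Sum>m\<in>{k<..L}. ennreal (\<alpha> * 2 ^ m / 2) * emeasure lebesgue (\<Omega> m))"
        unfolding g_int[OF \<Omega>_sets] using \<Omega>_mono by (intro sum.cong refl) (auto simp: Int_absorb2 simp del: emeasure_completion)
      also have "\<dots> = (\<Sum>m\<in>{k<..L}. ennreal (\<alpha> * 2 ^ m / 2 * measure lebesgue (\<Omega> m)))"
        unfolding \<Omega>fin using \<alpha> by (intro sum.cong refl ennreal_mult[symmetric]) auto
      also have "\<dots> = ennreal (\<Sum>m\<in>{k<..L}. \<alpha> * 2 ^ m / 2 * measure lebesgue (\<Omega> m))"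
        using \<alpha> by (intro sum_ennreal) auto
      finally show ?thesis using K1 unfolding w\<Omega> by (simp add: ennreal_mult[symmetric])
    qed
    have sum_le: "(\<Sum>m\<in>{k<..L}. measure (weight_measure w) (\<Omega> m)) \<le> C * measure (weight_measure w) (\<Omega> k)" for k L
    proof -
      have "(\<Sum>m\<in>{k<..L}. measure (weight_measure w) (\<Omega> m)) \<le> (\<Sum>m\<in>{k<..L}. 2 ^ (n+1) * (\<alpha> * 2 ^ m / 2 * measure lebesgue (\<Omega> m)))"
        using lev' by (intro sum_mono) (simp add: mult_ac)
      also have "\<dots> \<le> 2 ^ (n+1) * (K * measure (weight_measure w) (\<Omega> k))"
        unfolding sum_distrib_left[symmetric] using pack by (intro mult_left_mono) auto
      finally show ?thesis by (simp add: C_def mult_ac)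
    qed
    have decay: "measure (weight_measure w) (\<Omega> k) \<le> s * ((s - 1) / s) ^ k * ?w" for k
    proof -
      have "measure (weight_measure w) (\<Omega> k) \<le> (1 + C) * (C / (1 + C)) ^ k * measure (weight_measure w) (\<Omega> 0)"
        by (rule geometric_decay[OF _ C0 sum_le]) simp
      also have "measure (weight_measure w) (\<Omega> 0) \<le> ?w"
      proof -
        have "emeasure (weight_measure w) (\<Omega> 0) \<le> emeasure (weight_measure w) (cube c r)"
          using \<Omega>_Q0[of 0] Q0(1) by (intro emeasure_mono) auto
        then show ?thesis unfolding w\<Omega> wQ by simp
      qed
      finally show ?thesis using C0 by (simp add: s_def mult_left_mono)
    qed
    have dens: "measure (weight_measure w) A \<le> measure (weight_measure w) (\<Omega> k) + \<alpha> * 2 ^ k * measure lebesgue A" for k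
    proof -
      define A1 where "A1 = A \<inter> Q0 - \<Omega> k"
      have Q0s: "Q0 \<in> sets lebesgue" unfolding Q0_def D_def by (rule dyadic_sets[OF l])
      have A1: "A1 \<in> sets lebesgue" unfolding A1_def using A Q0s \<Omega>_sets by auto
      have "emeasure (weight_measure w) A1 \<le> ennreal (\<alpha> * 2 ^ k) * emeasure lebesgue A1"
      proof (rule dyadic_density[OF l A1])
        fix m x assume "x \<in> A1"
        then have "D m x \<subseteq> Q0" "\<not> \<phi> k (D m x)" using sub_Q0 unfolding A1_def \<Omega>_def by auto
        then show "emeasure (weight_measure w) (dyadic a l m x) \<le> ennreal (\<alpha> * 2 ^ k) * emeasure lebesgue (dyadic a l m x)"
          unfolding \<phi>_def D_def by (simp add: not_less)
      qed auto
      also have "\<dots> \<le> ennreal (\<alpha> * 2 ^ k) * emeasure lebesgue A"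
        using A by (intro mult_left_mono emeasure_mono) (auto simp: A1_def)
      finally have 1: "emeasure (weight_measure w) A1 \<le> ennreal (\<alpha> * 2 ^ k) * emeasure lebesgue A" .
      have 2: "emeasure (weight_measure w) (cube c r - Q0) = 0"
        using Q0 Q0s wQ by (subst emeasure_Diff) auto
      have "emeasure (weight_measure w) A \<le> emeasure (weight_measure w) (\<Omega> k \<union> A1 \<union> (cube c r - Q0))"
        using A A1 \<Omega>_sets Q0s by (intro emeasure_mono) (auto simp: A1_def)
      also have "\<dots> \<le> emeasure (weight_measure w) (\<Omega> k \<union> A1) + emeasure (weight_measure w) (cube c r - Q0)"
        using A1 \<Omega>_sets Q0s by (intro emeasure_subadditive) auto
      also have "emeasure (weight_measure w) (\<Omega> k \<union> A1) \<le> emeasure (weight_measure w) (\<Omega> k) + emeasure (weight_measure w) A1"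
        using A1 \<Omega>_sets by (intro emeasure_subadditive) auto
      also have "\<dots> \<le> emeasure (weight_measure w) (\<Omega> k) + ennreal (\<alpha> * 2 ^ k) * emeasure lebesgue A"
        using 1 by (intro add_left_mono)
      finally have "emeasure (weight_measure w) A \<le> emeasure (weight_measure w) (\<Omega> k) + ennreal (\<alpha> * 2 ^ k) * emeasure lebesgue A"
        unfolding 2 add_0_right by (simp add: add_right_mono)
      moreover have "emeasure lebesgue A = ennreal (measure lebesgue A)"
        using fmeasurableI2[OF cube_lmeasurable A(2,1)] emeasure_eq_measure2 by blast
      ultimately show ?thesis
        unfolding w\<Omega> weight_measure_ennreal[OF iw A] using \<alpha>
        by (simp add: ennreal_mult[symmetric] flip: ennreal_plus)
    qed
    define t where "t = measure lebesgue A / l ^ n"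
    have "measure lebesgue A \<le> measure lebesgue (cube c r)" using A by (intro measure_mono_fmeasurable) auto
    also have "\<dots> = l ^ n" using measure_cube[of r c] r by (simp add: l_def n_def)
    finally have t1: "t \<le> 1" using l by (simp add: t_def)
    have "measure lebesgue A \<noteq> 0"
    proof
      assume "measure lebesgue A = 0"
      then have "emeasure lebesgue A = 0"
        using emeasure_eq_measure2[OF fmeasurableI2[OF cube_lmeasurable A(2,1)]] by (simp only: ennreal_0)
      then show False using False by blast
    qed
    then have "measure lebesgue A > 0" using measure_nonneg[of lebesgue A] by linarith
    then have t0: "t > 0" unfolding t_def using l by (intro divide_pos_pos) auto
    have sD: "s \<le> 2 ^ (n + 2) * K"
    proof -
      have "1 \<le> 2 ^ (n + 1) * K" 
        using mult_mono[of 1 "2 ^ (n+1)" 1 K] one_le_power[of "2::real" "n + 1"] K1 by simp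
      then show ?thesis by (simp add: s_def C_def mult_ac)
    qed
    have s1: "1 < s" using C0 by (simp add: s_def)
    obtain k where k: "2 ^ k * t + s * ((s - 1) / s) ^ k \<le> B * t powr (1 / (2 * (2 ^ (n + 2) * K)))"
      using optimize_level[OF t0 t1 s1 sD] unfolding B_def by blast
    have "measure (weight_measure w) A \<le> s * ((s - 1) / s) ^ k * ?w + \<alpha> * 2 ^ k * measure lebesgue A"
      using dens[of k] decay[of k] by simp
    also have "\<alpha> * 2 ^ k * measure lebesgue A = 2 ^ k * t * ?w" by (simp add: \<alpha>_def t_def)
    also have "s * ((s - 1) / s) ^ k * ?w + 2 ^ k * t * ?w = (2 ^ k * t + s * ((s - 1) / s) ^ k) * ?w"
      by (simp add: algebra_simps)
    also have "\<dots> \<le> B * t powr (1 / (2 * (2 ^ (n + 2) * K))) * ?w"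
      using k wpos by (intro mult_right_mono) auto
    also have "1 / (2 * (2 ^ (n + 2) * K)) = p0" by (simp add: p0_def n_def K_def power_add)
    finally show ?thesis by (simp add: t_def l_def)
  qed
  show ?thesis using B goal unfolding n_def by blast
qed

section \<open>Unions of slightly smaller cubes\<close>

lemma finite_minimal_subfamily:
  assumes "finite J"
  obtains S where "S \<subseteq> J" "(\<Union>j\<in>S. I j) = (\<Union>j\<in>J. I j)"
    "\<And>j. j \<in> S \<Longrightarrow> (\<Union>k\<in>S - {j}. I k) \<noteq> (\<Union>j\<in>J. I j)"
proof -
  define \<S> where "\<S> = {S. S \<subseteq> J \<and> (\<Union>j\<in>S. I j) = (\<Union>j\<in>J. I j)}"
  have "finite \<S>" using assms by (simp add: \<S>_def)
  moreover have "J \<in> \<S>" by (simp add: \<S>_def)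
  ultimately obtain S where S: "S \<in> \<S>" "\<And>T. T \<in> \<S> \<Longrightarrow> T \<subseteq> S \<Longrightarrow> T = S"
    using finite_has_minimal[of \<S>] by blast
  show ?thesis
  proof (rule that[of S])
    fix j assume "j \<in> S"
    then show "(\<Union>k\<in>S - {j}. I k) \<noteq> (\<Union>j\<in>J. I j)" using S(1) S(2)[of "S - {j}"] by (auto simp: \<S>_def)
  qed (use S in \<open>auto simp: \<S>_def\<close>)
qed

text \<open>In one dimension a minimal subfamily with the same union has overlap at most two: of the
intervals through a point, the one reaching furthest left and the one reaching furthest right
cover all the others. So the total length trimmed off the subfamily is at most \<open>2 \<delta>\<close> times
the length of the union.\<close>

lemma interval_family_trim:
  fixes c r :: "'j \<Rightarrow> real"
  assumes J: "finite J" and r: "\<And>j. j \<in> J \<Longrightarrow> r j > 0" and \<delta>: "0 \<le> \<delta>" "\<delta> \<le> 1/2"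
  defines "I \<equiv> \<lambda>j. {c j - r j..c j + r j}"
    and "I' \<equiv> \<lambda>j. {c j - (1 - \<delta>) * r j..c j + (1 - \<delta>) * r j}"
  shows "ennreal (1 - 2 * \<delta>) * emeasure lborel (\<Union>j\<in>J. I j) \<le> emeasure lborel (\<Union>j\<in>J. I' j)"
proof -
  obtain S where S: "S \<subseteq> J" "(\<Union>j\<in>S. I j) = (\<Union>j\<in>J. I j)"
    "\<And>j. j \<in> S \<Longrightarrow> (\<Union>k\<in>S - {j}. I k) \<noteq> (\<Union>j\<in>J. I j)"
    using finite_minimal_subfamily[OF J, of I] by blast
  have fS: "finite S" using S(1) J finite_subset by blast
  define U where "U = (\<Union>j\<in>J. I j)"
  define U' where "U' = (\<Union>j\<in>J. I' j)"
  have I'I: "I' j \<subseteq> I j" if "j \<in> J" for j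
  proof -
    have "(1 - \<delta>) * r j \<le> 1 * r j" using r[OF that] \<delta> by (intro mult_right_mono) auto
    then show ?thesis by (auto simp: I_def I'_def)
  qed
  have m: "U \<in> fmeasurable lborel" "U' \<in> fmeasurable lborel"
  proof -
    show "U \<in> fmeasurable lborel" unfolding U_def
      by (rule fmeasurable.finite_UN[OF J]) (simp add: I_def fmeasurable_compact)
    show "U' \<in> fmeasurable lborel" unfolding U'_def
      by (rule fmeasurable.finite_UN[OF J]) (simp add: I'_def fmeasurable_compact)
  qed
  have overlap: "card {j \<in> S. x \<in> I j} \<le> 2" for x
  proof (cases "{j \<in> S. x \<in> I j} = {}")
    case False
    define T where "T = {j \<in> S. x \<in> I j}"
    have T: "finite T" "T \<noteq> {}" using fS False by (auto simp: T_def)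
    obtain a where a: "a \<in> T" "\<And>j. j \<in> T \<Longrightarrow> c a - r a \<le> c j - r j"
      using ex_is_arg_min_if_finite[OF T, of "\<lambda>j. c j - r j"] by (auto simp: is_arg_min_linorder)
    obtain b where b: "b \<in> T" "\<And>j. j \<in> T \<Longrightarrow> c j + r j \<le> c b + r b"
      using ex_is_arg_min_if_finite[OF T, of "\<lambda>j. - (c j + r j)"] unfolding is_arg_min_linorder
      by (metis neg_le_iff_le)
    have "T \<subseteq> {a, b}"
    proof
      fix j assume j: "j \<in> T"
      show "j \<in> {a, b}"
      proof (rule ccontr)
        assume n: "j \<notin> {a, b}"
        have "I j \<subseteq> I a \<union> I b" using a b j by (fastforce simp: I_def T_def)
        then have "(\<Union>k\<in>S. I k) = (\<Union>k\<in>S - {j}. I k)" using n a(1) b(1) by (auto simp: T_def)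
        then have "(\<Union>k\<in>S - {j}. I k) = (\<Union>j\<in>J. I j)" using S(2) by simp
        moreover have "j \<in> S" using j by (simp add: T_def)
        ultimately show False using S(3) by blast
      qed
    qed
    then have "card T \<le> card {a, b}" by (intro card_mono) auto
    also have "\<dots> \<le> 2" by (simp add: card_insert_if)
    finally show ?thesis by (simp add: T_def)
  next
    case True
    show ?thesis unfolding True by simp
  qed
  have "ennreal (\<Sum>j\<in>S. 2 * r j) = (\<Sum>j\<in>S. ennreal (2 * r j))"
    using r S(1) by (subst sum_ennreal) (auto simp: less_imp_le subset_iff)
  also have "\<dots> = (\<Sum>j\<in>S. emeasure lborel (I j))"
    using r S(1) by (intro sum.cong) (auto simp: I_def subset_iff less_imp_le)
  also have "\<dots> = (\<integral>\<^sup>+x. (\<Sum>j\<in>S. indicator (I j) x) \<partial>lborel)"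
    by (subst nn_integral_sum) (auto simp: I_def)
  also have "\<dots> \<le> (\<integral>\<^sup>+x. 2 * indicator U x \<partial>lborel)"
  proof (rule nn_integral_mono)
    fix x
    have "(\<Sum>j\<in>S. indicator (I j) x) = (\<Sum>j\<in>{j \<in> S. x \<in> I j}. 1 :: ennreal)"
      using fS by (intro sum.mono_neutral_cong_right) (auto simp: indicator_def)
    also have "\<dots> = of_nat (card {j \<in> S. x \<in> I j})" by simp
    finally have s: "(\<Sum>j\<in>S. indicator (I j) x) = (of_nat (card {j \<in> S. x \<in> I j}) :: ennreal)" .
    show "(\<Sum>j\<in>S. indicator (I j) x) \<le> (2 * indicator U x :: ennreal)"
    proof (cases "x \<in> U")
      case True
      have "of_nat (card {j \<in> S. x \<in> I j}) \<le> (of_nat 2 :: ennreal)" using overlap[of x] by (simp only: of_nat_le_iff)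
      then show ?thesis unfolding s using True by simp
    next
      case False
      then have "x \<notin> I j" if "j \<in> S" for j using S(1) that by (auto simp: U_def)
      then show ?thesis by (simp add: indicator_def)
    qed
  qed
  also have "\<dots> = 2 * emeasure lborel U" using m by (intro nn_integral_cmult_indicator) (auto simp: fmeasurable_def)
  also have "\<dots> = ennreal (2 * measure lborel U)"
    using m by (simp add: emeasure_eq_measure2 ennreal_mult)
  finally have sum: "(\<Sum>j\<in>S. 2 * r j) \<le> 2 * measure lborel U" by simp
  have "measure lborel (U - U') \<le> measure lborel (\<Union>j\<in>S. I j - I' j)"
  proof (rule measure_mono_fmeasurable)
    have "U = (\<Union>j\<in>S. I j)" using S(2) by (simp add: U_def)
    then show "U - U' \<subseteq> (\<Union>j\<in>S. I j - I' j)" using S(1) by (auto simp: U'_def)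
    show "(\<Union>j\<in>S. I j - I' j) \<in> fmeasurable lborel"
      using fS by (intro fmeasurable.finite_UN fmeasurable.Diff) (simp_all add: I_def I'_def fmeasurable_compact)
  qed (use m in \<open>auto simp: fmeasurable_def\<close>)
  also have "\<dots> \<le> (\<Sum>j\<in>S. measure lborel (I j - I' j))"
    using fS by (intro measure_UNION_le) (auto simp: I_def I'_def)
  also have "\<dots> = (\<Sum>j\<in>S. \<delta> * (2 * r j))"
  proof (rule sum.cong[OF refl])
    fix j assume "j \<in> S"
    then have j: "j \<in> J" using S by blast
    have "measure lborel (I j - I' j) = measure lborel (I j) - measure lborel (I' j)"
      using I'I[OF j] by (intro measurable_measure_Diff) (auto simp: I_def I'_def fmeasurable_compact)
    moreover have "(1 - \<delta>) * r j \<ge> 0" using r[OF j] \<delta> by (intro mult_nonneg_nonneg) auto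
    ultimately show "measure lborel (I j - I' j) = \<delta> * (2 * r j)"
      using r[OF j] by (simp add: I_def I'_def algebra_simps)
  qed
  also have "\<dots> \<le> 2 * \<delta> * measure lborel U"
    using mult_left_mono[OF sum \<delta>(1)] by (simp only: sum_distrib_left mult_ac)
  finally have "measure lborel (U - U') \<le> 2 * \<delta> * measure lborel U" .
  moreover have "measure lborel (U - U') = measure lborel U - measure lborel U'"
    using m I'I by (intro measure_Diff) (auto simp: U_def U'_def fmeasurable_def)
  ultimately have "(1 - 2 * \<delta>) * measure lborel U \<le> measure lborel U'" by (simp add: algebra_simps)
  then show ?thesis
    using m \<delta> unfolding U_def[symmetric] U'_def[symmetric]
    by (simp add: emeasure_eq_measure2 ennreal_mult[symmetric])
qed

text \<open>Fubini in the coordinate \<open>i\<close>, with the measure on the remaining coordinates left abstract: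
only the comparison of slices of two sets is needed.\<close>

lemma emeasure_lborel_slices:
  fixes i :: "'n::finite"
  obtains M :: "((real ^ 'n) \<Rightarrow> real) measure" and y :: "((real ^ 'n) \<Rightarrow> real) \<Rightarrow> real ^ 'n"
  where "\<And>A. A \<in> sets borel \<Longrightarrow>
    emeasure lborel A = (\<integral>\<^sup>+f. emeasure lborel {t. (\<chi> k. if k = i then t else y f $ k) \<in> A} \<partial>M)"
    and "\<And>A. A \<in> sets borel \<Longrightarrow>
    (\<lambda>f. emeasure lborel {t. (\<chi> k. if k = i then t else y f $ k) \<in> A}) \<in> borel_measurable M"
proof -
  interpret product_sigma_finite "\<lambda>_ :: real ^ 'n. lborel :: real measure" by standard
  define b :: "real ^ 'n" where "b = axis i 1"
  define Bs where "Bs = (Basis :: (real ^ 'n) set) - {b}"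
  have b: "b \<in> Basis" by (simp add: b_def)
  have Bs: "Basis = insert b Bs" "finite Bs" "b \<notin> Bs" using b by (auto simp: Bs_def)
  define y where "y f = (\<Sum>c\<in>Bs. f c *\<^sub>R c)" for f :: "real ^ 'n \<Rightarrow> real"
  have yi: "y f $ i = 0" for f
  proof -
    have "c $ i = 0" if "c \<in> Bs" for c
      using that by (auto simp: Bs_def b_def Basis_vec_def axis_def)
    then show ?thesis unfolding y_def sum_component by (intro sum.neutral) simp
  qed
  have upd: "(\<Sum>c\<in>Basis. (f(b := t)) c *\<^sub>R c) = (\<chi> k. if k = i then t else y f $ k)" for f t
  proof -
    have "(\<Sum>c\<in>Basis. (f(b := t)) c *\<^sub>R c) = t *\<^sub>R b + (\<Sum>c\<in>Bs. (f(b := t)) c *\<^sub>R c)"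
      unfolding Bs(1) using Bs(2,3) by simp
    also have "(\<Sum>c\<in>Bs. (f(b := t)) c *\<^sub>R c) = y f"
      unfolding y_def using Bs(3) by (intro sum.cong) auto
    finally show ?thesis using yi[of f] by (auto simp: vec_eq_iff b_def axis_def)
  qed
  define h :: "(real ^ 'n \<Rightarrow> real) \<Rightarrow> real ^ 'n" where "h f = (\<Sum>b\<in>Basis. f b *\<^sub>R b)" for f
  have h: "h \<in> measurable (\<Pi>\<^sub>M b\<in>Basis. lborel) borel" unfolding h_def by measurable
  have slice: "emeasure lborel {t. (\<chi> k. if k = i then t else y f $ k) \<in> A}
      = (\<integral>\<^sup>+t. indicator A (h (f(b := t))) \<partial>lborel)" if A: "A \<in> sets borel" for A f
  proof -
    have cont: "continuous_on UNIV (\<lambda>t :: real. (\<chi> k. if k = i then t else y f $ k))"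
    proof (rule continuous_on_vec_lambda)
      show "continuous_on UNIV (\<lambda>t :: real. if k = i then t else y f $ k)" for k
        by (cases "k = i") auto
    qed
    have "{t. (\<chi> k. if k = i then t else y f $ k) \<in> A} \<in> sets borel"
      using measurable_sets_borel[OF borel_measurable_continuous_onI[OF cont] A] by (simp add: vimage_def)
    moreover have "indicator A (h (f(b := t))) = (indicator {t. (\<chi> k. if k = i then t else y f $ k) \<in> A} t :: ennreal)" for t
      unfolding h_def upd by (simp add: indicator_def)
    ultimately show ?thesis by simp
  qed
  show ?thesis
  proof (rule that[of "\<Pi>\<^sub>M b\<in>Bs. lborel" y])
    fix A :: "(real ^ 'n) set" assume A: "A \<in> sets borel"
    have "emeasure lborel A = (\<integral>\<^sup>+x. indicator A x \<partial>(lborel :: (real ^ 'n) measure))"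
      using A by simp
    also have "\<dots> = (\<integral>\<^sup>+f. indicator A (h f) \<partial>(\<Pi>\<^sub>M b\<in>Basis. lborel))"
      unfolding lborel_eq[where 'a = "real ^ 'n"] h_def[symmetric] using A h
      by (subst nn_integral_distr) auto
    also have "\<dots> = (\<integral>\<^sup>+f. (\<integral>\<^sup>+t. indicator A (h (f(b := t))) \<partial>lborel) \<partial>(\<Pi>\<^sub>M b\<in>Bs. lborel))"
      unfolding Bs(1) using Bs(2,3) A h[unfolded Bs(1)]
      by (subst product_nn_integral_insert) auto
    finally show "emeasure lborel A = (\<integral>\<^sup>+f. emeasure lborel {t. (\<chi> k. if k = i then t else y f $ k) \<in> A} \<partial>(\<Pi>\<^sub>M b\<in>Bs. lborel))"
      unfolding slice[OF A] .
    have "(\<lambda>(f, t). f(b := t)) \<in> measurable ((\<Pi>\<^sub>M b\<in>Bs. lborel) \<Otimes>\<^sub>M lborel) (\<Pi>\<^sub>M b\<in>Basis. lborel :: real measure)"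
      unfolding Bs(1) by (rule measurable_add_dim)
    from measurable_compose[OF this h]
    have "(\<lambda>p. h (case p of (f, t) \<Rightarrow> f(b := t))) \<in> borel_measurable ((\<Pi>\<^sub>M b\<in>Bs. lborel) \<Otimes>\<^sub>M lborel)" .
    moreover have "(indicator A :: _ \<Rightarrow> ennreal) \<in> borel_measurable borel"
      using A by (rule borel_measurable_indicator)
    ultimately have "(\<lambda>p. indicator A (h (case p of (f, t) \<Rightarrow> f(b := t))) :: ennreal)
        \<in> borel_measurable ((\<Pi>\<^sub>M b\<in>Bs. lborel) \<Otimes>\<^sub>M lborel)"
      by (rule measurable_compose)
    then have "(\<lambda>(f, t). indicator A (h (f(b := t))) :: ennreal) \<in> borel_measurable ((\<Pi>\<^sub>M b\<in>Bs. lborel) \<Otimes>\<^sub>M lborel)"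
      unfolding split_beta .
    then show "(\<lambda>f. emeasure lborel {t. (\<chi> k. if k = i then t else y f $ k) \<in> A}) \<in> borel_measurable (\<Pi>\<^sub>M b\<in>Bs. lborel)"
      unfolding slice[OF A] by (rule lborel.borel_measurable_nn_integral)
  qed
qed

text \<open>The cube with center \<open>c\<close> and half side \<open>r\<close>, shrunk only in the coordinates in \<open>S\<close>. It
interpolates between a cube and its concentric contraction, one coordinate at a time, which
reduces the comparison of the unions to the one-dimensional case.\<close>

definition trim :: "real \<Rightarrow> 'n set \<Rightarrow> (real ^ 'n) \<times> real \<Rightarrow> (real ^ 'n) set" where
  "trim \<delta> S = (\<lambda>(c, r). {x. \<forall>i. \<bar>x $ i - c $ i\<bar> \<le> (if i \<in> S then (1 - \<delta>) * r else r)})"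

lemma trim_borel: "trim \<delta> S p \<in> sets borel"
proof -
  obtain c r where p: "p = (c, r)" by (cases p)
  have "trim \<delta> S p = cbox (\<chi> i. c $ i - (if i \<in> S then (1 - \<delta>) * r else r)) (\<chi> i. c $ i + (if i \<in> S then (1 - \<delta>) * r else r))"
    unfolding p trim_def by (simp add: set_eq_iff mem_box_cart abs_diff_le_iff)
  then show ?thesis by simp
qed

lemma trim_one_coordinate:
  fixes F :: "((real ^ 'n) \<times> real) set" and i :: 'n
  assumes F: "finite F" "\<And>c r. (c, r) \<in> F \<Longrightarrow> r > 0" and \<delta>: "0 \<le> \<delta>" "\<delta> \<le> 1/2" and i: "i \<notin> S"
  shows "ennreal (1 - 2 * \<delta>) * emeasure lborel (\<Union>p\<in>F. trim \<delta> S p) \<le> emeasure lborel (\<Union>p\<in>F. trim \<delta> (insert i S) p)"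
proof -
  obtain M :: "((real ^ 'n) \<Rightarrow> real) measure" and y :: "((real ^ 'n) \<Rightarrow> real) \<Rightarrow> real ^ 'n"
    where M: "\<And>A. A \<in> sets borel \<Longrightarrow>
      emeasure lborel A = (\<integral>\<^sup>+f. emeasure lborel {t. (\<chi> k. if k = i then t else y f $ k) \<in> A} \<partial>M)"
    and M': "\<And>A. A \<in> sets borel \<Longrightarrow>
      (\<lambda>f. emeasure lborel {t. (\<chi> k. if k = i then t else y f $ k) \<in> A}) \<in> borel_measurable M"
    using emeasure_lborel_slices[of i] by blast
  let ?z = "\<lambda>f t. (\<chi> k. if k = i then t else y f $ k) :: real ^ 'n"
  let ?A = "\<Union>p\<in>F. trim \<delta> S p" and ?B = "\<Union>p\<in>F. trim \<delta> (insert i S) p"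
  have AB: "?A \<in> sets borel" "?B \<in> sets borel" using F(1) trim_borel by (auto intro!: sets.finite_UN)
  have slice: "ennreal (1 - 2 * \<delta>) * emeasure lborel {t. ?z f t \<in> ?A} \<le> emeasure lborel {t. ?z f t \<in> ?B}" for f
  proof -
    define J where "J = {p \<in> F. \<forall>k. k \<noteq> i \<longrightarrow> \<bar>y f $ k - fst p $ k\<bar> \<le> (if k \<in> S then (1 - \<delta>) * snd p else snd p)}"
    have "{t. ?z f t \<in> ?A} = (\<Union>p\<in>J. {fst p $ i - snd p..fst p $ i + snd p})"
    proof (intro set_eqI)
      fix t
      have "?z f t \<in> trim \<delta> S p \<longleftrightarrow> (\<forall>k. k \<noteq> i \<longrightarrow> \<bar>y f $ k - fst p $ k\<bar> \<le> (if k \<in> S then (1 - \<delta>) * snd p else snd p))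
          \<and> t \<in> {fst p $ i - snd p..fst p $ i + snd p}" for p
        using i by (cases p) (force simp: trim_def abs_le_iff)
      then show "t \<in> {t. ?z f t \<in> ?A} \<longleftrightarrow> t \<in> (\<Union>p\<in>J. {fst p $ i - snd p..fst p $ i + snd p})"
        unfolding J_def mem_Collect_eq UN_iff by blast
    qed
    moreover have "{t. ?z f t \<in> ?B} = (\<Union>p\<in>J. {fst p $ i - (1 - \<delta>) * snd p..fst p $ i + (1 - \<delta>) * snd p})"
    proof (intro set_eqI)
      fix t
      have "?z f t \<in> trim \<delta> (insert i S) p \<longleftrightarrow> (\<forall>k. k \<noteq> i \<longrightarrow> \<bar>y f $ k - fst p $ k\<bar> \<le> (if k \<in> S then (1 - \<delta>) * snd p else snd p))
          \<and> t \<in> {fst p $ i - (1 - \<delta>) * snd p..fst p $ i + (1 - \<delta>) * snd p}" for p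
        using i by (cases p) (force simp: trim_def abs_le_iff)
      then show "t \<in> {t. ?z f t \<in> ?B} \<longleftrightarrow> t \<in> (\<Union>p\<in>J. {fst p $ i - (1 - \<delta>) * snd p..fst p $ i + (1 - \<delta>) * snd p})"
        unfolding J_def mem_Collect_eq UN_iff by blast
    qed
    moreover have "finite J" "\<And>p. p \<in> J \<Longrightarrow> snd p > 0" using F by (auto simp: J_def)
    ultimately show ?thesis
      using interval_family_trim[of J snd \<delta> "\<lambda>p. fst p $ i"] \<delta> by simp
  qed
  have "ennreal (1 - 2 * \<delta>) * emeasure lborel ?A = ennreal (1 - 2 * \<delta>) * (\<integral>\<^sup>+f. emeasure lborel {t. ?z f t \<in> ?A} \<partial>M)"
    by (subst M[OF AB(1)]) simp
  also have "\<dots> = (\<integral>\<^sup>+f. ennreal (1 - 2 * \<delta>) * emeasure lborel {t. ?z f t \<in> ?A} \<partial>M)"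
    by (rule nn_integral_cmult[symmetric]) (rule M'[OF AB(1)])
  also have "\<dots> \<le> (\<integral>\<^sup>+f. emeasure lborel {t. ?z f t \<in> ?B} \<partial>M)"
    using slice by (intro nn_integral_mono) auto
  also have "\<dots> = emeasure lborel ?B" by (rule M[OF AB(2), symmetric])
  finally show ?thesis .
qed

lemma trim_all_coordinates:
  fixes F :: "((real ^ 'n) \<times> real) set" and \<delta> :: real
  assumes F: "finite F" "\<And>c r. (c, r) \<in> F \<Longrightarrow> r > 0" and \<delta>: "0 \<le> (\<delta> :: real)" "\<delta> \<le> 1/2"
  shows "(1 - 2 * real CARD('n) * \<delta>) * measure lebesgue (\<Union>(c, r)\<in>F. cube c r)
    \<le> measure lebesgue (\<Union>(c, r)\<in>F. cube c ((1 - \<delta>) * r))"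
proof -
  have "ennreal ((1 - 2 * \<delta>) ^ card S) * emeasure lborel (\<Union>p\<in>F. trim \<delta> {} p) \<le> emeasure lborel (\<Union>p\<in>F. trim \<delta> S p)"
    if "finite S" for S :: "'n set"
    using that
  proof (induction S)
    case (insert i S)
    have "ennreal ((1 - 2 * \<delta>) ^ card (insert i S)) * emeasure lborel (\<Union>p\<in>F. trim \<delta> {} p)
        = ennreal (1 - 2 * \<delta>) * (ennreal ((1 - 2 * \<delta>) ^ card S) * emeasure lborel (\<Union>p\<in>F. trim \<delta> {} p))"
      using insert \<delta> by (simp add: ennreal_mult mult.assoc)
    also have "\<dots> \<le> ennreal (1 - 2 * \<delta>) * emeasure lborel (\<Union>p\<in>F. trim \<delta> S p)"
      using insert by (intro mult_left_mono) auto
    also have "\<dots> \<le> emeasure lborel (\<Union>p\<in>F. trim \<delta> (insert i S) p)"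
      using trim_one_coordinate[OF F(1) _ \<delta>, of i S] F(2) insert by blast
    finally show ?case .
  qed simp
  from this[of UNIV]
  have le: "ennreal ((1 - 2 * \<delta>) ^ CARD('n)) * emeasure lborel (\<Union>p\<in>F. trim \<delta> {} p) \<le> emeasure lborel (\<Union>p\<in>F. trim \<delta> UNIV p)"
    by simp
  have eq: "trim \<delta> {} (c, r) = cube c r" "trim \<delta> UNIV (c, r) = cube c ((1 - \<delta>) * r)" for c :: "real ^ 'n" and r
    by (auto simp: trim_def cube_def)
  let ?U = "\<Union>(c, r)\<in>F. cube c r" and ?V = "\<Union>(c, r)\<in>F. cube c ((1 - \<delta>) * r)"
  have UV: "(\<Union>p\<in>F. trim \<delta> {} p) = ?U" "(\<Union>p\<in>F. trim \<delta> UNIV p) = ?V"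
    using eq by auto
  have lm: "?U \<in> lmeasurable" "?V \<in> lmeasurable"
    using F(1) by (auto intro!: fmeasurable.finite_UN)
  have b: "?U \<in> sets borel" "?V \<in> sets borel"
    using F(1) by (auto intro!: sets.finite_UN simp: cube_eq_cbox)
  have "(1 - 2 * real CARD('n) * \<delta>) \<le> (1 - 2 * \<delta>) ^ CARD('n)"
    using Bernoulli_inequality[of "- 2 * \<delta>" "CARD('n)"] \<delta> by (simp add: algebra_simps)
  then have "(1 - 2 * real CARD('n) * \<delta>) * measure lebesgue ?U \<le> (1 - 2 * \<delta>) ^ CARD('n) * measure lebesgue ?U"
    by (intro mult_right_mono) auto
  also have "\<dots> \<le> measure lebesgue ?V"
  proof -
    have "ennreal ((1 - 2 * \<delta>) ^ CARD('n)) * emeasure lebesgue ?U \<le> emeasure lebesgue ?V"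
      using le b unfolding UV by simp
    then show ?thesis
      using lm \<delta> by (simp add: emeasure_eq_measure2 ennreal_mult[symmetric] del: emeasure_completion)
  qed
  finally show ?thesis .
qed

section \<open>The Solyanik estimate for Lebesgue measure\<close>

text \<open>With \<open>\<delta> = \<epsilon>\<^sup>1\<^sup>/\<^sup>2\<^sup>n\<close>, a dyadic cube of side comparable to \<open>\<delta> r\<close> through a point of the trimmed
cube lies in the original one, and \<open>E\<close> misses at most the proportion
\<open>4\<^sup>n \<epsilon> / \<delta>\<^sup>n = 4\<^sup>n \<epsilon>\<^sup>1\<^sup>/\<^sup>2\<close> of it. Maximal dyadic cubes with this property are disjoint, so
\<open>E\<close> misses at most this proportion of their union, whatever the overlap of the given cubes.\<close>

lemma solyanik_unweighted:
  fixes F :: "((real ^ 'n) \<times> real) set"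
  assumes F: "finite F" "\<And>c r. (c, r) \<in> F \<Longrightarrow> r > 0" and E: "E \<in> sets lebesgue"
    and \<epsilon>: "0 < \<epsilon>" "\<epsilon> \<le> 1"
    and dens: "\<And>c r. (c, r) \<in> F \<Longrightarrow> measure lebesgue (cube c r - E) \<le> \<epsilon> * (2 * r) ^ CARD('n)"
  shows "measure lebesgue ((\<Union>(c, r)\<in>F. cube c r) - E)
    \<le> (2 * real CARD('n) + 4 ^ CARD('n)) * \<epsilon> powr (1 / (2 * real CARD('n))) * measure lebesgue (\<Union>(c, r)\<in>F. cube c r)"
proof -
  define n where "n = CARD('n)"
  have n: "n > 0" by (simp add: n_def)
  define \<delta> where "\<delta> = \<epsilon> powr (1 / (2 * n))"
  have \<delta>0: "\<delta> > 0" "\<delta> \<le> 1" using \<epsilon> n powr_mono2[of "1 / (2 * n)" \<epsilon> 1] by (auto simp: \<delta>_def)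
  have \<delta>n: "\<delta> ^ n = sqrt \<epsilon>"
  proof -
    have "\<delta> ^ n = \<epsilon> powr (1 / (2 * n) * n)" unfolding \<delta>_def
      using \<epsilon> by (simp add: powr_powr flip: powr_realpow)
    also have "1 / (2 * n) * n = (1/2 :: real)" using n by simp
    finally show ?thesis using \<epsilon> by (simp add: powr_half_sqrt)
  qed
  define U where "U = (\<Union>(c, r)\<in>F. cube c r)"
  have U: "U \<in> lmeasurable" unfolding U_def using F(1) by (auto intro!: fmeasurable.finite_UN)
  have Ud: "A \<in> lmeasurable" if "A \<in> sets lebesgue" "A \<subseteq> U" for A
    using fmeasurableI2[OF U that(2,1)] .
  have UE: "measure lebesgue (U - E) \<le> measure lebesgue U"
    using U E by (intro measure_mono_fmeasurable) auto
  have "measure lebesgue (U - E) \<le> (2 * n + 4 ^ n) * \<delta> * measure lebesgue U"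
  proof (cases "\<delta> \<le> 1/2")
    case False
    have "1 \<le> 2 * real n * \<delta>" using mult_mono[of 1 "real n" "1/2" \<delta>] n False by simp
    then have "1 \<le> (2 * n + 4 ^ n) * \<delta>" using \<delta>0 by (simp add: distrib_right add_increasing2)
    then have "1 * measure lebesgue U \<le> (2 * n + 4 ^ n) * \<delta> * measure lebesgue U"
      by (rule mult_right_mono) simp
    then show ?thesis using UE by linarith
  next
    case True
    define V where "V = (\<Union>(c, r)\<in>F. cube c ((1 - \<delta>) * r))"
    have V: "V \<in> lmeasurable" unfolding V_def using F(1) by (auto intro!: fmeasurable.finite_UN)
    have VU: "V \<subseteq> U"
    proof -
      have "cube c ((1 - \<delta>) * r) \<subseteq> cube c r" if "(c, r) \<in> F" for c r
        using F(2)[OF that] \<delta>0 by (intro cube_mono) (simp add: algebra_simps)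
      then show ?thesis unfolding U_def V_def by blast
    qed
    \<comment> \<open>The level 0 cubes must exceed every trimming width \<delta> r, so that a suitable dyadic cube has
      a parent that is too large.\<close>
    define l where "l = 1 + (\<Sum>p\<in>F. snd p)"
    have lr: "r < l" if "(c, r) \<in> F" for c r
    proof -
      have "snd (c, r) \<le> (\<Sum>p\<in>F. snd p)"
        using that F by (intro member_le_sum) (auto simp: less_imp_le)
      then show ?thesis by (simp add: l_def)
    qed
    have "(\<Sum>p\<in>F. snd p) \<ge> 0" using F(2) by (intro sum_nonneg) (auto simp: less_imp_le)
    then have l: "l > 0" by (simp add: l_def)
    define \<eta> where "\<eta> = 4 ^ n * sqrt \<epsilon>"
    have \<eta>: "\<eta> \<ge> 0" using \<epsilon> by (simp add: \<eta>_def)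
    define \<phi> where "\<phi> P \<longleftrightarrow> P \<subseteq> U \<and> emeasure lebesgue (P - E) \<le> ennreal \<eta> * emeasure lebesgue P" for P
    define \<Omega> where "\<Omega> = {x. \<exists>m. \<phi> (dyadic 0 l m x)}"
    have \<Omega>s: "\<Omega> \<in> sets lebesgue" unfolding \<Omega>_def by (rule dyadic_Union_sets[OF l])
    have \<Omega>U: "\<Omega> \<subseteq> U" using dyadic_self unfolding \<Omega>_def \<phi>_def by blast
    define \<mu> where "\<mu> = density lebesgue (indicator (- E) :: _ \<Rightarrow> ennreal)"
    have \<mu>: "emeasure \<mu> A = emeasure lebesgue (A - E)" if "A \<in> sets lebesgue" for A
      unfolding \<mu>_def Diff_eq Int_commute[of A] by (rule emeasure_density_indicator) (use sets.compl_sets[OF E] that in \<open>auto simp: Compl_eq_Diff_UNIV\<close>)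
    have "emeasure \<mu> \<Omega> \<le> ennreal \<eta> * emeasure lebesgue \<Omega>"
      unfolding \<Omega>_def
    proof (rule dyadic_stopping[OF l])
      fix m x assume "\<phi> (dyadic 0 l m x)"
      then show "emeasure \<mu> (dyadic 0 l m x) \<le> ennreal \<eta> * emeasure lebesgue (dyadic 0 l m x)"
        unfolding \<mu>[OF dyadic_sets[OF l]] \<phi>_def by blast
    qed (auto simp: \<mu>_def)
    moreover have \<Omega>l: "\<Omega> \<in> lmeasurable" by (rule Ud[OF \<Omega>s \<Omega>U])
    moreover have \<Omega>El: "\<Omega> - E \<in> lmeasurable" by (rule fmeasurable_Diff[OF \<Omega>l E])
    ultimately have \<Omega>E: "measure lebesgue (\<Omega> - E) \<le> \<eta> * measure lebesgue \<Omega>"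
      unfolding \<mu>[OF \<Omega>s] using \<eta> by (simp add: emeasure_eq_measure2 ennreal_mult[symmetric] del: emeasure_completion)
    have V\<Omega>: "V \<subseteq> \<Omega>"
    proof
      fix x assume "x \<in> V"
      then obtain c r where cr: "(c, r) \<in> F" and x: "x \<in> cube c ((1 - \<delta>) * r)" unfolding V_def by blast
      have r: "r > 0" by (rule F(2)[OF cr])
      obtain m0 :: nat where "2 ^ m0 > l / (\<delta> * r)" using real_arch_pow[of 2 "l / (\<delta> * r)"] by auto
      then have "l / 2 ^ m0 \<le> \<delta> * r" using r \<delta>0 by (simp add: field_simps)
      then obtain m where m: "l / 2 ^ m \<le> \<delta> * r" "\<And>j. j < m \<Longrightarrow> \<not> l / 2 ^ j \<le> \<delta> * r"
        using exists_least_iff[of "\<lambda>m. l / 2 ^ m \<le> \<delta> * r"] by auto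
      have "m \<noteq> 0"
      proof
        assume "m = 0"
        then have "l \<le> \<delta> * r" using m by simp
        also have "\<dots> \<le> 1 * r" using \<delta>0 r by (intro mult_right_mono) auto
        finally show False using lr[OF cr] by simp
      qed
      then obtain m' where "m = Suc m'" using not0_implies_Suc by blast
      then have m2: "\<delta> * r < 2 * (l / 2 ^ m)" using m(2)[of m'] by simp
      let ?P = "dyadic 0 l m x"
      have PQ: "?P \<subseteq> cube c r"
      proof
        fix y assume y: "y \<in> ?P"
        have "\<bar>y $ i - c $ i\<bar> \<le> r" for i
        proof -
          have xx: "x \<in> ?P" by simp
          have "\<bar>y $ i - x $ i\<bar> \<le> l / 2 ^ m"
            using xx[unfolded dyadic_iff[OF l], rule_format, of i] y[unfolded dyadic_iff[OF l], rule_format, of i]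
            by (simp add: abs_le_iff)
          moreover have "\<bar>x $ i - c $ i\<bar> \<le> (1 - \<delta>) * r" using x by (simp add: cube_def)
          ultimately show ?thesis using m(1) by (simp add: algebra_simps)
        qed
        then show "y \<in> cube c r" by (simp add: cube_def)
      qed
      have "measure lebesgue (?P - E) \<le> measure lebesgue (cube c r - E)"
        using PQ by (intro measure_mono_fmeasurable fmeasurable_Diff sets.Diff E dyadic_sets[OF l] cube_lmeasurable) auto
      also have "\<dots> \<le> \<epsilon> * (2 * r) ^ n" using dens[OF cr] by (simp add: n_def)
      also have "\<dots> \<le> \<epsilon> * (4 / \<delta> * (l / 2 ^ m)) ^ n"
        using \<epsilon> r \<delta>0 m2 by (intro mult_left_mono power_mono) (auto simp: field_simps)
      also have "\<dots> = \<eta> * (l / 2 ^ m) ^ n"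
      proof -
        have "\<epsilon> * (4 / \<delta>) ^ n = \<eta>"
          unfolding \<eta>_def power_divide \<delta>n using \<epsilon> by (simp add: field_simps)
        then show ?thesis by (simp only: power_mult_distrib mult.assoc[symmetric])
      qed
      finally have "measure lebesgue (?P - E) \<le> \<eta> * measure lebesgue ?P"
        unfolding measure_dyadic[OF l] n_def .
      moreover have "?P - E \<in> lmeasurable" using dyadic_lmeasurable[OF l] E by (intro fmeasurable_Diff) auto
      ultimately have "emeasure lebesgue (?P - E) \<le> ennreal \<eta> * emeasure lebesgue ?P"
        using dyadic_lmeasurable[OF l, of 0 m x] \<eta>
        by (simp add: emeasure_eq_measure2 ennreal_mult[symmetric] del: emeasure_completion)
      moreover have "?P \<subseteq> U" using PQ cr unfolding U_def by blast
      ultimately show "x \<in> \<Omega>" unfolding \<Omega>_def \<phi>_def by blast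
    qed
    have "measure lebesgue (U - E) \<le> measure lebesgue ((U - V) \<union> (\<Omega> - E))"
      using V\<Omega> U V E \<Omega>El by (intro measure_mono_fmeasurable fmeasurable.Un \<Omega>El fmeasurable_Diff[OF U]) auto
    also have "\<dots> \<le> measure lebesgue (U - V) + measure lebesgue (\<Omega> - E)"
      using U V \<Omega>s E by (intro measure_Un_le) auto
    also have "measure lebesgue (U - V) = measure lebesgue U - measure lebesgue V"
      using U V VU by (intro measurable_measure_Diff) auto
    also have "\<dots> \<le> 2 * real n * \<delta> * measure lebesgue U"
      using trim_all_coordinates[OF F _ True] \<delta>0 unfolding U_def[symmetric] V_def[symmetric] n_def
      by (simp add: algebra_simps)
    also have "measure lebesgue (\<Omega> - E) \<le> \<eta> * measure lebesgue U"
    proof -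
      have "measure lebesgue \<Omega> \<le> measure lebesgue U" using \<Omega>U \<Omega>s U by (intro measure_mono_fmeasurable) auto
      then show ?thesis using \<Omega>E mult_left_mono[OF _ \<eta>] by (meson order_trans)
    qed
    also have "\<eta> * measure lebesgue U \<le> 4 ^ n * \<delta> * measure lebesgue U"
    proof -
      have "\<delta> ^ n \<le> \<delta> ^ 1" using \<delta>0 n by (intro power_decreasing) auto
      then show ?thesis unfolding \<eta>_def \<delta>n[symmetric] by (intro mult_right_mono mult_left_mono) auto
    qed
    finally show ?thesis by (simp add: algebra_simps)
  qed
  then show ?thesis by (simp add: U_def \<delta>_def n_def)
qed

section \<open>Halos\<close>

definition halo :: "real \<Rightarrow> (real ^ 'n) set \<Rightarrow> (real ^ 'n) set" where
  "halo \<alpha> E = {x. maximal_op (indicator E) x > ennreal \<alpha>}"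

text \<open>The passage from extended to real numbers, made once for all later arguments.\<close>

lemma halo_iff:
  fixes E :: "(real ^ 'n) set"
  assumes "0 \<le> \<alpha>" and E: "E \<in> sets lebesgue"
  shows "x \<in> halo \<alpha> E \<longleftrightarrow>
    (\<exists>c r. r > 0 \<and> x \<in> cube c r \<and> \<alpha> * (2 * r) ^ CARD('n) < measure lebesgue (E \<inter> cube c r))"
proof -
  have avg: "ennreal \<alpha> < (\<integral>\<^sup>+y\<in>cube c r. ennreal \<bar>indicator E y\<bar> \<partial>lebesgue) / emeasure lebesgue (cube c r) \<longleftrightarrow>
      \<alpha> * (2 * r) ^ CARD('n) < measure lebesgue (E \<inter> cube c r)" if r: "r > 0" for c r
  proof -
    have "(\<integral>\<^sup>+y\<in>cube c r. ennreal \<bar>indicator E y\<bar> \<partial>lebesgue) = (\<integral>\<^sup>+y. indicator (E \<inter> cube c r) y \<partial>lebesgue)"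
      by (intro nn_integral_cong) (simp add: indicator_def)
    also have "\<dots> = emeasure lebesgue (E \<inter> cube c r)" using E by (simp del: emeasure_completion)
    also have "\<dots> = ennreal (measure lebesgue (E \<inter> cube c r))"
      using fmeasurableI2[OF cube_lmeasurable[of c r], of "E \<inter> cube c r"] E by (simp add: emeasure_eq_measure2 del: emeasure_completion)
    finally show ?thesis
      using r assms(1) by (simp add: emeasure_cube divide_ennreal ennreal_less_iff field_simps del: emeasure_completion)
  qed
  have "x \<in> halo \<alpha> E \<longleftrightarrow> (\<exists>Q. is_cube Q \<and> x \<in> Q \<and>
      ennreal \<alpha> < (\<integral>\<^sup>+y\<in>Q. ennreal \<bar>indicator E y\<bar> \<partial>lebesgue) / emeasure lebesgue Q)"
    unfolding halo_def maximal_op_def by (simp add: less_SUP_iff del: emeasure_completion)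
  then show ?thesis unfolding is_cube_iff using avg by blast
qed

lemma halo_antimono:
  "\<alpha> \<le> \<beta> \<Longrightarrow> halo \<beta> E \<subseteq> halo \<alpha> E"
  unfolding halo_def by (auto intro: le_less_trans ennreal_leI)

lemma Int_cube_lmeasurable: "E \<in> sets lebesgue \<Longrightarrow> E \<inter> cube c r \<in> lmeasurable"
  by (rule fmeasurableI2[OF cube_lmeasurable[of c r]]) auto

lemma Union_cubes_sets: "finite F \<Longrightarrow> (\<Union>(c, r)\<in>F. cube c r) \<in> sets lebesgue"
  by (intro sets.finite_UN) auto

text \<open>By continuity of the volume; this makes halos open.\<close>

lemma density_enlarge:
  fixes E :: "(real ^ 'n) set"
  assumes r: "r > 0" and E: "E \<in> sets lebesgue"
    and d: "\<alpha> * (2 * r) ^ CARD('n) < measure lebesgue (E \<inter> cube c r)"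
  obtains s where "s > r" "\<alpha> * (2 * s) ^ CARD('n) < measure lebesgue (E \<inter> cube c s)"
proof -
  have "((\<lambda>s. \<alpha> * (2 * s) ^ CARD('n)) \<longlongrightarrow> \<alpha> * (2 * r) ^ CARD('n)) (at_right r)"
    by (intro tendsto_intros)
  then have "\<forall>\<^sub>F s in at_right r. \<alpha> * (2 * s) ^ CARD('n) < measure lebesgue (E \<inter> cube c r)"
    using d by (rule order_tendstoD)
  then obtain b where b: "b > r" "\<And>s. s > r \<Longrightarrow> s < b \<Longrightarrow> \<alpha> * (2 * s) ^ CARD('n) < measure lebesgue (E \<inter> cube c r)"
    unfolding eventually_at_right_field by blast
  obtain s where s: "r < s" "s < b" using dense[OF b(1)] by blast
  have "measure lebesgue (E \<inter> cube c r) \<le> measure lebesgue (E \<inter> cube c s)"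
    using cube_mono[of r s c] s by (intro measure_mono_fmeasurable Int_cube_lmeasurable[OF E] fmeasurableD) auto
  then show ?thesis using b(2)[OF s] s(1) that by force
qed

definition open_cube :: "real ^ 'n \<Rightarrow> real \<Rightarrow> (real ^ 'n) set" where
  "open_cube c r = box (\<chi> i. c $ i - r) (\<chi> i. c $ i + r)"

lemma open_cube_subset: "open_cube c r \<subseteq> cube c r"
  unfolding open_cube_def cube_eq_cbox by (rule box_subset_cbox)

lemma cube_subset_open_cube: "r < s \<Longrightarrow> cube c r \<subseteq> open_cube c s"
proof
  fix x assume rs: "r < s" and x: "x \<in> cube c r"
  have "c $ i - s < x $ i \<and> x $ i < c $ i + s" for i
    using x rs by (auto simp: cube_def abs_diff_le_iff dest!: spec[of _ i])
  then show "x \<in> open_cube c s" by (simp add: open_cube_def mem_box_cart)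
qed

lemma halo_Union_open_cube:
  fixes E :: "(real ^ 'n) set"
  assumes "0 \<le> \<alpha>" and E: "E \<in> sets lebesgue"
  shows "halo \<alpha> E = (\<Union>(c, r)\<in>{(c, r). r > 0 \<and> \<alpha> * (2 * r) ^ CARD('n) < measure lebesgue (E \<inter> cube c r)}. open_cube c r)"
proof (intro set_eqI iffI)
  fix x assume "x \<in> halo \<alpha> E"
  then obtain c r where r: "r > 0" "x \<in> cube c r" "\<alpha> * (2 * r) ^ CARD('n) < measure lebesgue (E \<inter> cube c r)"
    unfolding halo_iff[OF assms] by blast
  obtain s where "s > r" "\<alpha> * (2 * s) ^ CARD('n) < measure lebesgue (E \<inter> cube c s)"
    using density_enlarge[OF r(1) E r(3)] .
  moreover have "x \<in> open_cube c s" using cube_subset_open_cube[OF \<open>s > r\<close>, of c] r(2) by blast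
  ultimately show "x \<in> (\<Union>(c, r)\<in>{(c, r). r > 0 \<and> \<alpha> * (2 * r) ^ CARD('n) < measure lebesgue (E \<inter> cube c r)}. open_cube c r)"
    using r(1) by (intro UN_I[of "(c, s)"]) auto
next
  fix x assume "x \<in> (\<Union>(c, r)\<in>{(c, r). r > 0 \<and> \<alpha> * (2 * r) ^ CARD('n) < measure lebesgue (E \<inter> cube c r)}. open_cube c r)"
  then obtain c r where "r > 0" "\<alpha> * (2 * r) ^ CARD('n) < measure lebesgue (E \<inter> cube c r)" "x \<in> open_cube c r" by blast
  then show "x \<in> halo \<alpha> E" unfolding halo_iff[OF assms] using open_cube_subset[of c r] by blast
qed

lemma halo_open:
  assumes "0 \<le> \<alpha>" "E \<in> sets lebesgue" shows "open (halo \<alpha> E)"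
  unfolding halo_Union_open_cube[OF assms] by (intro open_UN) (auto simp: open_cube_def open_box)

lemma halo_sets:
  assumes "0 \<le> \<alpha>" "E \<in> sets lebesgue" shows "halo \<alpha> E \<in> sets lebesgue"
  using halo_open[OF assms] by (simp add: borel_open)

text \<open>Halos are countable unions of the interiors of the defining cubes, so measure bounds may be
proved for finite families of cubes.\<close>

lemma halo_emeasure_le:
  fixes E :: "(real ^ 'n) set"
  assumes \<alpha>: "0 \<le> \<alpha>" and E: "E \<in> sets lebesgue" and w: "sets \<mu> = sets lebesgue"
    and le: "\<And>F. finite F \<Longrightarrow> (\<And>c r. (c, r) \<in> F \<Longrightarrow> r > 0 \<and> \<alpha> * (2 * r) ^ CARD('n) < measure lebesgue (E \<inter> cube c r))
      \<Longrightarrow> emeasure \<mu> (\<Union>(c, r)\<in>F. cube c r) \<le> B"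
  shows "emeasure \<mu> (halo \<alpha> E) \<le> B"
proof -
  define P where "P = {(c :: real ^ 'n, r). r > 0 \<and> \<alpha> * (2 * r) ^ CARD('n) < measure lebesgue (E \<inter> cube c r)}"
  have H: "halo \<alpha> E = (\<Union>p\<in>P. open_cube (fst p) (snd p))"
    unfolding halo_Union_open_cube[OF \<alpha> E] P_def by (simp add: split_beta)
  have "\<exists>P'\<subseteq>P. countable P' \<and> (\<Union>p\<in>P'. open_cube (fst p) (snd p)) = (\<Union>p\<in>P. open_cube (fst p) (snd p))"
  proof -
    obtain \<C> where \<C>: "\<C> \<subseteq> (\<lambda>p. open_cube (fst p) (snd p)) ` P" "countable \<C>" "\<Union>\<C> = (\<Union>p\<in>P. open_cube (fst p) (snd p))"
    proof (rule Lindelof[of "(\<lambda>p. open_cube (fst p) (snd p)) ` P"])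
      show "open S" if "S \<in> (\<lambda>p. open_cube (fst p) (snd p)) ` P" for S
        using that unfolding open_cube_def by (elim imageE) (simp only: open_box)
    qed
    obtain P' where "P' \<subseteq> P" "countable P'" "\<C> = (\<lambda>p. open_cube (fst p) (snd p)) ` P'"
      using countable_subset_image[of \<C> "\<lambda>p. open_cube (fst p) (snd p)" P] \<C>(1,2) by blast
    then show ?thesis using \<C>(3) by auto
  qed
  then obtain P' where P': "P' \<subseteq> P" "countable P'" "halo \<alpha> E = (\<Union>p\<in>P'. open_cube (fst p) (snd p))" using H by auto
  show ?thesis
  proof (cases "P' = {}")
    case True
    then show ?thesis using P' by simp
  next
    case False
    define f where "f = from_nat_into P'"
    have f: "range f = P'" using P'(2) False by (simp add: f_def range_from_nat_into)
    define X where "X k = (\<Union>i<k. open_cube (fst (f i)) (snd (f i)))" for k :: nat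
    have "halo \<alpha> E = (\<Union>k. X k)" unfolding P'(3) f[symmetric] X_def by auto
    moreover have "(SUP k. emeasure \<mu> (X k)) = emeasure \<mu> (\<Union>k. X k)"
    proof (rule SUP_emeasure_incseq)
      show "range X \<subseteq> sets \<mu>" by (auto simp: X_def w open_cube_def)
      show "incseq X" unfolding incseq_def X_def by (intro allI impI UN_mono) auto
    qed
    moreover have "(SUP k. emeasure \<mu> (X k)) \<le> B"
    proof (rule SUP_least)
      fix k
      have fP: "f i \<in> P" for i using f P'(1) by blast
      have sub: "X k \<subseteq> (\<Union>(c, r)\<in>f ` {..<k}. cube c r)"
        unfolding X_def using open_cube_subset by (fastforce simp: split_beta)
      have "emeasure \<mu> (X k) \<le> emeasure \<mu> (\<Union>(c, r)\<in>f ` {..<k}. cube c r)"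
        by (rule emeasure_mono[OF sub]) (simp only: w Union_cubes_sets finite_imageI finite_lessThan)
      also have "\<dots> \<le> B"
      proof (rule le)
        fix c r assume "(c, r) \<in> f ` {..<k}"
        then have "(c, r) \<in> P" using fP by (metis imageE)
        then show "r > 0 \<and> \<alpha> * (2 * r) ^ CARD('n) < measure lebesgue (E \<inter> cube c r)" by (simp add: P_def)
      qed simp
      finally show "emeasure \<mu> (X k) \<le> B" .
    qed
    ultimately show ?thesis by simp
  qed
qed

section \<open>The Solyanik estimate for weights\<close>

lemma cube_vitali:
  assumes "finite F" "\<And>c r. (c, r) \<in> F \<Longrightarrow> r > 0"
  shows "\<exists>G\<subseteq>F. disjoint_family_on (\<lambda>(c, r). cube c r) G \<and> (\<forall>(c, r)\<in>F. \<exists>(c', r')\<in>G. cube c r \<subseteq> cube c' (3 * r'))"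
  using assms
proof (induction F rule: finite_psubset_induct)
  case (psubset F)
  show ?case
  proof (cases "F = {}")
    case False
    obtain p0 where p0: "p0 \<in> F" "\<And>q. q \<in> F \<Longrightarrow> snd q \<le> snd p0"
      using ex_is_arg_min_if_finite[OF psubset.hyps False, of "\<lambda>p. - snd p"] unfolding is_arg_min_linorder
      by (metis neg_le_iff_le)
    obtain c0 r0 where cr0: "p0 = (c0, r0)" by (cases p0)
    have r0: "r0 > 0" using psubset.prems p0(1) cr0 by blast
    define F' where "F' = {(c, r) \<in> F. cube c r \<inter> cube c0 r0 = {}}"
    have c0: "c0 \<in> cube c0 r0" using r0 by (simp add: cube_def)
    have "F' \<subset> F" using p0(1) c0 unfolding F'_def cr0 by blast
    from psubset.IH[OF this] psubset.prems \<open>F' \<subset> F\<close>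
    obtain G' where G': "G' \<subseteq> F'" "disjoint_family_on (\<lambda>(c, r). cube c r) G'"
      "\<forall>(c, r)\<in>F'. \<exists>(c', r')\<in>G'. cube c r \<subseteq> cube c' (3 * r')" by blast
    show ?thesis
    proof (intro exI[of _ "insert p0 G'"] conjI)
      show "insert p0 G' \<subseteq> F" using p0 G'(1) \<open>F' \<subset> F\<close> by blast
      have "cube c r \<inter> cube c0 r0 = {}" if "(c, r) \<in> G'" for c r using that G'(1) by (auto simp: F'_def)
      then show "disjoint_family_on (\<lambda>(c, r). cube c r) (insert p0 G')"
        using G'(2) unfolding disjoint_family_on_def cr0 by (fastforce simp: Int_commute)
      show "\<forall>(c, r)\<in>F. \<exists>(c', r')\<in>insert p0 G'. cube c r \<subseteq> cube c' (3 * r')"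
      proof clarify
        fix c r assume cr: "(c, r) \<in> F"
        show "\<exists>(c', r')\<in>insert p0 G'. cube c r \<subseteq> cube c' (3 * r')"
        proof (cases "(c, r) \<in> F'")
          case True
          then show ?thesis using G'(3) by blast
        next
          case f: False
          then obtain z where z: "z \<in> cube c r" "z \<in> cube c0 r0" using cr by (auto simp: F'_def)
          have rr: "r \<le> r0" using p0(2)[OF cr] cr0 by simp
          have "cube c r \<subseteq> cube c0 (3 * r0)"
          proof
            fix y assume y: "y \<in> cube c r"
            have "\<bar>y $ i - c0 $ i\<bar> \<le> 3 * r0" for i
            proof -
              have "\<bar>y $ i - c $ i\<bar> \<le> r" "\<bar>z $ i - c $ i\<bar> \<le> r" "\<bar>z $ i - c0 $ i\<bar> \<le> r0"
                using y z by (auto simp: cube_def)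
              then show ?thesis using rr by linarith
            qed
            then show "y \<in> cube c0 (3 * r0)" by (simp add: cube_def)
          qed
          then show ?thesis unfolding cr0 by blast
        qed
      qed
    qed
  qed (auto simp: disjoint_family_on_def)
qed

lemma powr_small:
  fixes C p :: real
  assumes "C > 0" "p > 0"
  obtains \<kappa> where "0 < \<kappa>" "\<kappa> \<le> 1" "\<And>t. 0 \<le> t \<Longrightarrow> t \<le> \<kappa> \<Longrightarrow> C * t powr p \<le> 1/2"
proof
  let ?k = "min 1 ((1 / (2 * C)) powr (1 / p))"
  show "0 < ?k" "?k \<le> 1" using assms by auto
  fix t :: real assume t: "0 \<le> t" "t \<le> ?k"
  have "t powr p \<le> ((1 / (2 * C)) powr (1 / p)) powr p" using t assms by (intro powr_mono2) auto
  also have "\<dots> = 1 / (2 * C)" using assms by (simp add: powr_powr)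
  finally show "C * t powr p \<le> 1/2" using assms by (simp add: field_simps)
qed

text \<open>Enlarging a cube by a factor \<open>\<rho>\<close> close to \<open>1\<close> adds a set of small relative measure, hence of at
most half the weight; so the weight at most doubles. Iteration reaches the factor \<open>3\<close>.\<close>

lemma A_infty_doubling:
  fixes w :: "real ^ 'n \<Rightarrow> real"
  assumes w: "w \<in> A_infty"
  shows "\<exists>D>0. \<forall>c r. r > 0 \<longrightarrow> measure (weight_measure w) (cube c (3 * r)) \<le> D * measure (weight_measure w) (cube c r)"
proof -
  have iw: "is_weight w" using w by (auto simp: A_infty_def)
  define p where "p = 1 / (2 ^ (CARD('n) + 3) * enn2real (fujii_wilson w))"
  have p: "p > 0" using fujii_wilson_ge_1[OF w] by (simp add: p_def)
  obtain C where C: "C > 0" "\<And>c r A. r > 0 \<Longrightarrow> A \<in> sets lebesgue \<Longrightarrow> A \<subseteq> cube c r \<Longrightarrow>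
     measure (weight_measure w) A \<le> C * (measure lebesgue A / (2 * r) ^ CARD('n)) powr p * measure (weight_measure w) (cube c r)"
    using A_infty_estimate[OF w] unfolding p_def by blast
  obtain \<kappa> where \<kappa>: "0 < \<kappa>" "\<kappa> \<le> 1" "\<And>t. 0 \<le> t \<Longrightarrow> t \<le> \<kappa> \<Longrightarrow> C * t powr p \<le> 1/2"
    using powr_small[OF C(1) p] by blast
  define \<tau> where "\<tau> = \<kappa> / (2 * CARD('n))"
  have \<tau>: "0 < \<tau>" "\<tau> < 1"
  proof -
    show "0 < \<tau>" using \<kappa> by (simp add: \<tau>_def)
    have "1 \<le> real CARD('n)" by (simp add: Suc_leI)
    then have "\<kappa> < 2 * real CARD('n)" using \<kappa>(2) by linarith
    then show "\<tau> < 1" by (simp add: \<tau>_def)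
  qed
  define \<rho> where "\<rho> = 1 / (1 - \<tau>)"
  have \<rho>: "\<rho> > 1" using \<tau> by (simp add: \<rho>_def)
  have step: "measure (weight_measure w) (cube c (\<rho> * r)) \<le> 2 * measure (weight_measure w) (cube c r)" if r: "r > 0" for c r
  proof -
    let ?A = "cube c (\<rho> * r) - cube c r"
    have sub: "cube c r \<subseteq> cube c (\<rho> * r)" using r \<rho> by (intro cube_mono) simp
    have \<rho>r: "\<rho> * r > 0" using r \<rho> by simp
    have "measure lebesgue ?A = (2 * (\<rho> * r)) ^ CARD('n) - (2 * r) ^ CARD('n)"
    proof -
      have "measure lebesgue ?A = measure lebesgue (cube c (\<rho> * r)) - measure lebesgue (cube c r)"
        by (rule measurable_measure_Diff) (use sub in auto)
      then show ?thesis using measure_cube[of r c] measure_cube[of "\<rho> * r" c] r \<rho>r by linarith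
    qed
    then have "measure lebesgue ?A / (2 * (\<rho> * r)) ^ CARD('n) = 1 - (2 * r / (2 * (\<rho> * r))) ^ CARD('n)"
    proof -
      have "2 * (\<rho> * r) \<noteq> 0" using \<rho>r by linarith
      then have "(2 * (\<rho> * r)) ^ CARD('n) \<noteq> 0" by (rule power_not_zero)
      then show ?thesis unfolding \<open>measure lebesgue ?A = _\<close> diff_divide_distrib power_divide by (simp only: divide_self not_False_eq_True)
    qed
    also have "2 * r / (2 * (\<rho> * r)) = 1 - \<tau>" using r \<tau> by (simp add: \<rho>_def)
    finally have e: "measure lebesgue ?A / (2 * (\<rho> * r)) ^ CARD('n) = 1 - (1 - \<tau>) ^ CARD('n)" .
    have "1 - real CARD('n) * \<tau> \<le> (1 - \<tau>) ^ CARD('n)"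
      using Bernoulli_inequality[of "- \<tau>" "CARD('n)"] \<tau> by simp
    moreover have "real CARD('n) * \<tau> \<le> \<kappa>" using \<kappa> by (simp add: \<tau>_def)
    moreover have "(1 - \<tau>) ^ CARD('n) \<le> 1" using \<tau> by (intro power_le_one) auto
    ultimately have half: "C * (1 - (1 - \<tau>) ^ CARD('n)) powr p \<le> 1/2" by (intro \<kappa>(3)) auto
    have "measure (weight_measure w) ?A \<le> C * (1 - (1 - \<tau>) ^ CARD('n)) powr p * measure (weight_measure w) (cube c (\<rho> * r))"
      using C(2)[OF \<rho>r, of ?A c] unfolding e by simp
    also have "\<dots> \<le> 1/2 * measure (weight_measure w) (cube c (\<rho> * r))"
      using half by (rule mult_right_mono) simp
    finally have "measure (weight_measure w) ?A \<le> 1/2 * measure (weight_measure w) (cube c (\<rho> * r))" .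
    moreover have "measure (weight_measure w) ?A = measure (weight_measure w) (cube c (\<rho> * r)) - measure (weight_measure w) (cube c r)"
      using sub weight_measure_cube_finite[OF iw] by (intro measure_Diff) (auto simp: less_top[symmetric])
    ultimately show ?thesis by simp
  qed
  obtain k where k: "\<rho> ^ k > 3" using real_arch_pow[OF \<rho>] by blast
  have iter: "measure (weight_measure w) (cube c (\<rho> ^ j * r)) \<le> 2 ^ j * measure (weight_measure w) (cube c r)" if r: "r > 0" for c r j
  proof (induction j)
    case (Suc j)
    have "\<rho> ^ j * r > 0" using \<rho> r by simp
    from step[OF this, of c] Suc show ?case by (simp add: mult.assoc)
  qed simp
  have "measure (weight_measure w) (cube c (3 * r)) \<le> 2 ^ k * measure (weight_measure w) (cube c r)" if r: "r > 0" for c r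
  proof -
    have "cube c (3 * r) \<subseteq> cube c (\<rho> ^ k * r)" using k r by (intro cube_mono) simp
    then have "measure (weight_measure w) (cube c (3 * r)) \<le> measure (weight_measure w) (cube c (\<rho> ^ k * r))"
      using weight_measure_cube_finite[OF iw] by (intro measure_mono_fmeasurable) (auto intro!: fmeasurableI)
    then show ?thesis using iter[OF r, of c k] by linarith
  qed
  then show ?thesis by (intro exI[of _ "2 ^ k"]) auto
qed

text \<open>Each cube lies in the triple of one of the disjoint cubes selected by Vitali. In each triple the
Lebesgue estimate makes \<open>V - E\<close> small relative to the triple, absolute continuity makes its weight
small relative to the weight of the triple, and by doubling and the high density of \<open>E\<close> this weight
is comparable to the weight of \<open>E\<close> in the selected cube. These contributions are disjoint.\<close>

lemma solyanik_weighted_finite: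
  fixes w :: "real ^ 'n \<Rightarrow> real"
  assumes w: "w \<in> A_infty"
  defines "p \<equiv> 1 / (2 * real CARD('n) * 2 ^ (CARD('n) + 3) * enn2real (fujii_wilson w))"
  shows "\<exists>\<kappa> C. 0 < \<kappa> \<and> \<kappa> \<le> 1 \<and> 0 < C \<and> (\<forall>\<epsilon> E F. 0 < \<epsilon> \<longrightarrow> \<epsilon> \<le> \<kappa> \<longrightarrow> E \<in> sets lebesgue \<longrightarrow> finite F \<longrightarrow>
     (\<forall>c r. (c, r) \<in> F \<longrightarrow> r > 0 \<and> measure lebesgue (cube c r - E) \<le> \<epsilon> * (2 * r) ^ CARD('n)) \<longrightarrow>
     emeasure (weight_measure w) ((\<Union>(c, r)\<in>F. cube c r) - E) \<le> ennreal (C * \<epsilon> powr p) * emeasure (weight_measure w) E)"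
proof -
  have iw: "is_weight w" using w by (auto simp: A_infty_def)
  define n where "n = CARD('n)"
  have n: "n > 0" by (simp add: n_def)
  define p0 where "p0 = 1 / (2 ^ (CARD('n) + 3) * enn2real (fujii_wilson w))"
  have p0: "p0 > 0" using fujii_wilson_ge_1[OF w] by (simp add: p0_def)
  have pp0: "p = 1 / (2 * real n) * p0" by (simp add: p_def p0_def n_def)
  obtain C where C: "C > 0" "\<And>c r A. r > 0 \<Longrightarrow> A \<in> sets lebesgue \<Longrightarrow> A \<subseteq> cube c r \<Longrightarrow>
     measure (weight_measure w) A \<le> C * (measure lebesgue A / (2 * r) ^ n) powr p0 * measure (weight_measure w) (cube c r)"
    using A_infty_estimate[OF w] unfolding p0_def n_def by blast
  obtain D where D: "D > 0" "\<And>c r. r > 0 \<Longrightarrow> measure (weight_measure w) (cube c (3 * r)) \<le> D * measure (weight_measure w) (cube c r)"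
    using A_infty_doubling[OF w] by blast
  obtain \<kappa> where \<kappa>: "0 < \<kappa>" "\<kappa> \<le> 1" "\<And>t. 0 \<le> t \<Longrightarrow> t \<le> \<kappa> \<Longrightarrow> C * t powr p0 \<le> 1/2"
    using powr_small[OF C(1) p0] by blast
  define A where "A = 2 * real n + 4 ^ n"
  have A: "A > 0" using n by (simp add: A_def add_pos_pos)
  define C1 where "C1 = 2 * C * A powr p0 * D"
  have C1: "C1 > 0" using A C D by (simp add: C1_def)
  have main: "emeasure (weight_measure w) ((\<Union>(c, r)\<in>F. cube c r) - E) \<le> ennreal (C1 * \<epsilon> powr p) * emeasure (weight_measure w) E"
    if \<epsilon>: "0 < \<epsilon>" "\<epsilon> \<le> \<kappa>" and E: "E \<in> sets lebesgue" and F: "finite F"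
      "\<And>c r. (c, r) \<in> F \<Longrightarrow> r > 0" "\<And>c r. (c, r) \<in> F \<Longrightarrow> measure lebesgue (cube c r - E) \<le> \<epsilon> * (2 * r) ^ n"
    for \<epsilon> E F
  proof -
    obtain G where G: "G \<subseteq> F" "disjoint_family_on (\<lambda>(c, r). cube c r) G"
       "\<forall>(c, r)\<in>F. \<exists>(c', r')\<in>G. cube c r \<subseteq> cube c' (3 * r')"
    proof -
      have "\<exists>G\<subseteq>F. disjoint_family_on (\<lambda>(c, r). cube c r) G \<and> (\<forall>(c, r)\<in>F. \<exists>(c', r')\<in>G. cube c r \<subseteq> cube c' (3 * r'))"
        by (rule cube_vitali[OF F(1)]) (rule F(2))
      then show ?thesis by (elim exE conjE) (rule that)
    qed
    have fG: "finite G" using G(1) F(1) finite_subset by blast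
    \<comment> \<open>The union of those cubes of the family that lie in the triple of a given one.\<close>
    define V where "V = (\<lambda>(c, r). \<Union>(c', r')\<in>{(c', r') \<in> F. cube c' r' \<subseteq> cube c (3 * r)}. cube c' r')"
    have Vs: "V g \<in> sets lebesgue" for g
    proof (cases g)
      case (Pair c r)
      show ?thesis unfolding Pair V_def prod.case
        by (rule Union_cubes_sets, rule finite_subset[OF _ F(1)]) auto
    qed
    have loc: "emeasure (weight_measure w) (V (c, r) - E) \<le> ennreal (C1 * \<epsilon> powr p) * emeasure (weight_measure w) (cube c r \<inter> E)"
      if cr: "(c, r) \<in> G" for c r
    proof -
      have crF: "(c, r) \<in> F" using cr G(1) by blast
      have r: "r > 0" by (rule F(2)[OF crF])
      define F' where "F' = {(c', r') \<in> F. cube c' r' \<subseteq> cube c (3 * r)}"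
      have F': "finite F'" "F' \<subseteq> F" using F(1) by (auto simp: F'_def intro: finite_subset)
      have VF': "V (c, r) = (\<Union>(c', r')\<in>F'. cube c' r')" by (simp add: V_def F'_def)
      have Vsub: "V (c, r) \<subseteq> cube c (3 * r)" unfolding VF' F'_def by blast
      have "measure lebesgue (V (c, r) - E) \<le> (2 * real n + 4 ^ n) * \<epsilon> powr (1 / (2 * real n)) * measure lebesgue (V (c, r))"
        unfolding VF' n_def
      proof (rule solyanik_unweighted[OF F'(1) _ E \<epsilon>(1)])
        show "\<epsilon> \<le> 1" using \<epsilon>(2) \<kappa>(2) by linarith
        fix c r assume "(c, r) \<in> F'"
        then have "(c, r) \<in> F" using F'(2) by blast
        then show "r > 0" "measure lebesgue (cube c r - E) \<le> \<epsilon> * (2 * r) ^ CARD('n)"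
          using F(2,3) unfolding n_def by blast+
      qed
      also have "measure lebesgue (V (c, r)) \<le> measure lebesgue (cube c (3 * r))"
        using Vsub Vs by (intro measure_mono_fmeasurable) auto
      also have "\<dots> = (2 * (3 * r)) ^ n" unfolding n_def using r by (intro measure_cube) auto
      finally have "measure lebesgue (V (c, r) - E) \<le> A * \<epsilon> powr (1 / (2 * real n)) * (2 * (3 * r)) ^ n"
        unfolding A_def by (simp add: mult_left_mono)
      then have q: "measure lebesgue (V (c, r) - E) / (2 * (3 * r)) ^ n \<le> A * \<epsilon> powr (1 / (2 * real n))"
        using r by (simp add: pos_divide_le_eq)
      have "measure (weight_measure w) (V (c, r) - E)
          \<le> C * (measure lebesgue (V (c, r) - E) / (2 * (3 * r)) ^ n) powr p0 * measure (weight_measure w) (cube c (3 * r))"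
        using Vsub Vs E r by (intro C(2)) auto
      also have "\<dots> \<le> C * (A * \<epsilon> powr (1 / (2 * real n))) powr p0 * (D * measure (weight_measure w) (cube c r))"
        using C(1) q p0 r A D by (intro mult_mono mult_left_mono powr_mono2) auto
      also have "(A * \<epsilon> powr (1 / (2 * real n))) powr p0 = A powr p0 * \<epsilon> powr p"
        using A \<epsilon> by (simp add: powr_mult powr_powr pp0)
      finally have 1: "measure (weight_measure w) (V (c, r) - E) \<le> C1 / 2 * \<epsilon> powr p * measure (weight_measure w) (cube c r)"
        by (simp add: C1_def mult_ac)
      have "measure (weight_measure w) (cube c r - E) \<le> C * (measure lebesgue (cube c r - E) / (2 * r) ^ n) powr p0 * measure (weight_measure w) (cube c r)"
        using E r by (intro C(2)) auto
      also have "\<dots> \<le> 1/2 * measure (weight_measure w) (cube c r)"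
      proof (intro mult_right_mono \<kappa>(3))
        show "measure lebesgue (cube c r - E) / (2 * r) ^ n \<le> \<kappa>"
          using F(3)[OF crF] r \<epsilon>(2) by (simp add: pos_divide_le_eq) (meson mult_right_mono order_trans zero_le_power mult_nonneg_nonneg less_imp_le zero_le_numeral)
      qed (use r in auto)
      finally have "measure (weight_measure w) (cube c r - E) \<le> 1/2 * measure (weight_measure w) (cube c r)" .
      moreover have "measure (weight_measure w) (cube c r) = measure (weight_measure w) (cube c r - E) + measure (weight_measure w) (cube c r \<inter> E)"
      proof -
        have "emeasure (weight_measure w) (cube c r) = emeasure (weight_measure w) (cube c r - E) + emeasure (weight_measure w) (cube c r \<inter> E)"
          using E by (subst plus_emeasure) (auto intro!: arg_cong[where f = "emeasure (weight_measure w)"])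
        then show ?thesis
          using E by (simp add: weight_measure_ennreal[OF iw, of _ c r] flip: ennreal_plus)
      qed
      ultimately have 2: "measure (weight_measure w) (cube c r) \<le> 2 * measure (weight_measure w) (cube c r \<inter> E)" by simp
      have "measure (weight_measure w) (V (c, r) - E) \<le> C1 / 2 * \<epsilon> powr p * (2 * measure (weight_measure w) (cube c r \<inter> E))"
        using C1 \<epsilon> by (intro order_trans[OF 1] mult_left_mono 2) auto
      then have "measure (weight_measure w) (V (c, r) - E) \<le> C1 * \<epsilon> powr p * measure (weight_measure w) (cube c r \<inter> E)" by simp
      moreover have "emeasure (weight_measure w) (V (c, r) - E) = ennreal (measure (weight_measure w) (V (c, r) - E))"
        using Vsub Vs E by (intro weight_measure_ennreal[OF iw, of _ c "3 * r"]) auto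
      moreover have "emeasure (weight_measure w) (cube c r \<inter> E) = ennreal (measure (weight_measure w) (cube c r \<inter> E))"
        using E by (intro weight_measure_ennreal[OF iw, of _ c r]) auto
      ultimately show ?thesis using C1 by (simp add: ennreal_mult[symmetric])
    qed
    have sub: "(\<Union>(c, r)\<in>F. cube c r) - E \<subseteq> (\<Union>g\<in>G. V g - E)"
    proof
      fix x assume "x \<in> (\<Union>(c, r)\<in>F. cube c r) - E"
      then obtain c r where x: "(c, r) \<in> F" "x \<in> cube c r" "x \<notin> E" by blast
      then obtain c' r' where "(c', r') \<in> G" "cube c r \<subseteq> cube c' (3 * r')" using G(3) by blast
      moreover have "x \<in> V (c', r')" unfolding V_def using x calculation(2) by auto
      ultimately show "x \<in> (\<Union>g\<in>G. V g - E)" using x(3) by blast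
    qed
    have "emeasure (weight_measure w) ((\<Union>(c, r)\<in>F. cube c r) - E) \<le> emeasure (weight_measure w) (\<Union>g\<in>G. V g - E)"
      unfolding sets_weight_measure[symmetric] using fG Vs E
      by (intro emeasure_mono[OF sub] sets.finite_UN sets.Diff) (simp_all only: sets_weight_measure)
    also have "\<dots> \<le> (\<Sum>g\<in>G. emeasure (weight_measure w) (V g - E))"
      using fG Vs E by (intro emeasure_subadditive_finite) auto
    also have "\<dots> \<le> (\<Sum>g\<in>G. ennreal (C1 * \<epsilon> powr p) * emeasure (weight_measure w) ((case g of (c, r) \<Rightarrow> cube c r) \<inter> E))"
      using loc by (intro sum_mono) auto
    also have "\<dots> = ennreal (C1 * \<epsilon> powr p) * emeasure (weight_measure w) (\<Union>g\<in>G. (case g of (c, r) \<Rightarrow> cube c r) \<inter> E)"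
    proof -
      have "disjoint_family_on (\<lambda>g. (case g of (c, r) \<Rightarrow> cube c r) \<inter> E) G"
        using G(2) unfolding disjoint_family_on_def by blast
      moreover have "(\<lambda>g. (case g of (c, r) \<Rightarrow> cube c r) \<inter> E) ` G \<subseteq> sets (weight_measure w)"
        using E by auto
      ultimately show ?thesis
        unfolding sum_distrib_left[symmetric] by (subst sum_emeasure[OF _ _ fG]) auto
    qed
    also have "\<dots> \<le> ennreal (C1 * \<epsilon> powr p) * emeasure (weight_measure w) E"
      using E by (intro mult_left_mono emeasure_mono) auto
    finally show ?thesis .
  qed
  show ?thesis
    by (rule exI[of _ \<kappa>], rule exI[of _ C1]) (use \<kappa> C1 main in \<open>auto simp: n_def\<close>)
qed

lemma solyanik_weighted:
  fixes w :: "real ^ 'n \<Rightarrow> real"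
  assumes w: "w \<in> A_infty"
  defines "p \<equiv> 1 / (2 * real CARD('n) * 2 ^ (CARD('n) + 3) * enn2real (fujii_wilson w))"
  shows "\<exists>\<kappa> C. 0 < \<kappa> \<and> \<kappa> \<le> 1 \<and> 0 < C \<and> (\<forall>\<epsilon> E. 0 < \<epsilon> \<longrightarrow> \<epsilon> \<le> \<kappa> \<longrightarrow> E \<in> sets lebesgue \<longrightarrow>
     emeasure (weight_measure w) (halo (1 - \<epsilon>) E) \<le> ennreal (1 + C * \<epsilon> powr p) * emeasure (weight_measure w) E)"
proof -
  obtain \<kappa> C where \<kappa>: "0 < \<kappa>" "\<kappa> \<le> 1" "0 < C"
    and le: "\<And>\<epsilon> E F. 0 < \<epsilon> \<Longrightarrow> \<epsilon> \<le> \<kappa> \<Longrightarrow> E \<in> sets lebesgue \<Longrightarrow> finite F \<Longrightarrow>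
     (\<And>c r. (c, r) \<in> F \<Longrightarrow> r > 0 \<and> measure lebesgue (cube c r - E) \<le> \<epsilon> * (2 * r) ^ CARD('n)) \<Longrightarrow>
     emeasure (weight_measure w) ((\<Union>(c, r)\<in>F. cube c r) - E) \<le> ennreal (C * \<epsilon> powr p) * emeasure (weight_measure w) E"
    using solyanik_weighted_finite[OF w] unfolding p_def by metis
  have "emeasure (weight_measure w) (halo (1 - \<epsilon>) E) \<le> ennreal (1 + C * \<epsilon> powr p) * emeasure (weight_measure w) E"
    if \<epsilon>: "0 < \<epsilon>" "\<epsilon> \<le> \<kappa>" and E: "E \<in> sets lebesgue" for \<epsilon> E
  proof (rule halo_emeasure_le[OF _ E sets_weight_measure])
    show "0 \<le> 1 - \<epsilon>" using \<epsilon> \<kappa> by simp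
    fix F :: "((real ^ 'n) \<times> real) set"
    assume F: "finite F" "\<And>c r. (c, r) \<in> F \<Longrightarrow> r > 0 \<and> (1 - \<epsilon>) * (2 * r) ^ CARD('n) < measure lebesgue (E \<inter> cube c r)"
    let ?U = "\<Union>(c, r)\<in>F. cube c r"
    have Us: "?U \<in> sets lebesgue" by (rule Union_cubes_sets[OF F(1)])
    have "emeasure (weight_measure w) ?U \<le> emeasure (weight_measure w) (E \<union> (?U - E))"
      using E Us by (intro emeasure_mono) auto
    also have "\<dots> \<le> emeasure (weight_measure w) E + emeasure (weight_measure w) (?U - E)"
      using E Us by (intro emeasure_subadditive) auto
    also have "emeasure (weight_measure w) (?U - E) \<le> ennreal (C * \<epsilon> powr p) * emeasure (weight_measure w) E"
    proof (rule le[OF \<epsilon> E F(1)])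
      fix c r assume cr: "(c, r) \<in> F"
      have "measure lebesgue (cube c r) = measure lebesgue (cube c r - E) + measure lebesgue (E \<inter> cube c r)"
      proof -
        have "cube c r - E = cube c r - (E \<inter> cube c r)" by blast
        moreover have "measure lebesgue (cube c r - (E \<inter> cube c r)) = measure lebesgue (cube c r) - measure lebesgue (E \<inter> cube c r)"
          by (rule measurable_measure_Diff) (use E in auto)
        ultimately show ?thesis by simp
      qed
      then show "r > 0 \<and> measure lebesgue (cube c r - E) \<le> \<epsilon> * (2 * r) ^ CARD('n)"
        using F(2)[OF cr, unfolded left_diff_distrib mult_1] measure_cube[of r c] by linarith
    qed
    also have "emeasure (weight_measure w) E + ennreal (C * \<epsilon> powr p) * emeasure (weight_measure w) E = ennreal (1 + C * \<epsilon> powr p) * emeasure (weight_measure w) E"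
      using \<kappa> by (simp add: distrib_right)
    finally show "emeasure (weight_measure w) ?U \<le> ennreal (1 + C * \<epsilon> powr p) * emeasure (weight_measure w) E"
      by (simp add: add_left_mono)
  qed
  then show ?thesis using \<kappa> by blast
qed

section \<open>Reaching a halo in two steps\<close>

text \<open>The null set in the density theorem: the points of \<open>E\<close> at which every dyadic density of \<open>E\<close>
is at most \<open>\<gamma> < 1\<close>.\<close>

lemma dyadic_low_density_null:
  assumes l: "l > 0" and E: "E \<in> sets lebesgue" and A: "A \<in> lmeasurable" "A \<subseteq> E" and \<gamma>: "0 \<le> \<gamma>" "\<gamma> < 1"
    and le: "\<And>m x. x \<in> A \<Longrightarrow> emeasure lebesgue (E \<inter> dyadic a l m x) \<le> ennreal \<gamma> * emeasure lebesgue (dyadic a l m x)"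
  shows "measure lebesgue A = 0"
proof -
  have As: "A \<in> sets lebesgue" using A by blast
  have "emeasure (density lebesgue (indicator E)) A \<le> ennreal \<gamma> * emeasure lebesgue A"
  proof (rule dyadic_density[OF l As])
    fix m x assume "x \<in> A"
    then show "emeasure (density lebesgue (indicator E)) (dyadic a l m x) \<le> ennreal \<gamma> * emeasure lebesgue (dyadic a l m x)"
      unfolding emeasure_density_indicator[OF E dyadic_sets[OF l]] by (rule le)
  qed auto
  moreover have "E \<inter> A = A" using A(2) by blast
  ultimately have "emeasure lebesgue A \<le> ennreal \<gamma> * emeasure lebesgue A"
    unfolding emeasure_density_indicator[OF E As] by simp
  then have "measure lebesgue A \<le> \<gamma> * measure lebesgue A"
    using A(1) \<gamma> by (simp add: emeasure_eq_measure2 ennreal_mult[symmetric] del: emeasure_completion)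
  then have "(1 - \<gamma>) * measure lebesgue A \<le> 0" by (simp add: algebra_simps)
  then show ?thesis using \<gamma> measure_nonneg[of lebesgue A] by (simp add: mult_le_0_iff)
qed

lemma dyadic_subset_halo:
  fixes E :: "(real ^ 'n) set"
  assumes l: "l > 0" and E: "E \<in> sets lebesgue" and \<gamma>: "0 \<le> \<gamma>"
    and gt: "emeasure lebesgue (E \<inter> dyadic a l m x) > ennreal \<gamma> * emeasure lebesgue (dyadic a l m x)"
  shows "\<gamma> * (2 * (l / 2 ^ m / 2)) ^ CARD('n) < measure lebesgue (E \<inter> cube (dyadic_center a l m x) (l / 2 ^ m / 2))"
    and "x \<in> halo \<gamma> E"
proof -
  let ?r = "l / 2 ^ m / 2"
  have r: "?r > 0" using l by simp
  have P: "dyadic a l m x \<in> lmeasurable" by (rule dyadic_lmeasurable[OF l])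
  have EP: "E \<inter> dyadic a l m x \<in> lmeasurable"
    by (rule fmeasurableI2[OF P]) (use E P in auto)
  have "\<gamma> * (l / 2 ^ m) ^ CARD('n) < measure lebesgue (E \<inter> dyadic a l m x)"
    using gt l \<gamma> EP unfolding emeasure_dyadic[OF l]
    by (simp add: emeasure_eq_measure2 ennreal_mult[symmetric] ennreal_less_iff del: emeasure_completion)
  also have "\<dots> \<le> measure lebesgue (E \<inter> cube (dyadic_center a l m x) ?r)"
    using dyadic_subset_cube[OF l, of a m x] EP by (intro measure_mono_fmeasurable Int_cube_lmeasurable[OF E]) auto
  finally show 1: "\<gamma> * (2 * ?r) ^ CARD('n) < measure lebesgue (E \<inter> cube (dyadic_center a l m x) ?r)" by simp
  show "x \<in> halo \<gamma> E" unfolding halo_iff[OF \<gamma> E]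
    using r 1 dyadic_subset_cube[OF l, of a m x] dyadic_self[of x a l m] by blast
qed

lemma halo_contains_ae:
  fixes E :: "(real ^ 'n) set"
  assumes E: "E \<in> sets lebesgue" and \<gamma>: "0 \<le> \<gamma>" "\<gamma> < 1"
  shows "E - halo \<gamma> E \<in> null_sets lebesgue"
proof -
  let ?A = "\<lambda>k :: nat. (E - halo \<gamma> E) \<inter> cube 0 (real k)"
  have H: "halo \<gamma> E \<in> sets lebesgue" by (rule halo_sets[OF \<gamma>(1) E])
  have "?A k \<in> null_sets lebesgue" for k
  proof -
    have A: "?A k \<in> lmeasurable" using E H by (intro Int_cube_lmeasurable) auto
    have "measure lebesgue (?A k) = 0"
    proof (rule dyadic_low_density_null[where l = 1 and a = 0 and E = E, OF _ E A _ \<gamma>])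
      fix m x assume "x \<in> ?A k"
      then have "x \<notin> halo \<gamma> E" by blast
      then show "emeasure lebesgue (E \<inter> dyadic 0 1 m x) \<le> ennreal \<gamma> * emeasure lebesgue (dyadic 0 1 m x)"
        using dyadic_subset_halo(2)[OF _ E \<gamma>(1), of 1 0 m x] by (meson not_less zero_less_one)
    qed auto
    then show ?thesis using A emeasure_eq_measure2[OF A] by (auto simp: null_sets_def fmeasurable_def)
  qed
  then have "(\<Union>k. ?A k) \<in> null_sets lebesgue" by (rule null_sets_UN)
  moreover have "(\<Union>k. ?A k) = E - halo \<gamma> E"
  proof -
    have "\<exists>k. x \<in> cube 0 (real k)" for x :: "real ^ 'n"
    proof -
      obtain k where k: "norm x \<le> real k" using real_arch_simple by blast
      have "\<bar>x $ i - 0 $ i\<bar> \<le> real k" for i using component_le_norm_cart[of x i] k by simp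
      then show ?thesis unfolding cube_def by blast
    qed
    then show ?thesis by blast
  qed
  ultimately show ?thesis by simp
qed

text \<open>Moving continuously from the cube at \<open>c1\<close>, where the density exceeds \<open>\<gamma>\<close>, to the twice larger
cube at \<open>c0\<close>, where it does not, passes through every density in between. The intermediate
cubes are nested, so the measure of their intersection with \<open>E\<close> increases by no more than their
volume and is therefore continuous.\<close>

lemma intermediate_cube:
  fixes c0 c1 :: "real ^ 'n"
  assumes E: "E \<in> sets lebesgue" and r: "r > 0" and near: "\<And>i. \<bar>c1 $ i - c0 $ i\<bar> \<le> r"
    and \<gamma>: "\<gamma> < \<delta>"
    and small: "\<gamma> * (2 * r) ^ CARD('n) < measure lebesgue (E \<inter> cube c1 r)"
    and large: "measure lebesgue (E \<inter> cube c0 (2 * r)) \<le> \<gamma> * (2 * (2 * r)) ^ CARD('n)"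
  obtains c s where "s \<ge> r" "cube c s \<subseteq> cube c0 (2 * r)"
    "\<gamma> * (2 * s) ^ CARD('n) < measure lebesgue (E \<inter> cube c s)"
    "measure lebesgue (E \<inter> cube c s) \<le> \<delta> * (2 * s) ^ CARD('n)"
proof -
  define C where "C t = c1 + t *\<^sub>R (c0 - c1)" for t :: real
  define R where "R t = (1 + t) * r" for t :: real
  define F where "F t = measure lebesgue (E \<inter> cube (C t) (R t))" for t
  define G where "G t = (2 * R t) ^ CARD('n)" for t
  have R: "R t \<ge> r" if "t \<ge> 0" for t using that r by (simp add: R_def)
  have nest: "cube (C s) (R s) \<subseteq> cube (C t) (R t)" if "s \<le> t" for s t
  proof
    fix y assume y: "y \<in> cube (C s) (R s)"
    have "\<bar>y $ i - C t $ i\<bar> \<le> R t" for i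
    proof -
      have "y $ i - C t $ i = (y $ i - C s $ i) + (t - s) * (c1 $ i - c0 $ i)"
        by (simp add: C_def algebra_simps)
      also have "\<bar>\<dots>\<bar> \<le> \<bar>y $ i - C s $ i\<bar> + \<bar>(t - s) * (c1 $ i - c0 $ i)\<bar>" by (rule abs_triangle_ineq)
      also have "\<bar>y $ i - C s $ i\<bar> \<le> R s" using y by (simp add: cube_def)
      also have "\<bar>(t - s) * (c1 $ i - c0 $ i)\<bar> \<le> (t - s) * r"
        using near[of i] that by (simp add: abs_mult mult_left_mono)
      finally show ?thesis by (simp add: R_def algebra_simps)
    qed
    then show "y \<in> cube (C t) (R t)" by (simp add: cube_def)
  qed
  have lm: "E \<inter> cube (C t) (R t) \<in> lmeasurable" for t by (rule Int_cube_lmeasurable[OF E])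
  have incr: "F s \<le> F t \<and> F t - F s \<le> G t - G s" if "0 \<le> s" "s \<le> t" for s t
  proof -
    have st: "cube (C s) (R s) \<subseteq> cube (C t) (R t)" by (rule nest[OF that(2)])
    have "F s \<le> F t" unfolding F_def using st lm[of s] lm[of t] by (intro measure_mono_fmeasurable) auto
    moreover have "F t - F s = measure lebesgue (E \<inter> cube (C t) (R t) - E \<inter> cube (C s) (R s))"
      unfolding F_def using st lm[of s] lm[of t] by (intro measurable_measure_Diff[symmetric]) auto
    moreover have "\<dots> \<le> measure lebesgue (cube (C t) (R t) - cube (C s) (R s))"
      using lm[of s] lm[of t] by (intro measure_mono_fmeasurable) auto
    moreover have "\<dots> = measure lebesgue (cube (C t) (R t)) - measure lebesgue (cube (C s) (R s))"
      using st by (intro measurable_measure_Diff) auto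
    moreover have "\<dots> = G t - G s"
    proof -
      have "R s \<ge> 0" "R t \<ge> 0" using R[of s] R[of t] that r by linarith+
      then show ?thesis by (simp only: G_def measure_cube)
    qed
    ultimately show ?thesis by linarith
  qed
  have contG: "continuous_on {0..1} G" unfolding G_def R_def by (intro continuous_intros)
  have contF: "continuous_on {0..1} F"
    unfolding continuous_on_iff
  proof (intro ballI allI impI)
    fix x e :: real assume "x \<in> {0..1}" "e > 0"
    then obtain d where d: "d > 0" "\<And>y. y \<in> {0..1} \<Longrightarrow> dist y x < d \<Longrightarrow> dist (G y) (G x) < e"
      using contG unfolding continuous_on_iff by blast
    have "dist (F y) (F x) < e" if "y \<in> {0..1}" "dist y x < d" for y
      using d(2)[OF that] incr[of x y] incr[of y x] that(1) \<open>x \<in> {0..1}\<close>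
      unfolding dist_real_def by (cases "x \<le> y") auto
    then show "\<exists>d>0. \<forall>y\<in>{0..1}. dist y x < d \<longrightarrow> dist (F y) (F x) < e" using d(1) by blast
  qed
  define f where "f t = F t - \<delta> * G t" for t
  have contf: "continuous_on {0..1} f" unfolding f_def by (intro continuous_intros contF contG)
  have G0: "G t > 0" if "t \<ge> 0" for t using R[OF that] r by (simp add: G_def)
  have "C 1 = c0" "R 1 = 2 * r" "C 0 = c1" "R 0 = r" by (simp_all add: C_def R_def)
  then have F1: "F 1 \<le> \<gamma> * G 1" and F0: "\<gamma> * G 0 < F 0" using small large by (auto simp: F_def G_def)
  have f1: "f 1 < 0" unfolding f_def using F1 mult_strict_right_mono[OF \<gamma> G0[of 1]] by linarith
  have "\<exists>t. 0 \<le> t \<and> t \<le> 1 \<and> \<gamma> * G t < F t \<and> F t \<le> \<delta> * G t"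
  proof (cases "f 0 \<le> 0")
    case True
    then show ?thesis using F0 by (intro exI[of _ 0]) (auto simp: f_def)
  next
    case False
    then obtain t where t: "0 \<le> t" "t \<le> 1" "f t = 0"
      using IVT2'[of f 1 0 0] f1 contf by force
    then show ?thesis using mult_strict_right_mono[OF \<gamma> G0[of t]] by (intro exI[of _ t]) (auto simp: f_def)
  qed
  then obtain t where t: "0 \<le> t" "t \<le> 1" "\<gamma> * G t < F t" "F t \<le> \<delta> * G t" by blast
  show ?thesis
    using that[of "R t" "C t"] R[OF t(1)] nest[OF t(2)] t \<open>C 1 = c0\<close> \<open>R 1 = 2 * r\<close> unfolding F_def G_def by metis
qed

text \<open>Half the side of the smaller cube: the condition that makes the cubes between a dyadic cube and
its parent nested.\<close>

lemma dyadic_center_Suc_near: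
  assumes "l > 0"
  shows "\<bar>dyadic_center a l (Suc j) x $ i - dyadic_center a l j x $ i\<bar> \<le> l / 2 ^ Suc j / 2"
proof -
  define u where "u = (x $ i - a $ i) * 2 ^ j / l"
  have u2: "(x $ i - a $ i) * 2 ^ Suc j / l = 2 * u" by (simp add: u_def)
  have "\<lfloor>2 * u\<rfloor> = 2 * \<lfloor>u\<rfloor> \<or> \<lfloor>2 * u\<rfloor> = 2 * \<lfloor>u\<rfloor> + 1" by linarith
  then have "\<bar>real_of_int \<lfloor>2 * u\<rfloor> - 2 * real_of_int \<lfloor>u\<rfloor> - 1/2\<bar> \<le> 1/2" by auto
  moreover have "dyadic_center a l (Suc j) x $ i - dyadic_center a l j x $ i
      = (real_of_int \<lfloor>2 * u\<rfloor> - 2 * real_of_int \<lfloor>u\<rfloor> - 1/2) * (l / 2 ^ Suc j)"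
    unfolding dyadic_center_def vec_lambda_beta u2 u_def[symmetric] by (simp add: field_simps)
  ultimately have "\<bar>dyadic_center a l (Suc j) x $ i - dyadic_center a l j x $ i\<bar> \<le> 1/2 * (l / 2 ^ Suc j)"
  proof -
    assume 1: "\<bar>real_of_int \<lfloor>2 * u\<rfloor> - 2 * real_of_int \<lfloor>u\<rfloor> - 1/2\<bar> \<le> 1/2"
      and 2: "dyadic_center a l (Suc j) x $ i - dyadic_center a l j x $ i
      = (real_of_int \<lfloor>2 * u\<rfloor> - 2 * real_of_int \<lfloor>u\<rfloor> - 1/2) * (l / 2 ^ Suc j)"
    have p: "l / 2 ^ Suc j > 0" using assms by simp
    show ?thesis
      unfolding 2 abs_mult abs_of_pos[OF p] by (rule mult_right_mono[OF 1 less_imp_le[OF p]])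
  qed
  then show ?thesis by simp
qed

text \<open>If \<open>E\<close> has density above \<open>\<gamma>\<close> in the cube, the cube lies in the inner halo and \<open>\<beta> < 1\<close> suffices.
Otherwise consider a maximal dyadic subcube of density above \<open>\<gamma>\<close>. Between it and its parent
there is a cube of density in \<open>(\<gamma>, (1 + \<gamma>) / 2]\<close>. This cube lies in the inner halo, and outside
\<open>E\<close> it has at least the proportion \<open>\<kappa> = (1 - \<gamma>) / 2\<^sup>n\<^sup>+\<^sup>1\<close> of the measure of the
parent. The maximal parents are disjoint and contain almost all of \<open>E \<inter> Q\<close>.\<close>

lemma halo_gain:
  fixes E :: "(real ^ 'n) set"
  assumes E: "E \<in> sets lebesgue" and \<alpha>: "0 \<le> \<alpha>" and \<gamma>: "0 < \<gamma>" "\<gamma> < 1"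
    and \<beta>: "0 \<le> \<beta>" "\<beta> < 1" "\<beta> \<le> \<alpha> * (1 + (1 - \<gamma>) / 2 ^ (CARD('n) + 1))"
  shows "halo \<alpha> E \<subseteq> halo \<beta> (halo \<gamma> E)"
proof
  fix z assume "z \<in> halo \<alpha> E"
  then obtain c r where r: "r > 0" and z: "z \<in> cube c r" and dens: "\<alpha> * (2 * r) ^ CARD('n) < measure lebesgue (E \<inter> cube c r)"
    unfolding halo_iff[OF \<alpha> E] by blast
  define n where "n = CARD('n)"
  define H where "H = halo \<gamma> E"
  have Hs: "H \<in> sets lebesgue" unfolding H_def using halo_sets[OF _ E] \<gamma> by simp
  have Hiff: "x \<in> H \<longleftrightarrow> (\<exists>c r. r > 0 \<and> x \<in> cube c r \<and> \<gamma> * (2 * r) ^ n < measure lebesgue (E \<inter> cube c r))" for x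
    unfolding H_def n_def using halo_iff[OF _ E, of \<gamma>] \<gamma> by simp
  have "\<beta> * (2 * r) ^ n < measure lebesgue (H \<inter> cube c r)"
  proof (cases "\<gamma> * (2 * r) ^ n < measure lebesgue (E \<inter> cube c r)")
    case True
    then have "cube c r \<subseteq> H" using Hiff r by blast
    then have "H \<inter> cube c r = cube c r" by blast
    then have "measure lebesgue (H \<inter> cube c r) = (2 * r) ^ n" using measure_cube[of r c] r by (simp add: n_def)
    moreover have "\<beta> * (2 * r) ^ n < 1 * (2 * r) ^ n" using \<beta>(2) r by (intro mult_strict_right_mono) auto
    ultimately show ?thesis by simp
  next
    case low: False
    define \<kappa> where "\<kappa> = (1 - \<gamma>) / 2 ^ (n + 1)"
    have \<kappa>: "\<kappa> > 0" using \<gamma> by (simp add: \<kappa>_def)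
    define l where "l = 2 * r"
    have l: "l > 0" using r by (simp add: l_def)
    define a :: "real ^ 'n" where "a = (\<chi> i. c $ i - r)"
    define D where "D = dyadic a l"
    define Q0 where "Q0 = D 0 c"
    have lQ: "dyadic_center a l 0 c = c" unfolding a_def l_def by (rule dyadic_center_root[OF r])
    have Q0: "Q0 \<subseteq> cube c r" using dyadic_subset_cube[OF l, of a 0 c] lQ by (auto simp: Q0_def D_def l_def)
    have Q0l: "Q0 \<in> lmeasurable" unfolding Q0_def D_def by (rule dyadic_lmeasurable[OF l])
    have Q0m: "measure lebesgue Q0 = (2 * r) ^ n" unfolding Q0_def D_def n_def l_def[symmetric]
      by (subst measure_dyadic[OF l]) simp
    have sub_Q0: "D m x \<subseteq> Q0" if "x \<in> Q0" for m x
    proof -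
      have "D 0 x = Q0" using dyadic_eq that unfolding Q0_def D_def by blast
      then show ?thesis using dyadic_antimono[of 0 m a l x] by (simp add: D_def)
    qed
    define \<phi> where "\<phi> P \<longleftrightarrow> P \<subseteq> Q0 \<and> emeasure lebesgue (E \<inter> P) > ennreal \<gamma> * emeasure lebesgue P" for P
    define \<nu> where "\<nu> = density lebesgue (indicator (H - E) :: _ \<Rightarrow> ennreal)"
    \<comment> \<open>\<phi> selects dyadic subcubes of high density; \<psi> selects dyadic subcubes in which the halo gains
      the proportion \<kappa> over E. Parents of maximal \<phi>-cubes are \<psi>-cubes.\<close>
    define \<psi> where "\<psi> P \<longleftrightarrow> P \<subseteq> Q0 \<and> emeasure lebesgue P \<le> ennreal (1 / \<kappa>) * emeasure \<nu> P" for P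
    define \<Phi> where "\<Phi> = {x. \<exists>m. \<phi> (D m x)}"
    define \<Psi> where "\<Psi> = {x. \<exists>m. \<psi> (D m x)}"
    have \<Phi>s: "\<Phi> \<in> sets lebesgue" and \<Psi>s: "\<Psi> \<in> sets lebesgue"
      unfolding \<Phi>_def \<Psi>_def D_def by (rule dyadic_Union_sets[OF l])+
    have \<Phi>Q0: "\<Phi> \<subseteq> Q0" and \<Psi>Q0: "\<Psi> \<subseteq> Q0"
      unfolding \<Phi>_def \<phi>_def \<Psi>_def \<psi>_def D_def using dyadic_self by blast+
    have \<Phi>H: "\<Phi> \<subseteq> H"
      unfolding \<Phi>_def \<phi>_def D_def H_def using dyadic_subset_halo(2)[OF l E] \<gamma>(1) by (auto simp: less_imp_le)
    have \<Phi>\<Psi>: "\<Phi> \<subseteq> \<Psi>"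
    proof
      fix x assume "x \<in> \<Phi>"
      then have x: "x \<in> Q0" and ex: "\<exists>m. \<phi> (D m x)" using \<Phi>Q0 by (auto simp: \<Phi>_def)
      obtain m where m: "\<phi> (D m x)" "\<And>j. j < m \<Longrightarrow> \<not> \<phi> (D j x)"
        using ex exists_least_iff[of "\<lambda>m. \<phi> (D m x)"] by auto
      have "m \<noteq> 0"
      proof
        assume "m = 0"
        moreover have "D 0 x = Q0" using dyadic_eq x unfolding Q0_def D_def by blast
        ultimately have "emeasure lebesgue (E \<inter> Q0) > ennreal \<gamma> * emeasure lebesgue Q0" using m(1) by (simp add: \<phi>_def)
        moreover have EQ0: "E \<inter> Q0 \<in> lmeasurable" by (rule fmeasurableI2[OF Q0l]) (use E Q0l in auto)
        ultimately have "\<gamma> * (2 * r) ^ n < measure lebesgue (E \<inter> Q0)"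
          using Q0l \<gamma> r by (simp add: emeasure_eq_measure2 ennreal_mult[symmetric] ennreal_less_iff Q0m del: emeasure_completion)
        also have "\<dots> \<le> measure lebesgue (E \<inter> cube c r)"
          using Q0 EQ0 by (intro measure_mono_fmeasurable Int_cube_lmeasurable[OF E]) auto
        finally show False using low by simp
      qed
      then obtain j where j: "m = Suc j" using not0_implies_Suc by blast
      let ?P = "D j x" and ?c0 = "dyadic_center a l j x" and ?c1 = "dyadic_center a l (Suc j) x" and ?r = "l / 2 ^ Suc j / 2"
      have rr: "?r > 0" using l by simp
      have r2: "l / 2 ^ j / 2 = 2 * ?r" by simp
      have Pl: "?P \<in> lmeasurable" unfolding D_def by (rule dyadic_lmeasurable[OF l])
      have Pc: "?P \<subseteq> cube ?c0 (2 * ?r)" using dyadic_subset_cube[OF l, of a j x] unfolding r2 D_def .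
      have Pm: "measure lebesgue ?P = (2 * (2 * ?r)) ^ n" unfolding D_def measure_dyadic[OF l] n_def by simp
      have bd: "measure lebesgue (cube ?c0 (2 * ?r) - ?P) = 0"
      proof -
        have "measure lebesgue (cube ?c0 (2 * ?r)) = (2 * (2 * ?r)) ^ n"
          unfolding n_def using rr by (intro measure_cube) simp
        then show ?thesis using Pl Pc Pm by (subst measurable_measure_Diff) auto
      qed
      have small: "\<gamma> * (2 * ?r) ^ n < measure lebesgue (E \<inter> cube ?c1 ?r)"
        unfolding n_def using m(1) \<gamma>(1) unfolding j \<phi>_def D_def
        by (intro dyadic_subset_halo(1)[OF l E]) auto
      have large: "measure lebesgue (E \<inter> cube ?c0 (2 * ?r)) \<le> \<gamma> * (2 * (2 * ?r)) ^ n"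
      proof -
        have EP: "E \<inter> ?P \<in> lmeasurable" by (rule fmeasurableI2[OF Pl]) (use E Pl in auto)
        have "emeasure lebesgue (E \<inter> ?P) \<le> ennreal \<gamma> * emeasure lebesgue ?P"
          using m(2)[of j] j sub_Q0[OF x, of j] by (simp add: \<phi>_def not_less)
        then have 1: "measure lebesgue (E \<inter> ?P) \<le> \<gamma> * (2 * (2 * ?r)) ^ n"
          unfolding Pm[symmetric] using EP Pl \<gamma>
          by (simp add: emeasure_eq_measure2 ennreal_mult[symmetric] del: emeasure_completion)
        have "measure lebesgue (E \<inter> cube ?c0 (2 * ?r)) \<le> measure lebesgue ((E \<inter> ?P) \<union> (cube ?c0 (2 * ?r) - ?P))"
          using EP Pl by (intro measure_mono_fmeasurable fmeasurable.Un fmeasurable_Diff fmeasurableD[OF Int_cube_lmeasurable[OF E]]) auto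
        also have "\<dots> \<le> measure lebesgue (E \<inter> ?P) + measure lebesgue (cube ?c0 (2 * ?r) - ?P)"
          using EP Pl by (intro measure_Un_le) auto
        finally show ?thesis using 1 bd by linarith
      qed
      obtain c' s where s: "s \<ge> ?r" "cube c' s \<subseteq> cube ?c0 (2 * ?r)"
        "\<gamma> * (2 * s) ^ n < measure lebesgue (E \<inter> cube c' s)"
        "measure lebesgue (E \<inter> cube c' s) \<le> (1 + \<gamma>) / 2 * (2 * s) ^ n"
      proof (rule intermediate_cube[OF E rr dyadic_center_Suc_near[OF l]])
        show "\<gamma> < (1 + \<gamma>) / 2" using \<gamma> by simp
      qed (use small large in \<open>simp_all only: n_def\<close>)
      have s0: "s > 0" using s(1) rr by linarith
      have "cube c' s \<subseteq> H" using Hiff s(3) s0 by blast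
      have HE: "(H - E) \<inter> ?P \<in> lmeasurable" by (rule fmeasurableI2[OF Pl]) (use Hs E Pl in auto)
      have "\<kappa> * measure lebesgue ?P = (1 - \<gamma>) / 2 * (2 * ?r) ^ n"
        unfolding Pm \<kappa>_def power_mult_distrib[of 2 "2 * ?r"] by simp
      also have "\<dots> \<le> (1 - \<gamma>) / 2 * (2 * s) ^ n"
        using s(1) rr \<gamma> by (intro mult_left_mono power_mono) auto
      also have "\<dots> \<le> measure lebesgue (cube c' s) - measure lebesgue (E \<inter> cube c' s)"
        using s(4) s0 measure_cube[of s c'] unfolding n_def by (simp add: algebra_simps add_divide_distrib diff_divide_distrib)
      also have "\<dots> = measure lebesgue (cube c' s - E \<inter> cube c' s)"
        using Int_cube_lmeasurable[OF E] by (intro measurable_measure_Diff[symmetric]) auto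
      also have "\<dots> \<le> measure lebesgue (((H - E) \<inter> ?P) \<union> (cube ?c0 (2 * ?r) - ?P))"
        using \<open>cube c' s \<subseteq> H\<close> s(2) HE Pl E
        by (intro measure_mono_fmeasurable fmeasurable.Un fmeasurable_Diff) auto
      also have "\<dots> \<le> measure lebesgue ((H - E) \<inter> ?P) + measure lebesgue (cube ?c0 (2 * ?r) - ?P)"
        using HE Pl by (intro measure_Un_le) auto
      finally have "\<kappa> * measure lebesgue ?P \<le> measure lebesgue ((H - E) \<inter> ?P)" using bd by linarith
      then have "measure lebesgue ?P \<le> 1 / \<kappa> * measure lebesgue ((H - E) \<inter> ?P)"
        using \<kappa> by (simp add: field_simps)
      then have "emeasure lebesgue ?P \<le> ennreal (1 / \<kappa>) * emeasure lebesgue ((H - E) \<inter> ?P)"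
        using Pl HE \<kappa> by (simp add: emeasure_eq_measure2 ennreal_mult[symmetric] del: emeasure_completion)
      also have "emeasure lebesgue ((H - E) \<inter> ?P) = emeasure \<nu> ?P"
        unfolding \<nu>_def using Hs E Pl by (intro emeasure_density_indicator[symmetric]) auto
      finally have "\<psi> ?P" using sub_Q0[OF x] by (simp add: \<psi>_def)
      then show "x \<in> \<Psi>" unfolding \<Psi>_def by blast
    qed
    have lmI: "A \<in> lmeasurable" if "A \<in> sets lebesgue" "A \<subseteq> cube c r" for A
      by (rule fmeasurableI2[OF cube_lmeasurable that(2,1)])
    have \<Psi>l: "\<Psi> \<in> lmeasurable" and \<Phi>l: "\<Phi> \<in> lmeasurable"
      by (rule lmI; use \<Psi>s \<Phi>s \<Psi>Q0 \<Phi>Q0 Q0 in blast)+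
    have "emeasure lebesgue \<Psi> \<le> ennreal (1 / \<kappa>) * emeasure \<nu> \<Psi>"
      unfolding \<Psi>_def D_def
    proof (rule dyadic_stopping[OF l])
      fix m x assume "\<psi> (dyadic a l m x)"
      then show "emeasure lebesgue (dyadic a l m x) \<le> ennreal (1 / \<kappa>) * emeasure \<nu> (dyadic a l m x)" by (simp only: \<psi>_def)
    qed (auto simp: \<nu>_def)
    also have "emeasure \<nu> \<Psi> = emeasure lebesgue ((H - E) \<inter> \<Psi>)"
      unfolding \<nu>_def using Hs E \<Psi>s by (intro emeasure_density_indicator) auto
    finally have pk: "\<kappa> * measure lebesgue \<Psi> \<le> measure lebesgue ((H - E) \<inter> \<Psi>)"
    proof -
      assume a1: "emeasure lebesgue \<Psi> \<le> ennreal (1 / \<kappa>) * emeasure lebesgue ((H - E) \<inter> \<Psi>)"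
      have "(H - E) \<inter> \<Psi> \<in> lmeasurable" by (rule fmeasurableI2[OF \<Psi>l]) (use Hs E \<Psi>s in auto)
      with a1 have "measure lebesgue \<Psi> \<le> 1 / \<kappa> * measure lebesgue ((H - E) \<inter> \<Psi>)"
        using \<Psi>l \<kappa> by (simp add: emeasure_eq_measure2 ennreal_mult[symmetric] del: emeasure_completion)
      then show ?thesis using \<kappa> by (simp add: field_simps)
    qed
    have Q0s: "Q0 \<in> sets lebesgue" using Q0l by blast
    have null: "measure lebesgue (E \<inter> Q0 - \<Phi>) = 0"
    proof (rule dyadic_low_density_null[OF l E, where a = a and \<gamma> = \<gamma>])
      show "E \<inter> Q0 - \<Phi> \<in> lmeasurable" by (rule lmI) (use E Q0s \<Phi>s Q0 in auto)
      fix m x assume "x \<in> E \<inter> Q0 - \<Phi>"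
      then have "\<not> \<phi> (D m x)" "D m x \<subseteq> Q0" using sub_Q0 by (auto simp: \<Phi>_def)
      then show "emeasure lebesgue (E \<inter> dyadic a l m x) \<le> ennreal \<gamma> * emeasure lebesgue (dyadic a l m x)"
        by (simp add: \<phi>_def D_def not_less)
    qed (use \<gamma> in auto)
    have bd: "measure lebesgue (cube c r - Q0) = 0"
      using Q0l Q0 Q0m measure_cube[of r c] r by (subst measurable_measure_Diff) (auto simp: n_def)
    have E1: "measure lebesgue (E \<inter> cube c r) \<le> measure lebesgue (E \<inter> \<Phi>)"
    proof -
      have lm: "E \<inter> \<Phi> \<in> lmeasurable" "E \<inter> Q0 - \<Phi> \<in> lmeasurable" "cube c r - Q0 \<in> lmeasurable"
        by (rule lmI; use E Q0s \<Phi>s \<Phi>Q0 Q0 in auto)+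
      have "measure lebesgue (E \<inter> cube c r) \<le> measure lebesgue ((E \<inter> \<Phi>) \<union> (E \<inter> Q0 - \<Phi>) \<union> (cube c r - Q0))"
        using lm by (intro measure_mono_fmeasurable fmeasurable.Un fmeasurableD[OF Int_cube_lmeasurable[OF E]]) auto
      also have "\<dots> \<le> measure lebesgue ((E \<inter> \<Phi>) \<union> (E \<inter> Q0 - \<Phi>)) + measure lebesgue (cube c r - Q0)"
        using lm by (intro measure_Un_le sets.Un fmeasurableD)
      also have "measure lebesgue ((E \<inter> \<Phi>) \<union> (E \<inter> Q0 - \<Phi>)) \<le> measure lebesgue (E \<inter> \<Phi>) + measure lebesgue (E \<inter> Q0 - \<Phi>)"
        using lm by (intro measure_Un_le fmeasurableD)
      finally show ?thesis using null bd by linarith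
    qed
    have lm: "E \<inter> \<Phi> \<in> lmeasurable" "(H - E) \<inter> \<Psi> \<in> lmeasurable" "H \<inter> cube c r \<in> lmeasurable"
      by (rule lmI; use E Hs \<Psi>s \<Psi>Q0 \<Phi>s \<Phi>Q0 Q0 in auto)+
    have "measure lebesgue (E \<inter> \<Phi>) \<le> measure lebesgue \<Psi>"
      using \<Phi>\<Psi> lm(1) \<Psi>l by (intro measure_mono_fmeasurable) auto
    then have "\<kappa> * measure lebesgue (E \<inter> cube c r) \<le> measure lebesgue ((H - E) \<inter> \<Psi>)"
      using E1 pk \<kappa> by (meson mult_le_cancel_left_pos order_trans)
    then have "(1 + \<kappa>) * measure lebesgue (E \<inter> cube c r) \<le> measure lebesgue (E \<inter> \<Phi>) + measure lebesgue ((H - E) \<inter> \<Psi>)"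
      using E1 by (simp add: distrib_right)
    also have "\<dots> = measure lebesgue ((E \<inter> \<Phi>) \<union> ((H - E) \<inter> \<Psi>))"
    proof -
      have "(E \<inter> \<Phi>) \<inter> ((H - E) \<inter> \<Psi>) = {}" by blast
      then show ?thesis using measure_Un3[OF lm(1,2)] by simp
    qed
    also have "\<dots> \<le> measure lebesgue (H \<inter> cube c r)"
      using lm \<Phi>H \<Phi>Q0 \<Psi>Q0 Q0 by (intro measure_mono_fmeasurable) auto
    finally have gain: "(1 + \<kappa>) * measure lebesgue (E \<inter> cube c r) \<le> measure lebesgue (H \<inter> cube c r)" .
    have "\<beta> * (2 * r) ^ n \<le> \<alpha> * (1 + \<kappa>) * (2 * r) ^ n"
      using \<beta>(3) r unfolding \<kappa>_def n_def by (intro mult_right_mono) auto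
    also have "\<dots> = (1 + \<kappa>) * (\<alpha> * (2 * r) ^ n)" by simp
    also have "\<dots> < (1 + \<kappa>) * measure lebesgue (E \<inter> cube c r)"
      using dens \<kappa> unfolding n_def by (intro mult_strict_left_mono) auto
    finally show ?thesis using gain by linarith
  qed
  then show "z \<in> halo \<beta> (halo \<gamma> E)"
    unfolding halo_iff[OF \<beta>(1) Hs[unfolded H_def]] using r z unfolding n_def H_def by blast
qed

section \<open>The halo function\<close>

lemma C_HL_eq:
  assumes w: "is_weight w" and \<alpha>: "0 \<le> \<alpha>"
  shows "C_HL w \<alpha> = (SUP E \<in> {E \<in> sets lebesgue. 0 < emeasure (weight_measure w) E \<and> emeasure (weight_measure w) E < \<infinity>}.
     emeasure (weight_measure w) (halo \<alpha> E) / emeasure (weight_measure w) E)"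
  unfolding C_HL_def halo_def[symmetric]
proof (rule SUP_cong)
  show "{E \<in> sets lebesgue. 0 < weight_of w E \<and> weight_of w E < \<infinity>}
      = {E \<in> sets lebesgue. 0 < emeasure (weight_measure w) E \<and> emeasure (weight_measure w) E < \<infinity>}"
    using weight_of_eq[OF w] by auto
  fix E assume "E \<in> {E \<in> sets lebesgue. 0 < emeasure (weight_measure w) E \<and> emeasure (weight_measure w) E < \<infinity>}"
  then have E: "E \<in> sets lebesgue" by blast
  show "weight_of w (halo \<alpha> E) / weight_of w E = emeasure (weight_measure w) (halo \<alpha> E) / emeasure (weight_measure w) E"
    using weight_of_eq[OF w E] weight_of_eq[OF w halo_sets[OF \<alpha> E]] by simp
qed

lemma C_HL_le:
  assumes w: "is_weight w" and \<alpha>: "0 \<le> \<alpha>"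
    and le: "\<And>E. E \<in> sets lebesgue \<Longrightarrow> 0 < emeasure (weight_measure w) E \<Longrightarrow> emeasure (weight_measure w) E < \<infinity> \<Longrightarrow>
      emeasure (weight_measure w) (halo \<alpha> E) \<le> B * emeasure (weight_measure w) E"
  shows "C_HL w \<alpha> \<le> B"
  unfolding C_HL_eq[OF w \<alpha>]
proof (rule SUP_least)
  fix E assume E: "E \<in> {E \<in> sets lebesgue. 0 < emeasure (weight_measure w) E \<and> emeasure (weight_measure w) E < \<infinity>}"
  then show "emeasure (weight_measure w) (halo \<alpha> E) / emeasure (weight_measure w) E \<le> B"
    using le[of E] by (intro divide_le_posI_ennreal) (auto simp: mult.commute)
qed

lemma C_HL_ge:
  assumes w: "is_weight w" and \<alpha>: "0 \<le> \<alpha>"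
    and E: "E \<in> sets lebesgue" "0 < emeasure (weight_measure w) E" "emeasure (weight_measure w) E < \<infinity>"
  shows "emeasure (weight_measure w) (halo \<alpha> E) \<le> C_HL w \<alpha> * emeasure (weight_measure w) E"
proof -
  have "emeasure (weight_measure w) (halo \<alpha> E) / emeasure (weight_measure w) E \<le> C_HL w \<alpha>"
    unfolding C_HL_eq[OF w \<alpha>] using E by (intro SUP_upper) auto
  then have "emeasure (weight_measure w) (halo \<alpha> E) / emeasure (weight_measure w) E * emeasure (weight_measure w) E \<le> C_HL w \<alpha> * emeasure (weight_measure w) E"
    by (rule mult_right_mono) simp
  then show ?thesis using E by (simp add: ennreal_divide_times)
qed

lemma C_HL_antimono:
  assumes w: "is_weight w" and \<alpha>: "0 \<le> \<alpha>" "\<alpha> \<le> \<beta>"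
  shows "C_HL w \<beta> \<le> C_HL w \<alpha>"
proof (rule C_HL_le[OF w])
  fix E assume E: "E \<in> sets lebesgue" "0 < emeasure (weight_measure w) E" "emeasure (weight_measure w) E < \<infinity>"
  have "emeasure (weight_measure w) (halo \<beta> E) \<le> emeasure (weight_measure w) (halo \<alpha> E)"
    using halo_antimono[OF \<alpha>(2)] halo_sets[OF \<alpha>(1) E(1)] by (intro emeasure_mono) auto
  also have "\<dots> \<le> C_HL w \<alpha> * emeasure (weight_measure w) E" by (rule C_HL_ge[OF w \<alpha>(1) E])
  finally show "emeasure (weight_measure w) (halo \<beta> E) \<le> C_HL w \<alpha> * emeasure (weight_measure w) E" .
qed (use \<alpha> in simp)

text \<open>Apply the definition of the constant first to \<open>E\<close> at height \<open>\<gamma>\<close> and then to the halo of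
\<open>E\<close> at height \<open>\<beta>\<close>. The halo has finite weight by finiteness at \<open>\<gamma>\<close>, and positive weight because
it contains almost all of \<open>E\<close>.\<close>

lemma C_HL_submult:
  fixes w :: "real ^ 'n \<Rightarrow> real"
  assumes w: "is_weight w" and \<alpha>: "0 \<le> \<alpha>" and \<gamma>: "0 < \<gamma>" "\<gamma> < 1"
    and \<beta>: "0 \<le> \<beta>" "\<beta> < 1" "\<beta> \<le> \<alpha> * (1 + (1 - \<gamma>) / 2 ^ (CARD('n) + 1))"
    and fin: "C_HL w \<gamma> < \<infinity>"
  shows "C_HL w \<alpha> \<le> C_HL w \<beta> * C_HL w \<gamma>"
proof (rule C_HL_le[OF w \<alpha>])
  fix E :: "(real ^ 'n) set"
  assume E: "E \<in> sets lebesgue" "0 < emeasure (weight_measure w) E" "emeasure (weight_measure w) E < \<infinity>"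
  let ?H = "halo \<gamma> E"
  have Hs: "?H \<in> sets lebesgue" using halo_sets[OF _ E(1)] \<gamma> by simp
  have HE: "emeasure (weight_measure w) ?H \<le> C_HL w \<gamma> * emeasure (weight_measure w) E"
    using C_HL_ge[OF w _ E] \<gamma> by simp
  have "emeasure (weight_measure w) E \<le> emeasure (weight_measure w) (?H \<union> (E - ?H))"
    using E Hs by (intro emeasure_mono) auto
  also have "\<dots> \<le> emeasure (weight_measure w) ?H + emeasure (weight_measure w) (E - ?H)"
    using E Hs by (intro emeasure_subadditive) auto
  also have "emeasure (weight_measure w) (E - ?H) = 0"
    using halo_contains_ae[OF E(1)] \<gamma> by (intro weight_measure_null[OF w]) auto
  finally have pos: "0 < emeasure (weight_measure w) ?H" using E(2) by simp
  have "C_HL w \<gamma> * emeasure (weight_measure w) E < \<infinity>" using fin E(3) by (simp add: ennreal_mult_less_top)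
  then have Hfin: "emeasure (weight_measure w) ?H < \<infinity>" using HE by (rule le_less_trans[rotated])
  have "emeasure (weight_measure w) (halo \<alpha> E) \<le> emeasure (weight_measure w) (halo \<beta> ?H)"
    using halo_gain[OF E(1) \<alpha> \<gamma> \<beta>] halo_sets[OF \<beta>(1) Hs] by (intro emeasure_mono) auto
  also have "\<dots> \<le> C_HL w \<beta> * emeasure (weight_measure w) ?H" by (rule C_HL_ge[OF w \<beta>(1) Hs pos Hfin])
  also have "\<dots> \<le> C_HL w \<beta> * (C_HL w \<gamma> * emeasure (weight_measure w) E)" by (intro mult_left_mono HE) simp
  finally show "emeasure (weight_measure w) (halo \<alpha> E) \<le> C_HL w \<beta> * C_HL w \<gamma> * emeasure (weight_measure w) E"
    by (simp add: mult.assoc)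
qed

lemma C_HL_near_one:
  fixes w :: "real ^ 'n \<Rightarrow> real"
  assumes w: "w \<in> A_infty"
  defines "p \<equiv> 1 / (2 * real CARD('n) * 2 ^ (CARD('n) + 3) * enn2real (fujii_wilson w))"
  shows "\<exists>\<kappa> C. 0 < \<kappa> \<and> \<kappa> < 1 \<and> 0 < C \<and> (\<forall>t. 0 < t \<longrightarrow> t \<le> \<kappa> \<longrightarrow> C_HL w (1 - t) \<le> ennreal (1 + C * t powr p))"
proof -
  have iw: "is_weight w" using w by (auto simp: A_infty_def)
  obtain \<kappa> C where \<kappa>: "0 < \<kappa>" "\<kappa> \<le> 1" "0 < C"
    and le: "\<And>\<epsilon> E. 0 < \<epsilon> \<Longrightarrow> \<epsilon> \<le> \<kappa> \<Longrightarrow> E \<in> sets lebesgue \<Longrightarrow>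
     emeasure (weight_measure w) (halo (1 - \<epsilon>) E) \<le> ennreal (1 + C * \<epsilon> powr p) * emeasure (weight_measure w) E"
    using solyanik_weighted[OF w] unfolding p_def by blast
  show ?thesis
  proof (rule exI[of _ "\<kappa> / 2"], rule exI[of _ C], intro conjI allI impI)
    fix t assume t: "0 < t" "t \<le> \<kappa> / 2"
    show "C_HL w (1 - t) \<le> ennreal (1 + C * t powr p)"
    proof (rule C_HL_le[OF iw])
      show "0 \<le> 1 - t" using t \<kappa> by linarith
      have "t \<le> \<kappa>" using t \<kappa> by linarith
      fix E :: "(real ^ 'n) set" assume "E \<in> sets lebesgue"
      with \<open>t \<le> \<kappa>\<close> show "emeasure (weight_measure w) (halo (1 - t) E) \<le> ennreal (1 + C * t powr p) * emeasure (weight_measure w) E"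
        by (rule le[OF t(1)])
    qed
  qed (use \<kappa> in auto)
qed

text \<open>Submultiplicativity reduces the level \<open>\<alpha>\<close> to \<open>q \<alpha>\<close> with a fixed \<open>q > 1\<close>, so finitely many
steps lead to a level near \<open>1\<close>, where the Solyanik estimate applies.\<close>

lemma C_HL_finite:
  fixes w :: "real ^ 'n \<Rightarrow> real"
  assumes w: "w \<in> A_infty" and \<alpha>: "0 < \<alpha>"
  shows "C_HL w \<alpha> < \<infinity>"
proof -
  have iw: "is_weight w" using w by (auto simp: A_infty_def)
  obtain \<kappa> C where \<kappa>: "0 < \<kappa>" "\<kappa> < 1"
    and le: "\<And>t. 0 < t \<Longrightarrow> t \<le> \<kappa> \<Longrightarrow> C_HL w (1 - t) \<le> ennreal (1 + C * t powr (1 / (2 * real CARD('n) * 2 ^ (CARD('n) + 3) * enn2real (fujii_wilson w))))"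
    using C_HL_near_one[OF w] by blast
  define \<gamma> where "\<gamma> = 1 - \<kappa>"
  have \<gamma>: "0 < \<gamma>" "\<gamma> < 1" using \<kappa> by (auto simp: \<gamma>_def)
  have fin\<gamma>: "C_HL w \<gamma> < \<infinity>" using le[of \<kappa>] \<kappa> unfolding \<gamma>_def by (auto intro: le_less_trans)
  define q where "q = 1 + (1 - \<gamma>) / 2 ^ (CARD('n) + 1)"
  have q: "q > 1" using \<gamma> by (simp add: q_def)
  have "C_HL w \<alpha> < \<infinity>" if "0 < \<alpha>" "\<gamma> \<le> \<alpha> * q ^ k" for \<alpha> k
    using that
  proof (induction k arbitrary: \<alpha>)
    case 0
    then have "C_HL w \<alpha> \<le> C_HL w \<gamma>" using \<gamma> by (intro C_HL_antimono[OF iw]) auto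
    then show ?case using fin\<gamma> by (rule le_less_trans)
  next
    case (Suc k)
    define \<beta> where "\<beta> = min \<gamma> (\<alpha> * q)"
    have \<beta>: "0 < \<beta>" "\<beta> < 1" "\<beta> \<le> \<alpha> * q" using \<gamma> q Suc.prems(1) by (auto simp: \<beta>_def)
    have "C_HL w \<beta> < \<infinity>"
    proof (cases "\<gamma> \<le> \<alpha> * q")
      case True
      then show ?thesis using fin\<gamma> by (simp add: \<beta>_def)
    next
      case False
      then have "\<beta> = \<alpha> * q" by (simp add: \<beta>_def)
      then show ?thesis using Suc.IH[of "\<alpha> * q"] Suc.prems q by (simp add: mult.assoc)
    qed
    moreover have "C_HL w \<alpha> \<le> C_HL w \<beta> * C_HL w \<gamma>"
      using \<beta> Suc.prems(1) unfolding q_def by (intro C_HL_submult[OF iw _ \<gamma> _ _ _ fin\<gamma>]) auto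
    ultimately show ?case using fin\<gamma> by (auto intro: le_less_trans simp: ennreal_mult_less_top)
  qed
  note * = this
  obtain k where "q ^ k > \<gamma> / \<alpha>" using real_arch_pow[OF q] by blast
  then have "\<gamma> \<le> \<alpha> * q ^ k" using \<alpha> by (simp add: field_simps)
  then show ?thesis using *[OF \<alpha>] by blast
qed

text \<open>With \<open>t = 2\<^sup>n\<^sup>+\<^sup>1 (y - x) / x\<close>, submultiplicativity reads \<open>C(x) \<le> C(y) C(1 - t)\<close>. For small \<open>t\<close> the
Solyanik estimate bounds the last factor; for large \<open>t\<close> the points are far apart and
the monotonicity of \<open>C\<close> suffices.\<close>

lemma C_HL_increment:
  fixes w :: "real ^ 'n \<Rightarrow> real"
  assumes w: "w \<in> A_infty" and u: "0 < u"
  defines "p \<equiv> 1 / (2 * real CARD('n) * 2 ^ (CARD('n) + 3) * enn2real (fujii_wilson w))"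
  shows "\<exists>L\<ge>0. \<forall>x y. u \<le> x \<longrightarrow> x < y \<longrightarrow> y < 1 \<longrightarrow>
     enn2real (C_HL w x) - enn2real (C_HL w y) \<le> L * (y - x) powr p"
proof -
  have iw: "is_weight w" using w by (auto simp: A_infty_def)
  have p: "p > 0" using fujii_wilson_ge_1[OF w] by (simp add: p_def)
  obtain \<kappa> C where \<kappa>: "0 < \<kappa>" "\<kappa> < 1" "0 < C"
    and le: "\<And>t. 0 < t \<Longrightarrow> t \<le> \<kappa> \<Longrightarrow> C_HL w (1 - t) \<le> ennreal (1 + C * t powr p)"
    using C_HL_near_one[OF w] unfolding p_def by blast
  define f where "f x = enn2real (C_HL w x)" for x
  have f: "C_HL w x = ennreal (f x)" if "0 < x" for x
    using C_HL_finite[OF w that] by (simp add: f_def)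
  have f0: "f x \<ge> 0" for x by (simp add: f_def)
  have fmono: "f y \<le> f x" if "0 < x" "x \<le> y" for x y
    using C_HL_antimono[OF iw, of x y] that f0 by (simp add: f)
  define A where "A = 2 ^ (CARD('n) + 1) / u"
  have A: "A > 0" using u by (simp add: A_def)
  define B where "B = C + \<kappa> powr (- p)"
  have B: "B \<ge> 0" using \<kappa> by (simp add: B_def)
  have "f x - f y \<le> f u * B * A powr p * (y - x) powr p" if xy: "u \<le> x" "x < y" "y < 1" for x y
  proof -
    define t where "t = 2 ^ (CARD('n) + 1) * ((y - x) / x)"
    have x: "0 < x" using u xy by simp
    have t0: "0 < t" using xy x by (simp add: t_def)
    have tA: "t \<le> A * (y - x)"
    proof -
      have "(y - x) / x \<le> (y - x) / u" using xy u by (intro divide_left_mono) auto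
      then have "t \<le> 2 ^ (CARD('n) + 1) * ((y - x) / u)" unfolding t_def by (rule mult_left_mono) simp
      then show ?thesis by (simp add: A_def)
    qed
    have "f x - f y \<le> f u * (B * t powr p)"
    proof (cases "t \<le> \<kappa>")
      case True
      have e: "x * (1 + (1 - (1 - t)) / 2 ^ (CARD('n) + 1)) = y" using x by (simp add: t_def field_simps)
      have "C_HL w x \<le> C_HL w y * C_HL w (1 - t)"
      proof (rule C_HL_submult[OF iw])
        show "C_HL w (1 - t) < \<infinity>" using True \<kappa> by (intro C_HL_finite[OF w]) simp
        show "y \<le> x * (1 + (1 - (1 - t)) / 2 ^ (CARD('n) + 1))" unfolding e ..
      qed (use True \<kappa> t0 x xy in auto)
      also have "\<dots> \<le> C_HL w y * ennreal (1 + C * t powr p)" by (intro mult_left_mono le t0 True) simp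
      finally have "ennreal (f x) \<le> ennreal (f y * (1 + C * t powr p))"
        using x xy f0 by (simp only: f ennreal_mult')
      moreover have "0 \<le> f y * (1 + C * t powr p)" using f0 \<kappa> by (intro mult_nonneg_nonneg) auto
      ultimately have "f x \<le> f y * (1 + C * t powr p)" by (simp only: ennreal_le_iff)
      then have "f x - f y \<le> f y * (C * t powr p)" by (simp add: algebra_simps)
      also have "\<dots> \<le> f u * (B * t powr p)"
        using fmono[of u y] xy u f0 \<kappa> by (intro mult_mono mult_right_mono) (auto simp: B_def)
      finally show ?thesis .
    next
      case False
      have "1 = \<kappa> powr (- p) * \<kappa> powr p" using \<kappa> by (simp add: powr_minus)
      also have "\<dots> \<le> \<kappa> powr (- p) * t powr p" using False \<kappa> p by (intro mult_left_mono powr_mono2) auto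
      also have "\<dots> \<le> B * t powr p" using \<kappa> by (intro mult_right_mono) (auto simp: B_def)
      finally have "1 \<le> B * t powr p" .
      then have "f u * 1 \<le> f u * (B * t powr p)" using f0 by (rule mult_left_mono)
      moreover have "f x - f y \<le> f u" using fmono[of u x] xy u f0[of y] by simp
      ultimately show ?thesis by simp
    qed
    also have "\<dots> \<le> f u * (B * (A * (y - x)) powr p)"
      using tA t0 p B f0 by (intro mult_left_mono powr_mono2) auto
    also have "(A * (y - x)) powr p = A powr p * (y - x) powr p" using A xy by (simp add: powr_mult)
    finally show ?thesis by (simp add: mult_ac)
  qed
  then show ?thesis
    using f0[of u] B by (intro exI[of _ "f u * B * A powr p"]) (auto simp: f_def)
qed

theorem theorem3:
  shows "\<exists>c::real. c > 0 \<and>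
    (\<forall>w :: real ^ 'n \<Rightarrow> real. w \<in> A_infty \<longrightarrow>
       (\<forall>\<alpha>\<in>{0<..<1}. C_HL w \<alpha> < \<infinity>) \<and>
       (\<lambda>\<alpha>. enn2real (C_HL w \<alpha>))
         \<in> local_holder (inverse (c * enn2real (fujii_wilson w))) {0<..<1})"
proof (intro exI[of _ "2 * real CARD('n) * 2 ^ (CARD('n) + 3)"] conjI allI impI)
  show "0 < 2 * real CARD('n) * 2 ^ (CARD('n) + 3)" by simp
next
  fix w :: "real ^ 'n \<Rightarrow> real" assume w: "w \<in> A_infty"
  then show "\<forall>\<alpha>\<in>{0<..<1}. C_HL w \<alpha> < \<infinity>" using C_HL_finite by auto
next
  fix w :: "real ^ 'n \<Rightarrow> real" assume w: "w \<in> A_infty"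
  have iw: "is_weight w" using w by (auto simp: A_infty_def)
  let ?p = "inverse (2 * real CARD('n) * 2 ^ (CARD('n) + 3) * enn2real (fujii_wilson w))"
  let ?f = "\<lambda>\<alpha>. enn2real (C_HL w \<alpha>)"
  show "?f \<in> local_holder ?p {0<..<1}"
    unfolding local_holder_def
  proof (intro CollectI allI impI)
    fix K :: "real set" assume K: "compact K \<and> K \<subseteq> {0<..<1}"
    show "\<exists>C. \<forall>x\<in>K. \<forall>y\<in>K. \<bar>?f x - ?f y\<bar> \<le> C * \<bar>x - y\<bar> powr ?p"
    proof (cases "K = {}")
      case False
      then obtain u where u: "u \<in> K" "\<And>x. x \<in> K \<Longrightarrow> u \<le> x" using compact_attains_inf[of K] K by blast
      then have u0: "0 < u" using K by auto
      obtain L where L: "L \<ge> 0" "\<And>x y. u \<le> x \<Longrightarrow> x < y \<Longrightarrow> y < 1 \<Longrightarrow> ?f x - ?f y \<le> L * (y - x) powr ?p"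
        using C_HL_increment[OF w u0] unfolding inverse_eq_divide by blast
      have main: "\<bar>?f x - ?f y\<bar> \<le> L * \<bar>x - y\<bar> powr ?p" if "x \<in> K" "y \<in> K" "x < y" for x y
      proof -
        have "?f y \<le> ?f x"
          using that K C_HL_finite[OF w, of x] C_HL_antimono[OF iw, of x y] by (intro enn2real_mono) auto
        moreover have "?f x - ?f y \<le> L * (y - x) powr ?p" using that u(2) K by (intro L(2)) auto
        ultimately show ?thesis using that by simp
      qed
      have "\<bar>?f x - ?f y\<bar> \<le> L * \<bar>x - y\<bar> powr ?p" if "x \<in> K" "y \<in> K" for x y
        using main[of x y] main[of y x] that L(1) by (cases x y rule: linorder_cases) (simp_all add: abs_minus_commute)
      then show ?thesis by blast
    qed simp
  qed
qed

end
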